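(* Let $K\subset\mathbb{R}^2$ be a centrally symmetric convex body, let $N\ge 2$ be an integer, let $r\ge 1$ be real and let $1\le p\le\infty$. Let $Q\subset\mathbb{R}^2$ be a square centered at the origin with $|Q|=|K|$. Then $$\mathbb{E}\,\bigl|Z^{\circ}_{p,N}(K)\bigr|^{-r}\;\le\;\mathbb{E}\,\bigl|Z^{\circ}_{p,N}(Q)\bigr|^{-r}.$$ In particular (letting $N\to\infty$), $$\bigl|(Z_pK)^{\circ}\bigr|\;\ge\;\bigl|(Z_pQ)^{\circ}\bigr|.$$
   Context: A convex body in $\mathbb{R}^2$ is a compact convex set with non-empty interior; it is centrally symmetric if $K=-K$. $|\cdot|$ denotes Lebesgue measure on $\mathbb{R}^2$ (and absolute value for scalars). For a set $L\subset\mathbb{R}^2$, the polar is $L^{\circ}=\{\omega\in\mathbb{R}^2:\langle\omega,x\rangle\le 1\ \ \forall x\in L\}$. The support function of a compact convex set $L$ is $h(L,z)=\max_{x\in L}\langle x,z\rangle$. The $p$-centroid body $Z_pK$ of a convex body $K$ is the convex body with support function $$h(Z_pK,z)=\Bigl(\frac{1}{|K|}\int_K|\langle x,z\rangle|^p\,dx\Bigr)^{1/p}.$$ The empirical $p$-centroid body $Z_{p,N}(K)$ is the random compact convex set with support function given by $$h(Z_{p,N}(K),z)^p=\frac1N\sum_{i=1}^N|\langle X_i,z\rangle|^p,$$ where $X_1,\dots,X_N$ are independent random vectors uniformly distributed in $K$; $Z_{p,N}(Q)$ is defined in the same way with independent random vectors uniformly distributed in $Q$. Write $Z^{\circ}_{p,N}(K)=(Z_{p,N}(K))^{\circ}$.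 For $p=\infty$ these are read in the limiting sense: $h(Z_\infty K,z)=\max_{x\in K}|\langle x,z\rangle|$ and $h(Z_{\infty,N}(K),z)=\max_{1\le i\le N}|\langle X_i,z\rangle|$. Convention: $|L^\circ|^{-r}=0$ if $|L^\circ|=\infty$ (this concerns only a probability-zero event). *)

theory Defs
  imports "HOL-Probability.Probability"
begin

definition convex_body :: "'a::euclidean_space set \<Rightarrow> bool" where
  "convex_body K \<longleftrightarrow> compact K \<and> convex K \<and> interior K \<noteq> {}"

definition centrally_symmetric :: "'a::euclidean_space set \<Rightarrow> bool" where
  "centrally_symmetric K \<longleftrightarrow> uminus ` K = K"

text \<open>Squares centred at the origin, in arbitrary orientation.\<close>

definition centered_square :: "(real^2) set \<Rightarrow> bool" where
  "centered_square Q \<longleftrightarrow>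
     (\<exists>a>0. \<exists>f :: real^2 \<Rightarrow> real^2. orthogonal_transformation f \<and> Q = f ` {x. \<forall>i. \<bar>x $ i\<bar> \<le> a})"

definition polar :: "'a::euclidean_space set \<Rightarrow> 'a set" where
  "polar L = {w. \<forall>x\<in>L. w \<bullet> x \<le> 1}"

definition support_function :: "'a::euclidean_space set \<Rightarrow> 'a \<Rightarrow> real" where
  "support_function L z = (SUP x\<in>L. x \<bullet> z)"

text \<open>The compact convex set with support function \<open>h\<close>. It exists and is unique whenever \<open>h\<close> is
  sublinear. Nonemptiness is required since the supremum of the empty set of reals is
  a junk value.\<close>

definition body_of_support :: "('a::euclidean_space \<Rightarrow> real) \<Rightarrow> 'a set" where
  "body_of_support h =
     (THE L. compact L \<and> convex L \<and> L \<noteq> {} \<and> (\<forall>z. support_function L z = h z))"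

definition centroid_body :: "ennreal \<Rightarrow> 'a::euclidean_space set \<Rightarrow> 'a set" where
  "centroid_body p K = body_of_support (\<lambda>z.
     if p = \<infinity> then (SUP x\<in>K. \<bar>x \<bullet> z\<bar>)
     else (1 / measure lborel K * (LINT x:K|lborel. \<bar>x \<bullet> z\<bar> powr enn2real p))
            powr (1 / enn2real p))"

definition empirical_centroid_body ::
    "ennreal \<Rightarrow> nat \<Rightarrow> (nat \<Rightarrow> 'a::euclidean_space) \<Rightarrow> 'a set" where
  "empirical_centroid_body p N x = body_of_support (\<lambda>z.
     if p = \<infinity> then (MAX i\<in>{1..N}. \<bar>x i \<bullet> z\<bar>)
     else (1 / real N * (\<Sum>i=1..N. \<bar>x i \<bullet> z\<bar> powr enn2real p)) powr (1 / enn2real p))"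

definition vol_powr_neg :: "'a::euclidean_space set \<Rightarrow> real \<Rightarrow> real" where
  "vol_powr_neg S r = (if emeasure lborel S = \<infinity> then 0 else measure lborel S powr (- r))"

definition iid_uniform ::
    "'w measure \<Rightarrow> nat \<Rightarrow> (nat \<Rightarrow> 'w \<Rightarrow> 'a::euclidean_space) \<Rightarrow> 'a set \<Rightarrow> bool" where
  "iid_uniform M N X K \<longleftrightarrow>
     prob_space M \<and> prob_space.indep_vars M (\<lambda>_. borel) X {1..N} \<and>
     (\<forall>i\<in>{1..N}. distr M borel (X i) = uniform_measure lborel K)"

end

theory Submission
  imports Defs "HOL-Library.Multiset"
begin

text \<open>The proof is a symmetric shadow system argument in the spirit of Campi, Colesanti and Gronchi.
  Displacing points \<open>x\<close> to \<open>x + t g(x) e\<close> makes the inverse area of the polar of their (empirical) centroid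
  body a convex function of \<open>t\<close>, a form of Busemann's theorem: fibring the polar along the
  direction orthogonal to \<open>e\<close> reduces it to the one-dimensional Brunn-Minkowski inequality. If
  \<open>K\<close> is a centrally symmetric polygon, that is, a zonogon, moving one of its vertices (and the opposite one) parallel
  to the line through the neighbouring vertices is such a displacement by area-preserving shears of
  the two corners cut off. At both ends of the motion an edge direction disappears, so by convexity one
  of the two zonogons with fewer edges has a functional value at least that of \<open>K\<close>. One ends with a parallelogram,
  a linear image of \<open>Q\<close>. General bodies are squeezed between zonogons \<open>Z\<close> with \<open>K \<subseteq> Z \<subseteq> (1 + \<eta>) K\<close>.
  Applying the same argument directly to the deterministic functional gives the second
  inequality without a law of large numbers.\<close>

section \<open>Zonogons and vertex motions\<close>

text \<open>The functional is an expectation over random points, but it has to be compared along a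
  motion of \<open>K\<close> itself. This is possible because the displacement in
  \<open>cap_shear\<close> depends only on the point that it moves: applied to every point of a
  sample it is a shadow system for each fixed outcome, and since the map preserves area, moved
  uniform points are uniform in the moved body. Convexity for each outcome can then be integrated.
  All polars are treated as unit balls of support functions; the convex bodies behind them appear
  only in the translation of the statement. The geometry of a moving vertex is done for an abstract
  alternating form, so that the motion in the opposite direction is the same lemma for
  \<open>- cross2\<close>.\<close>

locale alternating_form =
  fixes X :: "'a::real_vector \<Rightarrow> 'a \<Rightarrow> real"
  assumes add_left: "X (a + b) c = X a c + X b c"
    and scale_left: "X (r *\<^sub>R a) c = r * X a c"
    and anti: "X a b = - X b a"
    \<comment> \<open>The Pluecker relation holds for forms of rank at most two. It is Cramer's rule
      without a choice of coordinates, and the only axiom in which the dimension shows.\<close>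
    and pluecker: "X a b * X c d - X a c * X b d + X a d * X b c = 0"
begin

lemma add_right: "X c (a + b) = X c a + X c b"
  using add_left[of a b c] anti[of c] by simp

lemma scale_right: "X c (r *\<^sub>R a) = r * X c a"
  using scale_left[of r a c] anti[of c] by simp

lemma self [simp]: "X a a = 0"
  using anti[of a a] by simp

lemma zero_left [simp]: "X 0 a = 0"
  using scale_left[of 0 a a] by simp

lemma zero_right [simp]: "X a 0 = 0"
  using anti[of a 0] by simp

lemma minus_left: "X (- a) c = - X a c"
  using scale_left[of "-1" a c] by simp

lemma minus_right: "X c (- a) = - X c a"
  using scale_right[of c "-1" a] by simp

lemma diff_left: "X (a - b) c = X a c - X b c"
  using add_left[of a "- b" c] minus_left[of b c] by simp

lemma diff_right: "X c (a - b) = X c a - X c b"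
  using add_right[of c a "- b"] minus_right[of c b] by simp

lemmas bilinear = add_left add_right scale_left scale_right minus_left minus_right diff_left diff_right

lemma sum_mset_right: "X a (\<Sum>\<^sub># R) = (\<Sum>v\<in>#R. X a v)"
  by (induction R) (simp_all add: add_right)

lemma abs_sum_mset_right_le: "\<bar>X a (\<Sum>\<^sub># R)\<bar> \<le> (\<Sum>v\<in>#R. \<bar>X a v\<bar>)"
  by (induction R) (simp_all add: add_right)

lemma sum_mset_abs_eq:
  assumes "\<And>v. v \<in># R \<Longrightarrow> 0 \<le> X a v"
  shows "(\<Sum>v\<in>#R. \<bar>X a v\<bar>) = X a (\<Sum>\<^sub># R)"
  using assms by (induction R) (simp_all add: add_right)

text \<open>For generators that span the plane this is the Minkowski sum of the segments from
  \<open>- w\<close> to \<open>w\<close>, described by its edges: each edge is parallel to a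
  generator, and the right-hand side is the support value of the sum across that generator.\<close>

definition zonogon :: "'a multiset \<Rightarrow> 'a set" where
  "zonogon W = {x. \<forall>w\<in>#W. \<bar>X w x\<bar> \<le> (\<Sum>v\<in>#W. \<bar>X w v\<bar>)}"

text \<open>For \<open>0 \<le> h\<close> the middle strip of half-width \<open>h\<close> stays
  fixed, and each cap beyond it is sheared along \<open>e\<close> in proportion to the height above
  the strip. The displacement is linear in \<open>t\<close>, which makes this a shadow system, and
  odd in \<open>x\<close>, which preserves central symmetry.\<close>

definition cap_shear :: "'a \<Rightarrow> real \<Rightarrow> real \<Rightarrow> 'a \<Rightarrow> 'a" where
  "cap_shear e h t x = x + (t * (max 0 (X e x - h) - max 0 (- X e x - h))) *\<^sub>R e"

lemma cap_shear_height [simp]: "X e (cap_shear e h t x) = X e x"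
  by (simp add: cap_shear_def bilinear)

lemma cap_shear_inverse [simp]: "cap_shear e h (- t) (cap_shear e h t x) = x"
  unfolding cap_shear_def[of e h "-t"] cap_shear_height by (simp add: cap_shear_def)

lemma cap_shear_uminus: "cap_shear e h t (- x) = - cap_shear e h t x"
  by (simp add: cap_shear_def bilinear algebra_simps)

lemma zonogon_uminus: "- x \<in> zonogon W \<longleftrightarrow> x \<in> zonogon W"
  by (simp add: zonogon_def bilinear)

text \<open>Moving the top vertex of a zonogon parallel to the line through its neighbours replaces the
  generators \<open>p, q\<close> at that vertex by \<open>p + t e, q - t e\<close> where \<open>e = p + q\<close>. The motion ends when the second of
  them becomes parallel to the next generator \<open>k\<close>; \<open>l\<close> is the generator next to \<open>p\<close> on the other side.\<close>

lemma cap_shear_zonogon: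
  fixes p q k l :: 'a
  defines "e \<equiv> p + q"
  assumes D: "0 < X p q"
    and R: "R = add_mset k R0" and l: "l \<in># R"
    and pos: "\<And>w. w \<in># R \<Longrightarrow> 0 < X p w" "\<And>w. w \<in># R \<Longrightarrow> 0 < X q w"
    and first: "\<And>w. w \<in># R \<Longrightarrow> 0 \<le> X k w" and last: "\<And>w. w \<in># R \<Longrightarrow> 0 \<le> X w l"
    and t: "0 \<le> t" and \<mu>: "0 < \<mu>" "q - t *\<^sub>R e = \<mu> *\<^sub>R k"
  shows "cap_shear e (X e (\<Sum>\<^sub># R)) (- t / X p q) ` zonogon (add_mset p (add_mset q R))
       = zonogon (add_mset (p + t *\<^sub>R e) (add_mset ((1 + \<mu>) *\<^sub>R k) R0))"
proof -
  define D where "D = X p q"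
  have Dpos: "D > 0" using D by (simp add: D_def)
  \<comment> \<open>\<open>C\<close> sums with signs and \<open>S\<close> with absolute values. They
    agree where all remaining generators lie on one side, as for \<open>p\<close>, \<open>q\<close>
    and \<open>k\<close>, and are opposite for the last generator \<open>l\<close>.\<close>
  define C where "C = (\<lambda>w. X w (\<Sum>\<^sub># R))"
  define S where "S = (\<lambda>w. \<Sum>v\<in>#R. \<bar>X w v\<bar>)"
  have S_fold: "(\<Sum>v\<in>#R. \<bar>X w v\<bar>) = S w" for w by (simp add: S_def)
  define p' where "p' = p + t *\<^sub>R e"
  define Z1 where "Z1 = zonogon (add_mset p (add_mset q R))"
  define Z2 where "Z2 = zonogon (add_mset p' (add_mset ((1 + \<mu>) *\<^sub>R k) R0))"
  define h0 where "h0 = C e"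
  have kR: "k \<in># R" using R by simp
  have Xqp: "X q p = - D" using anti[of q p] by (simp add: D_def)
  have Xe: "X e x = X p x + X q x" for x by (simp add: e_def bilinear)
  have Ce: "h0 = C p + C q" by (simp add: h0_def C_def Xe)
  have CS: "\<bar>C w\<bar> \<le> S w" for w unfolding C_def S_def by (rule abs_sum_mset_right_le)
  have S_eq: "S a = C a" if "\<And>v. v \<in># R \<Longrightarrow> 0 \<le> X a v" for a
    unfolding S_def C_def using sum_mset_abs_eq that by blast
  have Sp: "S p = C p" and Sq: "S q = C q" and Sk: "S k = C k"
    using S_eq pos first by (auto intro: less_imp_le)
  have Cpos: "0 \<le> C p" "0 \<le> C q" using Sp Sq CS[of p] CS[of q] by auto
  have h0: "0 \<le> h0" using Ce Cpos by simp
  have Sl: "S l = - C l"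
  proof -
    have "S l = (\<Sum>v\<in>#R. \<bar>X (- l) v\<bar>)" unfolding S_def by (simp add: minus_left)
    also have "\<dots> = - C l"
      unfolding C_def using last anti[of l] by (subst sum_mset_abs_eq) (simp_all add: minus_left)
    finally show ?thesis .
  qed
  \<comment> \<open>Cramer's rule: each \<open>X w\<close> is a combination of the two coordinates
    \<open>X p\<close> and \<open>X q\<close>, in which the inequalities are compared.\<close>
  have key: "D * X w x = X p w * X q x - X q w * X p x" for w x
    using pluecker[of p q w x] by (simp add: D_def algebra_simps)
  have keyC: "D * C w = X p w * C q - X q w * C p" for w
    using key by (simp add: C_def)
  have q': "X q w - t * X e w = \<mu> * X k w" for w
    using arg_cong[OF \<mu>(2), of "\<lambda>v. X v w"] by (simp add: bilinear)
  have q'': "X q w - t * (X p w + X q w) = \<mu> * X k w" for w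
    using q' Xe by simp
  \<comment> \<open>The moving generator \<open>q - t e\<close> has just reached the direction of
    \<open>k\<close>, so it is not yet past any remaining generator.\<close>
  have q'pos: "0 \<le> X q w - t * (X p w + X q w)" if "w \<in># R" for w
    using q'' first[OF that] \<mu>(1) by simp
  have p'k: "\<mu> * X p' k = D"
  proof -
    have "\<mu> * X p' k = X p' (q - t *\<^sub>R e)" by (simp add: \<mu>(2) scale_right)
    also have "\<dots> = D" by (simp add: p'_def e_def bilinear Xqp flip: D_def)
    finally show ?thesis .
  qed
  have ek: "\<mu> * X e k = D"
    using q'[of q] q'[of e] Xqp anti[of e k] anti[of e q] Xe[of q] D_def by (simp)
  have Xwe: "X w e = - (X p w + X q w)" for w using anti[of w e] Xe by simp
  have in1: "x \<in> Z1 \<longleftrightarrow> \<bar>X p x\<bar> \<le> C p + D \<and> \<bar>X q x\<bar> \<le> C q + D \<and>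
      (\<forall>w\<in>#R. \<bar>X w x\<bar> \<le> X p w + X q w + S w)" for x
  proof -
    have "\<bar>X w p\<bar> + (\<bar>X w q\<bar> + S w) = X p w + X q w + S w" if "w \<in># R" for w
      using pos[OF that] anti[of w p] anti[of w q] by simp
    then show ?thesis
      using Dpos by (simp add: Z1_def zonogon_def S_fold Sp Sq Xqp flip: D_def) (auto simp: ac_simps)
  qed
  have p'w: "X p' w = X p w + t * (X p w + X q w)" for w
    by (simp add: p'_def bilinear Xe)
  have p'pos: "0 \<le> X p' w" if "w \<in># R" for w
    using pos[OF that] t by (simp add: p'w)
  have S_R: "S a = \<bar>X a k\<bar> + (\<Sum>v\<in>#R0. \<bar>X a v\<bar>)" for a by (simp add: S_def R)
  have sum2: "(\<Sum>v\<in>#add_mset p' (add_mset ((1 + \<mu>) *\<^sub>R k) R0). \<bar>X a v\<bar>) = \<bar>X a p'\<bar> + \<mu> * \<bar>X a k\<bar> + S a" for a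
  proof -
    have "\<bar>X a ((1 + \<mu>) *\<^sub>R k)\<bar> = (1 + \<mu>) * \<bar>X a k\<bar>" using \<mu>(1) by (simp add: scale_right abs_mult)
    then show ?thesis by (simp add: S_R distrib_right)
  qed
  \<comment> \<open>The new pair \<open>p'\<close> and \<open>\<mu> k\<close> still sums to
    \<open>e\<close>, and \<open>w\<close> lies on the same side of both. The strips of the
    remaining generators therefore keep their widths; only those of \<open>p\<close> and
    \<open>q\<close> change.\<close>
  have sum2w: "\<bar>X w p'\<bar> + \<mu> * \<bar>X w k\<bar> + S w = X p w + X q w + S w" if "w \<in># R" for w
    using p'pos[OF that] first[OF that] anti[of w p'] anti[of w k] q''[of w] p'w[of w] by simp
  have Cp': "C p' = C p + t * h0" by (simp add: C_def p'w Ce)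
  have in2: "x \<in> Z2 \<longleftrightarrow> \<bar>X p' x\<bar> \<le> C p + t * h0 + D \<and>
      (\<forall>w\<in>#R. \<bar>X w x\<bar> \<le> X p w + X q w + S w)" for x
  proof -
    have A: "\<bar>X p' p'\<bar> + \<mu> * \<bar>X p' k\<bar> + S p' = C p + t * h0 + D"
      using p'k p'pos[OF kR] S_eq[OF p'pos] Cp' by simp
    have B: "\<bar>X ((1 + \<mu>) *\<^sub>R k) x\<bar> \<le> \<bar>X ((1 + \<mu>) *\<^sub>R k) p'\<bar> + \<mu> * \<bar>X ((1 + \<mu>) *\<^sub>R k) k\<bar> + S ((1 + \<mu>) *\<^sub>R k)
        \<longleftrightarrow> \<bar>X k x\<bar> \<le> X p k + X q k + S k"
    proof -
      have "S ((1 + \<mu>) *\<^sub>R k) = (1 + \<mu>) * S k"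
        using \<mu>(1) by (simp add: S_def scale_left abs_mult sum_mset_distrib_left)
      then have "\<bar>X ((1 + \<mu>) *\<^sub>R k) p'\<bar> + \<mu> * \<bar>X ((1 + \<mu>) *\<^sub>R k) k\<bar> + S ((1 + \<mu>) *\<^sub>R k)
          = (1 + \<mu>) * (\<bar>X k p'\<bar> + \<mu> * \<bar>X k k\<bar> + S k)"
        using \<mu>(1) by (simp add: scale_left abs_mult distrib_left)
      also have "\<dots> = (1 + \<mu>) * (X p k + X q k + S k)" by (simp only: sum2w[OF kR])
      finally show ?thesis
        using \<mu>(1) by (simp add: scale_left abs_mult)
    qed
    have "x \<in> Z2 \<longleftrightarrow> (\<forall>w\<in>#add_mset p' (add_mset ((1 + \<mu>) *\<^sub>R k) R0).
        \<bar>X w x\<bar> \<le> \<bar>X w p'\<bar> + \<mu> * \<bar>X w k\<bar> + S w)"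
      unfolding Z2_def zonogon_def sum2 by simp
    also have "\<dots> \<longleftrightarrow> \<bar>X p' x\<bar> \<le> C p + t * h0 + D \<and> \<bar>X k x\<bar> \<le> X p k + X q k + S k \<and>
        (\<forall>w\<in>#R0. \<bar>X w x\<bar> \<le> \<bar>X w p'\<bar> + \<mu> * \<bar>X w k\<bar> + S w)"
      unfolding A[symmetric] B[symmetric] by auto
    also have "(\<forall>w\<in>#R0. \<bar>X w x\<bar> \<le> \<bar>X w p'\<bar> + \<mu> * \<bar>X w k\<bar> + S w) \<longleftrightarrow>
        (\<forall>w\<in>#R0. \<bar>X w x\<bar> \<le> X p w + X q w + S w)"
      using sum2w R by auto
    finally show ?thesis by (auto simp: R)
  qed
  \<comment> \<open>The top vertex is \<open>q - p\<close> plus the sum of \<open>R\<close>. It lies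
    \<open>2 D\<close> above its neighbours, which are at height \<open>h0\<close>, and it has to
    move by \<open>- 2 t e\<close>; hence the shear coefficient \<open>- t / D\<close>.\<close>
  define f where "f = cap_shear e h0 (- t / D)"
  define g where "g = cap_shear e h0 (t / D)"
  have fx: "X w (f x) = X w x + t / D * (max 0 (X e x - h0) - max 0 (- X e x - h0)) * (X p w + X q w)" for w x
    by (simp add: f_def cap_shear_def bilinear Xwe) (simp add: algebra_simps diff_divide_distrib)
  have gx: "X w (g x) = X w x - t / D * (max 0 (X e x - h0) - max 0 (- X e x - h0)) * (X p w + X q w)" for w x
    by (simp add: g_def cap_shear_def bilinear Xwe) (simp add: algebra_simps diff_divide_distrib)
  have fwd: "f x \<in> Z2" if x: "x \<in> Z1" and h: "0 \<le> X e x" for x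
  proof -
    define h where "h = X e x"
    have P: "X p x = h - X q x" by (simp add: h_def Xe)
    show ?thesis
    proof (cases "h \<le> h0")
      case True
      have "X w (f x) = X w x" for w unfolding fx using True h by (simp add: h_def)
      moreover have "0 \<le> t * h" "t * h \<le> t * h0" using t h True by (auto simp: h_def mult_left_mono)
      ultimately show ?thesis
        using x unfolding in1 in2 by (auto simp: p'w P algebra_simps)
    next
      case False
      define b where "b = t * (h - h0)"
      have b: "0 \<le> b" using t False by (simp add: b_def)
      have fw: "X w (f x) = X w x + b / D * (X p w + X q w)" for w
        unfolding fx using False h h0 by (simp add: h_def b_def)
      have "X p p' + X q p' = - D"
        by (simp add: p'_def e_def bilinear Xqp flip: D_def)
      then have "X p' (f x) = X p' x - b" using Dpos unfolding fw by simp
      also have "\<dots> = X p x + t * h0" by (simp add: p'w P b_def algebra_simps)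
      finally have "X p' (f x) = X p x + t * h0" .
      \<comment> \<open>In the upper cap the shear does not decrease \<open>X w\<close>, so only the
        upper bound is in question. It combines the bound on \<open>X q x\<close> with the height
        above \<open>h0\<close>, using that \<open>w\<close> is not on the negative side of
        \<open>q - t e\<close>.\<close>
      moreover have "\<bar>X w (f x)\<bar> \<le> X p w + X q w + S w" if w: "w \<in># R" for w
      proof -
        define a where "a = X p w + X q w"
        have a: "0 < a" using pos[OF w] by (simp add: a_def)
        have "a * X q x \<le> a * (C q + D)" using a x unfolding in1 by (intro mult_left_mono) auto
        moreover have "0 \<le> (X q w - t * a) * (h - h0)" using q'pos[OF w] False by (simp add: a_def)
        moreover have "D * X w (f x) = a * X q x - X q w * h + b * a"
        proof -
          have "D * X w (f x) = D * X w x + b * a" using Dpos unfolding fw a_def[symmetric] by (simp add: distrib_left)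
          also have "D * X w x = a * X q x - X q w * h" unfolding key P by (simp add: a_def algebra_simps)
          finally show ?thesis .
        qed
        moreover have "a * C q - X q w * h0 = D * C w" unfolding keyC Ce by (simp add: a_def algebra_simps)
        ultimately have "D * X w (f x) \<le> D * (a + C w)" unfolding b_def by (simp add: algebra_simps)
        then have "X w (f x) \<le> a + C w" using Dpos by simp
        moreover have "0 \<le> b / D * a" using a b Dpos by simp
        ultimately show ?thesis using x w CS[of w] unfolding in1 fw by (fastforce simp: a_def)
      qed
      moreover have "0 \<le> t * h0" using t h0 by simp
      ultimately show ?thesis using x unfolding in2 in1 by auto
    qed
  qed
  have bwd: "g y \<in> Z1" if y: "y \<in> Z2" and h: "0 \<le> X e y" for y
  proof -
    define h where "h = X e y"
    have P: "X p y = h - X q y" by (simp add: h_def Xe)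
    \<comment> \<open>The strip of \<open>q\<close> is absent from the description of
      \<open>Z2\<close>; it is recovered from that of \<open>k\<close>, since
      \<open>q - t e = \<mu> k\<close>.\<close>
    have qy: "\<bar>X q y - t * h\<bar> \<le> D + C q - t * h0"
    proof -
      have "\<bar>X q y - t * h\<bar> = \<mu> * \<bar>X k y\<bar>" using q'[of y] \<mu>(1) by (simp add: h_def abs_mult)
      also have "\<dots> \<le> \<mu> * (X e k + S k)" using y kR \<mu>(1) unfolding in2 by (intro mult_left_mono) (auto simp: Xe)
      also have "\<dots> = D + \<mu> * C k" by (simp add: distrib_left ek Sk)
      also have "\<mu> * C k = C q - t * h0" using q'[of "\<Sum>\<^sub># R"] by (simp add: C_def h0_def)
      finally show ?thesis by simp
    qed
    have py: "\<bar>X p y + t * h\<bar> \<le> C p + t * h0 + D" using y unfolding in2 by (simp add: p'w h_def Xe)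
    show ?thesis
    proof (cases "h \<le> h0")
      case True
      have gy: "X w (g y) = X w y" for w unfolding gx using True h by (simp add: h_def)
      have th: "t * h \<le> t * h0" "- (t * h0) \<le> t * h" using t h h0 True by (auto simp: h_def mult_left_mono intro: order_trans[of _ 0])
      \<comment> \<open>Below height \<open>h0\<close> the bound for \<open>p\<close> follows from
        the strip of \<open>l\<close>: the edge line of \<open>l\<close> meets the line of height
        \<open>h0\<close> in the vertex \<open>p + q\<close> plus the sum of \<open>R\<close>, where
        \<open>X p\<close> equals \<open>C p + D\<close>.\<close>
      have pbound: "X p z \<le> C p + D" if z: "X l z \<ge> - (X p l + X q l + S l)" "X e z \<le> h0" for z
      proof -
        define a where "a = X p l + X q l"
        have a: "0 < a" using pos[OF l] by (simp add: a_def)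
        have "D * (- (a + S l)) \<le> D * X l z" using z(1) Dpos by (intro mult_left_mono) (auto simp: a_def)
        moreover have "D * X l z = X p l * X e z - a * X p z" unfolding key by (simp add: a_def Xe algebra_simps)
        moreover have "X p l * X e z \<le> X p l * h0" using z(2) pos(1)[OF l] by (intro mult_left_mono) auto
        moreover have "X p l * h0 - a * C p = D * C l" unfolding keyC Ce by (simp add: a_def algebra_simps)
        ultimately have "a * X p z \<le> a * (C p + D)" by (simp add: Sl algebra_simps)
        then show ?thesis using a by simp
      qed
      have "X p y \<le> C p + D" using y l True unfolding in2 by (intro pbound) (auto simp: h_def abs_le_iff minus_le_iff)
      moreover have "X p (- y) \<le> C p + D"
        using y l h h0 unfolding in2 by (intro pbound) (auto simp: h_def minus_right abs_le_iff)
      ultimately have "\<bar>X p y\<bar> \<le> C p + D" by (simp add: minus_right)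
      moreover have "\<bar>X q y\<bar> \<le> C q + D" using qy th by (auto simp: abs_le_iff)
      ultimately show ?thesis using y unfolding in1 in2 gy by simp
    next
      case False
      define b where "b = t * (h - h0)"
      have b: "0 \<le> b" using t False by (simp add: b_def)
      have gw: "X w (g y) = X w y - b / D * (X p w + X q w)" for w
        unfolding gx using False h h0 by (simp add: h_def b_def)
      have gp: "X p (g y) = X p y + b" using Dpos unfolding gw by (simp add: Xqp flip: D_def)
      have gq: "X q (g y) = X q y - b" using Dpos unfolding gw by (simp flip: D_def)
      have gpq: "X p (g y) + X q (g y) = h" by (simp add: gp gq P)
      have g1: "X p (g y) \<le> C p + D" using py by (simp add: gp b_def algebra_simps)
      have g2: "X q (g y) \<le> C q + D" using qy by (simp add: gq b_def algebra_simps)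
      have "\<bar>X p (g y)\<bar> \<le> C p + D" "\<bar>X q (g y)\<bar> \<le> C q + D"
        using g1 g2 gpq False Cpos Ce by (auto simp: abs_le_iff)
      moreover have "\<bar>X w (g y)\<bar> \<le> X p w + X q w + S w" if w: "w \<in># R" for w
      proof -
        define a where "a = X p w + X q w"
        have a: "0 < a" using pos[OF w] by (simp add: a_def)
        have "D * X w (g y) = X p w * h - a * X p (g y)"
          unfolding key gpq[symmetric] by (simp add: a_def algebra_simps)
        moreover have "X p w * h0 \<le> X p w * h" using False pos(1)[OF w] by (intro mult_left_mono) auto
        moreover have "a * X p (g y) \<le> a * (C p + D)" using g1 a by (intro mult_left_mono) auto
        moreover have "X p w * h0 - a * C p = D * C w" unfolding keyC Ce by (simp add: a_def algebra_simps)
        ultimately have "D * (C w - a) \<le> D * X w (g y)" by (simp add: algebra_simps)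
        then have "C w - a \<le> X w (g y)" using Dpos by simp
        moreover have "0 \<le> b / D * a" using a b Dpos by simp
        ultimately show ?thesis using y w CS[of w] unfolding in2 gw by (fastforce simp: a_def)
      qed
      ultimately show ?thesis unfolding in1 by simp
    qed
  qed
  \<comment> \<open>Points of negative height are reflected in the origin.\<close>
  have fwd': "f x \<in> Z2" if "x \<in> Z1" for x
    using fwd[of x] fwd[of "- x"] that zonogon_uminus[of x] zonogon_uminus[of "f x"]
    by (cases "0 \<le> X e x") (auto simp: Z1_def Z2_def f_def cap_shear_uminus minus_right)
  have bwd': "g x \<in> Z1" if "x \<in> Z2" for x
    using bwd[of x] bwd[of "- x"] that zonogon_uminus[of x] zonogon_uminus[of "g x"]
    by (cases "0 \<le> X e x") (auto simp: Z1_def Z2_def g_def cap_shear_uminus minus_right)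
  have fg: "f (g y) = y" for y
    using cap_shear_inverse[of e h0 "t / D" y] by (simp add: f_def g_def)
  have "f ` Z1 = Z2"
    using fwd' bwd' fg by (auto intro!: image_eqI[of _ f "g _"])
  then show ?thesis
    by (simp add: Z1_def Z2_def f_def h0_def C_def D_def p'_def)
qed

end

section \<open>Area-scaling maps of the plane\<close>

definition cross2 :: "real^2 \<Rightarrow> real^2 \<Rightarrow> real" where
  "cross2 a b = a $ 1 * b $ 2 - a $ 2 * b $ 1"

interpretation cross2: alternating_form cross2
  by unfold_locales (simp_all add: cross2_def algebra_simps)

abbreviation "zonogon \<equiv> cross2.zonogon"
abbreviation "cap_shear \<equiv> cross2.cap_shear"

text \<open>Stated for images under homeomorphisms, so that linear maps and the piecewise affine cap
  shears are covered together and images of Borel and compact sets stay Borel and compact.\<close>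

definition area_scaling :: "real \<Rightarrow> (real^2 \<Rightarrow> real^2) \<Rightarrow> bool" where
  "area_scaling c T \<longleftrightarrow> 0 < c \<and> (\<exists>S. homeomorphism UNIV UNIV T S) \<and>
     (\<forall>A\<in>sets borel. emeasure lborel (T ` A) = ennreal c * emeasure lborel A)"

lemma homeomorphism_UNIV_image_borel:
  fixes T S :: "'a::topological_space \<Rightarrow> 'a"
  assumes "homeomorphism UNIV UNIV T S" and "A \<in> sets borel"
  shows "T ` A \<in> sets borel"
proof -
  have "T ` A = S -` A"
    using assms(1) by (force simp: homeomorphism_def)
  moreover have "S \<in> borel_measurable borel"
    using assms(1) by (intro borel_measurable_continuous_onI) (simp add: homeomorphism_def)
  ultimately show ?thesis using measurable_sets_borel[of S borel A] assms(2) by simp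
qed

lemma homeomorphism_UNIV_I:
  assumes "continuous_on UNIV T" "continuous_on UNIV S" "\<And>x. S (T x) = x" "\<And>x. T (S x) = x"
  shows "homeomorphism UNIV UNIV T S"
  using assms unfolding homeomorphism_def by (metis UNIV_I UNIV_eq_I rangeI)

text \<open>Lebesgue measure is determined by its values on boxes; this is applied to the image of
  Lebesgue measure under \<open>S\<close>, rescaled by \<open>1 / c\<close>.\<close>

lemma area_scalingI:
  assumes T: "homeomorphism UNIV UNIV T S" and c: "0 < c"
    and box: "\<And>l u. emeasure lborel (T ` box l u) = ennreal c * emeasure lborel (box l u)"
  shows "area_scaling c T"
proof -
  have TS: "T ` A = S -` A" for A
    using T by (force simp: homeomorphism_def)
  have S[measurable]: "S \<in> borel_measurable borel"
    using T by (intro borel_measurable_continuous_onI) (simp add: homeomorphism_def)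
  define N where "N = scale_measure (ennreal (1 / c)) (distr lborel borel S)"
  have N: "emeasure N A = ennreal (1 / c) * emeasure lborel (T ` A)" if "A \<in> sets borel" for A
    using that by (simp add: N_def emeasure_distr TS)
  have "lborel = N"
  proof (rule lborel_eqI)
    fix l u :: "real^2" assume "\<And>b. b \<in> Basis \<Longrightarrow> l \<bullet> b \<le> u \<bullet> b"
    then show "emeasure N (box l u) = ennreal (\<Prod>b\<in>Basis. (u - l) \<bullet> b)"
      using c by (simp add: N box emeasure_lborel_box flip: ennreal_mult' mult.assoc)
  qed (simp add: N_def)
  then have "emeasure lborel A = ennreal (1 / c) * emeasure lborel (T ` A)" if "A \<in> sets borel" for A
    using N that by simp
  then have "emeasure lborel (T ` A) = ennreal c * emeasure lborel A" if "A \<in> sets borel" for A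
    using that c by (simp flip: ennreal_mult' mult.assoc)
  then show ?thesis using T c by (auto simp: area_scaling_def)
qed

lemma area_scaling_distr:
  assumes "area_scaling c T"
  shows "T \<in> borel_measurable borel" "inj T"
    and "A \<in> sets borel \<Longrightarrow> T ` A \<in> sets borel"
    and "A \<in> sets borel \<Longrightarrow> emeasure lborel (T ` A) = ennreal c * emeasure lborel A"
    and "A \<in> sets borel \<Longrightarrow> emeasure lborel (T -` A) = ennreal (1 / c) * emeasure lborel A"
    and "compact K \<Longrightarrow> compact (T ` K)"
proof -
  obtain S where S: "homeomorphism UNIV UNIV T S" using assms by (auto simp: area_scaling_def)
  have c: "0 < c" using assms by (auto simp: area_scaling_def)
  show 1: "T \<in> borel_measurable borel"
    using S by (intro borel_measurable_continuous_onI) (simp add: homeomorphism_def)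
  show "inj T" using S by (metis UNIV_I homeomorphism_apply1 injI)
  show "A \<in> sets borel \<Longrightarrow> T ` A \<in> sets borel" by (rule homeomorphism_UNIV_image_borel[OF S])
  show em: "emeasure lborel (T ` A) = ennreal c * emeasure lborel A" if "A \<in> sets borel" for A
    using assms that by (simp add: area_scaling_def)
  have "T -` A \<in> sets borel" if "A \<in> sets borel"
    using measurable_sets_borel[OF 1 that] .
  moreover have "T ` (T -` A) = A" using S by (force simp: homeomorphism_def)
  ultimately show "emeasure lborel (T -` A) = ennreal (1 / c) * emeasure lborel A" if "A \<in> sets borel"
    using em[of "T -` A"] that c by (simp flip: ennreal_mult' mult.assoc)
  show "compact (T ` K)" if "compact K"
    using S that by (meson compact_continuous_image continuous_on_subset homeomorphism_def subset_UNIV)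
qed

lemma emeasure_affine_image:
  fixes B :: "(real^'n::{finite,wellorder}) set"
  assumes B: "B \<in> sets borel" "bounded B" and L: "linear L"
    and eq: "\<And>x. x \<in> B \<Longrightarrow> T x = v + L x" and TB: "T ` B \<in> sets borel"
  shows "emeasure lborel (T ` B) = ennreal \<bar>det (matrix L)\<bar> * emeasure lborel B"
proof -
  have B': "B \<in> lmeasurable" using B
    by (intro bounded_set_imp_lmeasurable) auto
  have im: "T ` B = (+) v ` L ` B" using eq by (auto simp: image_iff)
  have LB: "L ` B \<in> lmeasurable" by (rule measurable_linear_image[OF L B'])
  then have TB': "T ` B \<in> lmeasurable" unfolding im by (rule measurable_translation)
  have "measure lebesgue (T ` B) = \<bar>det (matrix L)\<bar> * measure lebesgue B"
    unfolding im measure_translation using measure_linear_image[OF L B'] .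
  then have "emeasure lebesgue (T ` B) = ennreal \<bar>det (matrix L)\<bar> * emeasure lebesgue B"
    using TB' B' by (simp add: emeasure_eq_measure2 ennreal_mult)
  then show ?thesis using B TB by simp
qed

lemma area_scaling_linear:
  fixes T :: "real^2 \<Rightarrow> real^2"
  assumes T: "linear T" and det: "det (matrix T) \<noteq> 0"
  shows "area_scaling \<bar>det (matrix T)\<bar> T"
proof -
  have inj: "inj T" using det_nz_iff_inj T det by blast
  then obtain S where S: "linear S" "\<And>x. S (T x) = x" "\<And>x. T (S x) = x"
    using linear_injective_isomorphism[OF T] by metis
  have hom: "homeomorphism UNIV UNIV T S"
    using S T by (intro homeomorphism_UNIV_I) (auto simp: linear_continuous_on linear_conv_bounded_linear)
  show ?thesis
  proof (rule area_scalingI[OF hom])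
    fix l u :: "real^2"
    show "emeasure lborel (T ` box l u) = ennreal \<bar>det (matrix T)\<bar> * emeasure lborel (box l u)"
      by (rule emeasure_affine_image[where v = 0, OF _ _ T])
         (simp_all add: homeomorphism_UNIV_image_borel[OF hom])
  qed (use det in simp)
qed

lemma area_scaling_homothety:
  assumes c: "0 < c"
  shows "area_scaling (c\<^sup>2) (\<lambda>x. c *\<^sub>R x)"
proof -
  have "linear (\<lambda>x::real^2. c *\<^sub>R x)" by (auto intro: linearI simp: algebra_simps)
  moreover have "det (matrix (\<lambda>x::real^2. c *\<^sub>R x)) = c\<^sup>2" by (simp add: det_2 matrix_def axis_def power2_eq_square)
  ultimately show ?thesis using c area_scaling_linear[of "\<lambda>x. c *\<^sub>R x"] by simp
qed

lemma continuous_on_cross2 [continuous_intros]: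
  "continuous_on A f \<Longrightarrow> continuous_on A g \<Longrightarrow> continuous_on A (\<lambda>x. cross2 (f x) (g x))"
  unfolding cross2_def by (intro continuous_intros)

lemma continuous_on_cap_shear: "continuous_on A (cap_shear e h t)"
  unfolding cross2.cap_shear_def by (intro continuous_intros)

lemma emeasure_Un3:
  assumes "A \<in> sets M" "B \<in> sets M" "C \<in> sets M" "A \<inter> B = {}" "(A \<union> B) \<inter> C = {}"
  shows "emeasure M (A \<union> B \<union> C) = emeasure M A + emeasure M B + emeasure M C"
proof -
  have "emeasure M (A \<union> B \<union> C) = emeasure M (A \<union> B) + emeasure M C"
    using assms by (intro plus_emeasure[symmetric]) auto
  also have "emeasure M (A \<union> B) = emeasure M A + emeasure M B"
    using assms by (intro plus_emeasure[symmetric]) auto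
  finally show ?thesis .
qed

text \<open>On each cap the map is a translate of the transvection with direction \<open>e\<close>,
  which has determinant 1, and in between it is the identity. The images of the pieces stay disjoint
  because the heights \<open>cross2 e x\<close> are preserved.\<close>

lemma area_scaling_cap_shear:
  assumes h: "0 \<le> h"
  shows "area_scaling 1 (cap_shear e h t)"
proof -
  let ?T = "cap_shear e h t"
  have hom: "homeomorphism UNIV UNIV ?T (cap_shear e h (- t))"
    using cross2.cap_shear_inverse[of e h t] cross2.cap_shear_inverse[of e h "- t"]
    by (intro homeomorphism_UNIV_I continuous_on_cap_shear) auto
  show ?thesis
  proof (rule area_scalingI[OF hom])
    fix l u :: "real^2"
    define B where "B = box l u"
    define P where "P = {x. h < cross2 e x}"
    define N where "N = {x. h < - cross2 e x}"
    define L where "L = (\<lambda>x. x + (t * cross2 e x) *\<^sub>R e)"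
    have L: "linear L"
      by (rule linearI) (simp_all add: L_def cross2.bilinear algebra_simps)
    have detL: "det (matrix L) = 1"
      by (simp add: det_2 matrix_def L_def cross2_def axis_def algebra_simps)
    have [measurable]: "P \<in> sets borel" "N \<in> sets borel" "B \<in> sets borel"
      unfolding P_def N_def B_def
      by (auto intro!: borel_open open_Collect_less continuous_intros)
    have bdd: "bounded (B \<inter> P)" "bounded (B \<inter> N)" "bounded (B - P - N)"
      by (auto simp: B_def intro: bounded_subset[of "box l u"])
    have TI: "?T ` C \<in> sets borel" if "C \<in> sets borel" for C
      by (rule homeomorphism_UNIV_image_borel[OF hom that])
    have "emeasure lborel (?T ` (B \<inter> P)) = emeasure lborel (B \<inter> P)"
    proof -
      have "?T x = - (t * h) *\<^sub>R e + L x" if "x \<in> B \<inter> P" for x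
        using h that by (auto simp: L_def P_def cross2.cap_shear_def algebra_simps)
      from emeasure_affine_image[OF _ bdd(1) L this TI] show ?thesis by (simp add: detL)
    qed
    moreover have "emeasure lborel (?T ` (B \<inter> N)) = emeasure lborel (B \<inter> N)"
    proof -
      have "?T x = (t * h) *\<^sub>R e + L x" if "x \<in> B \<inter> N" for x
        using h that by (auto simp: L_def N_def cross2.cap_shear_def algebra_simps)
      from emeasure_affine_image[OF _ bdd(2) L this TI] show ?thesis by (simp add: detL)
    qed
    moreover have "?T ` (B - P - N) = B - P - N"
      by (auto simp: P_def N_def cross2.cap_shear_def)
    moreover have "emeasure lborel (?T ` B)
       = emeasure lborel (?T ` (B \<inter> P)) + emeasure lborel (?T ` (B \<inter> N)) + emeasure lborel (?T ` (B - P - N))"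
    proof -
      have disj: "?T ` (B \<inter> P) \<inter> ?T ` (B \<inter> N) = {}" "(?T ` (B \<inter> P) \<union> ?T ` (B \<inter> N)) \<inter> ?T ` (B - P - N) = {}"
        using h by (auto simp: P_def N_def dest!: arg_cong[of _ _ "cross2 e"])
      have "?T ` B = ?T ` (B \<inter> P) \<union> ?T ` (B \<inter> N) \<union> ?T ` (B - P - N)" by blast
      then show ?thesis
        using emeasure_Un3[OF _ _ _ disj, of lborel] by (simp add: TI)
    qed
    moreover have "emeasure lborel B
       = emeasure lborel (B \<inter> P) + emeasure lborel (B \<inter> N) + emeasure lborel (B - P - N)"
    proof -
      have disj: "(B \<inter> P) \<inter> (B \<inter> N) = {}" "((B \<inter> P) \<union> (B \<inter> N)) \<inter> (B - P - N) = {}"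
        using h by (auto simp: P_def N_def)
      have "B = (B \<inter> P) \<union> (B \<inter> N) \<union> (B - P - N)" by blast
      then show ?thesis
        using emeasure_Un3[OF _ _ _ disj, of lborel] by simp
    qed
    ultimately show "emeasure lborel (?T ` box l u) = ennreal 1 * emeasure lborel (box l u)"
      by (simp add: B_def)
  qed simp
qed

section \<open>Reduction of zonogons to parallelograms\<close>

lemma cross2_eq_0_imp_scaled:
  assumes "cross2 a b = 0" "b \<noteq> 0"
  obtains c where "a = c *\<^sub>R b"
proof -
  have eq: "a $ 1 * b $ 2 = a $ 2 * b $ 1" using assms(1) by (simp add: cross2_def)
  consider "b $ 1 \<noteq> 0" | "b $ 2 \<noteq> 0" using assms(2) by (auto simp: vec_eq_iff forall_2)
  then show ?thesis
  proof cases
    case 1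
    then have "a = (a $ 1 / b $ 1) *\<^sub>R b" using eq by (simp add: vec_eq_iff forall_2 field_simps)
    then show ?thesis using that by blast
  next
    case 2
    then have "a = (a $ 2 / b $ 2) *\<^sub>R b" using eq by (simp add: vec_eq_iff forall_2 field_simps)
    then show ?thesis using that by blast
  qed
qed

lemma cross2_decompose: "cross2 p q *\<^sub>R x = cross2 x q *\<^sub>R p + cross2 p x *\<^sub>R q"
  by (simp add: cross2_def vec_eq_iff forall_2 algebra_simps)

lemma emeasure_lborel_pos:
  fixes K :: "'a::euclidean_space set"
  assumes "interior K \<noteq> {}" "K \<in> sets borel"
  shows "0 < emeasure lborel K"
proof -
  obtain x r where r: "0 < r" "ball x r \<subseteq> K"
    using assms(1) by (meson ex_in_conv mem_interior)
  have "0 < emeasure lborel (ball x r)"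
    using content_ball_pos[OF r(1), of x] by (simp add: measure_def enn2real_positive_iff)
  also have "\<dots> \<le> emeasure lborel K"
    using r(2) assms(2) by (intro emeasure_mono) auto
  finally show ?thesis .
qed

text \<open>Two independent generators make the zonogon compact, and the exclusion of 0 lets a
  vanishing \<open>cross2\<close> between generators mean that they are parallel.\<close>

definition spanning :: "(real^2) multiset \<Rightarrow> bool" where
  "spanning W \<longleftrightarrow> 0 \<notin># W \<and> (\<exists>p\<in>#W. \<exists>q\<in>#W. cross2 p q \<noteq> 0)"

lemma spanning_add_mset2:
  assumes "cross2 a b \<noteq> 0" "0 \<notin># R"
  shows "spanning (add_mset a (add_mset b R))"
proof -
  have "a \<noteq> 0" "b \<noteq> 0" using assms(1) by auto
  then show ?thesis using assms by (auto simp: spanning_def)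
qed

section \<open>Topology and area of zonogons, and changes of their generators\<close>

lemma closed_zonogon: "closed (zonogon W)"
proof -
  have "zonogon W = (\<Inter>w\<in>set_mset W. {x. \<bar>cross2 w x\<bar> \<le> (\<Sum>v\<in>#W. \<bar>cross2 w v\<bar>)})"
    by (auto simp: cross2.zonogon_def)
  then show ?thesis
    by (auto intro!: closed_INT closed_Collect_le continuous_intros)
qed

lemma bounded_two_strips:
  assumes "cross2 p q \<noteq> 0"
  shows "bounded {x. \<bar>cross2 p x\<bar> \<le> a \<and> \<bar>cross2 q x\<bar> \<le> b}"
proof -
  have "norm x \<le> (b * norm p + a * norm q) / \<bar>cross2 p q\<bar>"
    if "\<bar>cross2 p x\<bar> \<le> a" "\<bar>cross2 q x\<bar> \<le> b" for x
  proof -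
    have "\<bar>cross2 p q\<bar> * norm x = norm (cross2 x q *\<^sub>R p + cross2 p x *\<^sub>R q)"
      by (simp flip: cross2_decompose)
    also have "\<dots> \<le> \<bar>cross2 q x\<bar> * norm p + \<bar>cross2 p x\<bar> * norm q"
      using norm_triangle_ineq[of "cross2 x q *\<^sub>R p" "cross2 p x *\<^sub>R q"] cross2.anti[of x q] by simp
    also have "\<dots> \<le> b * norm p + a * norm q"
      using that by (intro add_mono mult_right_mono) auto
    finally show ?thesis using assms by (simp add: field_simps)
  qed
  then show ?thesis unfolding bounded_iff by blast
qed

lemma compact_zonogon:
  assumes "spanning W"
  shows "compact (zonogon W)"
proof -
  obtain p q where pq: "p \<in># W" "q \<in># W" "cross2 p q \<noteq> 0" using assms by (auto simp: spanning_def)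
  have "zonogon W \<subseteq> {x. \<bar>cross2 p x\<bar> \<le> (\<Sum>v\<in>#W. \<bar>cross2 p v\<bar>) \<and> \<bar>cross2 q x\<bar> \<le> (\<Sum>v\<in>#W. \<bar>cross2 q v\<bar>)}"
    using pq by (auto simp: cross2.zonogon_def)
  then show ?thesis
    using closed_zonogon bounded_subset[OF bounded_two_strips[OF pq(3)]] by (simp add: compact_eq_bounded_closed)
qed

lemma spanning_sum_pos:
  assumes "spanning W" "w \<noteq> 0"
  shows "0 < (\<Sum>v\<in>#W. \<bar>cross2 w v\<bar>)"
proof -
  obtain p q where pq: "p \<in># W" "q \<in># W" "cross2 p q \<noteq> 0" using assms by (auto simp: spanning_def)
  have "cross2 w p \<noteq> 0 \<or> cross2 w q \<noteq> 0"
  proof (rule ccontr)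
    assume "\<not> ?thesis"
    then have "cross2 p w = 0" "cross2 q w = 0" using cross2.anti[of p w] cross2.anti[of q w] by auto
    then obtain c d where "p = c *\<^sub>R w" "q = d *\<^sub>R w"
      using cross2_eq_0_imp_scaled assms(2) by metis
    then show False using pq(3) by (simp add: cross2.bilinear)
  qed
  then obtain v where v: "v \<in># W" "cross2 w v \<noteq> 0" using pq by auto
  then obtain V where "W = add_mset v V" by (metis insert_DiffM)
  moreover have "0 \<le> (\<Sum>v\<in>#V. \<bar>cross2 w v\<bar>)" by (induction V) auto
  ultimately show ?thesis using v by (simp add: add_pos_nonneg)
qed

lemma emeasure_zonogon_pos:
  assumes "spanning W"
  shows "0 < emeasure lborel (zonogon W)"
proof (rule emeasure_lborel_pos)
  define U where "U = (\<Inter>w\<in>set_mset W. {x. \<bar>cross2 w x\<bar> < (\<Sum>v\<in>#W. \<bar>cross2 w v\<bar>)})"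
  have "open U" unfolding U_def by (auto intro!: open_INT open_Collect_less continuous_intros)
  moreover have "U \<subseteq> zonogon W" unfolding U_def cross2.zonogon_def by (auto intro: less_imp_le)
  moreover have "0 \<in> U"
  proof -
    have "0 < (\<Sum>v\<in>#W. \<bar>cross2 w v\<bar>)" if "w \<in># W" for w
      using that assms by (intro spanning_sum_pos) (auto simp: spanning_def)
    then show ?thesis by (simp add: U_def)
  qed
  ultimately show "interior (zonogon W) \<noteq> {}" using interior_maximal by blast
qed (simp add: closed_zonogon)

text \<open>The signs of generators are free, so all of them can be turned into one half-plane
  before they are ordered by angle.\<close>

lemma zonogon_flip:
  assumes f: "\<And>w. w \<in># W \<Longrightarrow> f w = w \<or> f w = - w"
  shows "zonogon (image_mset f W) = zonogon W"
proof -
  have abs_left: "\<bar>cross2 (f w) x\<bar> = \<bar>cross2 w x\<bar>" and abs_right: "\<bar>cross2 x (f w)\<bar> = \<bar>cross2 x w\<bar>"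
    if "w \<in># W" for w x
    using f[OF that] by (auto simp: cross2.bilinear)
  have "(\<Sum>v\<in>#image_mset f W. \<bar>cross2 a v\<bar>) = (\<Sum>v\<in>#W. \<bar>cross2 a v\<bar>)" for a
    using abs_right by (simp add: multiset.map_comp comp_def cong: image_mset_cong)
  moreover have "(\<Sum>v\<in>#W. \<bar>cross2 (f w) v\<bar>) = (\<Sum>v\<in>#W. \<bar>cross2 w v\<bar>)" if "w \<in># W" for w
    using abs_left[OF that] by simp
  ultimately show ?thesis
    unfolding cross2.zonogon_def using abs_left by auto
qed

lemma spanning_flip:
  assumes f: "\<And>w. w \<in># W \<Longrightarrow> f w = w \<or> f w = - w" and W: "spanning W"
  shows "spanning (image_mset f W)"
proof -
  obtain p q where pq: "p \<in># W" "q \<in># W" "cross2 p q \<noteq> 0" using W by (auto simp: spanning_def)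
  then have "cross2 (f p) (f q) \<noteq> 0"
    using f[of p] f[of q] by (auto simp: cross2.bilinear)
  moreover have "0 \<notin># image_mset f W"
    using W f by (fastforce simp: spanning_def)
  ultimately show ?thesis using pq unfolding spanning_def by auto
qed

text \<open>Parallel segments add up to one segment: with \<open>w = c p\<close> the total is the
  multiple \<open>1 + \<bar>c\<bar>\<close> of \<open>p\<close>. Merging lowers the number of
  generators, and once nothing can be merged the relevant inequalities between directions are
  strict.\<close>

lemma zonogon_merge_parallel:
  assumes W: "spanning (add_mset p (add_mset w R))" and parallel: "cross2 p w = 0"
  obtains p' where "spanning (add_mset p' R)" "zonogon (add_mset p' R) = zonogon (add_mset p (add_mset w R))"
proof -
  have nz: "p \<noteq> 0" "w \<noteq> 0" "0 \<notin># R" using W by (auto simp: spanning_def)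
  have "cross2 w p = 0" using parallel cross2.anti[of w p] by simp
  then obtain c where c: "w = c *\<^sub>R p" using cross2_eq_0_imp_scaled nz by metis
  then have c0: "c \<noteq> 0" using nz by auto
  define p' where "p' = (1 + \<bar>c\<bar>) *\<^sub>R p"
  have pos: "0 < 1 + \<bar>c\<bar>" by simp
  have scaled: "\<bar>cross2 p' x\<bar> = (1 + \<bar>c\<bar>) * \<bar>cross2 p x\<bar>" "\<bar>cross2 w x\<bar> = \<bar>c\<bar> * \<bar>cross2 p x\<bar>"
    "\<bar>cross2 x p'\<bar> = (1 + \<bar>c\<bar>) * \<bar>cross2 x p\<bar>" "\<bar>cross2 x w\<bar> = \<bar>c\<bar> * \<bar>cross2 x p\<bar>" for x
    unfolding p'_def c cross2.bilinear abs_mult by simp_all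
  have sums: "(\<Sum>v\<in>#R. \<bar>cross2 p' v\<bar>) = (1 + \<bar>c\<bar>) * (\<Sum>v\<in>#R. \<bar>cross2 p v\<bar>)"
    "(\<Sum>v\<in>#R. \<bar>cross2 w v\<bar>) = \<bar>c\<bar> * (\<Sum>v\<in>#R. \<bar>cross2 p v\<bar>)"
    unfolding scaled by (simp_all add: sum_mset_distrib_left)
  have "zonogon (add_mset p' R) = zonogon (add_mset p (add_mset w R))"
  proof -
    define T where "T = (\<lambda>a. \<bar>cross2 a p\<bar> + (\<bar>cross2 a w\<bar> + (\<Sum>v\<in>#R. \<bar>cross2 a v\<bar>)))"
    have 1: "(\<Sum>v\<in>#add_mset p' R. \<bar>cross2 a v\<bar>) = T a" for a
      unfolding T_def by (simp only: image_mset_add_mset sum_mset.add_mset scaled distrib_right add.assoc mult_1)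
    have 2: "(\<Sum>v\<in>#add_mset p (add_mset w R). \<bar>cross2 a v\<bar>) = T a" for a
      unfolding T_def by (simp only: image_mset_add_mset sum_mset.add_mset)
    have T: "T p' = (1 + \<bar>c\<bar>) * T p" "T w = \<bar>c\<bar> * T p"
      unfolding T_def sums by (simp_all only: scaled parallel \<open>cross2 w p = 0\<close> cross2.self abs_zero add_0 mult_zero_right)
    have c0': "0 < \<bar>c\<bar>" using c0 by simp
    have "\<bar>cross2 p' x\<bar> \<le> T p' \<longleftrightarrow> \<bar>cross2 p x\<bar> \<le> T p" "\<bar>cross2 w x\<bar> \<le> T w \<longleftrightarrow> \<bar>cross2 p x\<bar> \<le> T p" for x
      by (simp_all only: T scaled mult_le_cancel_left_pos[OF pos] mult_le_cancel_left_pos[OF c0'])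
    then show ?thesis
      unfolding cross2.zonogon_def 1 2 by auto
  qed
  moreover have "spanning (add_mset p' R)"
  proof -
    have "0 \<notin># add_mset p' R" using nz pos by (auto simp: p'_def)
    moreover have "\<exists>b\<in>#R. cross2 p b \<noteq> 0"
    proof (rule ccontr)
      assume "\<not> ?thesis"
      then have "cross2 b p = 0" if "b \<in># add_mset p (add_mset w R)" for b
        using that parallel cross2.anti[of b p] by (auto simp: c cross2.bilinear)
      then have sc: "\<exists>c. b = c *\<^sub>R p" if "b \<in># add_mset p (add_mset w R)" for b
        using that cross2_eq_0_imp_scaled nz(1) by metis
      obtain a b where "a \<in># add_mset p (add_mset w R)" "b \<in># add_mset p (add_mset w R)" "cross2 a b \<noteq> 0"
        using W by (auto simp: spanning_def)
      then show False using sc[of a] sc[of b] by (auto simp: cross2.bilinear)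
    qed
    ultimately show ?thesis using pos unfolding spanning_def
      by (force simp: p'_def cross2.bilinear)
  qed
  ultimately show ?thesis using that by blast
qed

text \<open>\<open>\<rho>\<close> is the cotangent of the angle from \<open>p\<close>, which
  decreases over the half-plane to the left of \<open>p\<close>. Its maximum and minimum therefore
  give the first and the last generator without angles being introduced.\<close>

lemma angular_extremes:
  assumes V: "finite V" "V \<noteq> {}" and pos: "\<And>w. w \<in> V \<Longrightarrow> 0 < cross2 p w"
  shows "\<exists>k\<in>V. \<forall>w\<in>V. 0 \<le> cross2 k w" "\<exists>l\<in>V. \<forall>w\<in>V. 0 \<le> cross2 w l"
proof -
  define \<rho> where "\<rho> = (\<lambda>w. (p \<bullet> w) / cross2 p w)"
  have order: "0 \<le> cross2 v w" if "v \<in> V" "w \<in> V" "\<rho> w \<le> \<rho> v" for v w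
  proof -
    have "(p \<bullet> w) * cross2 p v \<le> (p \<bullet> v) * cross2 p w"
      using that pos[of v] pos[of w] by (simp add: \<rho>_def divide_simps mult.commute)
    moreover have "(p \<bullet> v) * cross2 p w - (p \<bullet> w) * cross2 p v = (p \<bullet> p) * cross2 v w"
      by (simp add: cross2_def inner_vec_def sum_2 algebra_simps)
    moreover have "0 < p \<bullet> p" using pos[OF that(1)] by auto
    ultimately show ?thesis by (metis diff_ge_0_iff_ge zero_le_mult_iff not_less)
  qed
  have "Max (\<rho> ` V) \<in> \<rho> ` V" "Min (\<rho> ` V) \<in> \<rho> ` V" using V by simp_all
  then obtain k l where k: "k \<in> V" "Max (\<rho> ` V) = \<rho> k" and l: "l \<in> V" "Min (\<rho> ` V) = \<rho> l" by auto
  have "\<rho> w \<le> \<rho> k" "\<rho> l \<le> \<rho> w" if "w \<in> V" for w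
    using V that by (simp_all flip: k(2) l(2))
  then show "\<exists>k\<in>V. \<forall>w\<in>V. 0 \<le> cross2 k w" "\<exists>l\<in>V. \<forall>w\<in>V. 0 \<le> cross2 w l"
    using order k(1) l(1) by blast+
qed

text \<open>Reversing the orientation exchanges the two directions of motion of the vertex.\<close>

interpretation neg_cross2: alternating_form "\<lambda>a b. - cross2 a b"
  by unfold_locales (simp_all add: cross2_def algebra_simps)

lemma neg_zonogon: "neg_cross2.zonogon W = zonogon W"
  by (simp add: neg_cross2.zonogon_def cross2.zonogon_def)

lemma neg_cap_shear: "neg_cross2.cap_shear e h t = cap_shear e h (- t)"
  by (simp add: neg_cross2.cap_shear_def cross2.cap_shear_def fun_eq_iff algebra_simps)

lemma centered_square_linear_image:
  assumes Q: "centered_square Q" and D: "cross2 p q \<noteq> 0"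
  obtains T where "linear T" "det (matrix T) \<noteq> 0" "Q = T ` zonogon {#p, q#}"
proof -
  obtain a and f :: "real^2 \<Rightarrow> real^2" where a: "0 < a" and f: "orthogonal_transformation f" and Qf: "Q = f ` {x. \<forall>i. \<bar>x $ i\<bar> \<le> a}"
    using Q unfolding centered_square_def by blast
  \<comment> \<open>Both strips of the parallelogram have half-width
    \<open>\<bar>cross2 p q\<bar>\<close>, which this factor turns into \<open>a\<close>.\<close>
  define s where "s = a / \<bar>cross2 p q\<bar>"
  have s: "0 < s" using a D by (simp add: s_def)
  define L where "L = (\<lambda>x. vector [s * cross2 p x, s * cross2 q x] :: real^2)"
  have L: "linear L"
    by (rule linearI) (simp_all add: L_def cross2.bilinear vec_eq_iff forall_2 algebra_simps)
  have detL: "det (matrix L) = s\<^sup>2 * cross2 p q"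
    by (simp add: det_2 matrix_def L_def cross2_def axis_def algebra_simps power2_eq_square)
  have mem: "x \<in> zonogon {#p, q#} \<longleftrightarrow> (\<forall>i. \<bar>L x $ i\<bar> \<le> a)" for x
  proof -
    have "\<bar>cross2 q p\<bar> = \<bar>cross2 p q\<bar>" using cross2.anti[of q p] by simp
    then show ?thesis
      using s D a by (simp add: cross2.zonogon_def L_def forall_2 abs_mult s_def field_simps)
  qed
  have "surj L"
    using det_nz_iff_inj[OF L] detL D s linear_injective_imp_surjective[OF L] by simp
  have im: "L ` zonogon {#p, q#} = {x. \<forall>i. \<bar>x $ i\<bar> \<le> a}"
    using \<open>surj L\<close> by (auto simp: mem) (metis (full_types) imageI mem mem_Collect_eq surjD)
  have lf: "linear f" using f by (simp add: orthogonal_transformation_linear)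
  have "det (matrix (f \<circ> L)) = det (matrix f) * det (matrix L)"
    by (simp add: matrix_compose[OF L lf] det_mul)
  moreover have "\<bar>det (matrix f)\<bar> = 1" using f by (simp add: orthogonal_transformation_det)
  ultimately have "det (matrix (f \<circ> L)) \<noteq> 0" using detL D s by auto
  moreover have "Q = (f \<circ> L) ` zonogon {#p, q#}" by (simp only: Qf im[symmetric] image_comp)
  ultimately show ?thesis using that[of "f \<circ> L"] linear_compose[OF L lf] by blast
qed

text \<open>What the reduction asks of a functional: \<open>linear_image\<close> makes all
  parallelograms of one area equal, \<open>shear\<close> is convexity along the vertex motion read
  off at the starting position, and \<open>mono\<close> takes the place of continuity in the
  approximation. Values in \<open>ennreal\<close> postpone the question of finiteness.\<close>

locale planar_functional =
  fixes \<Phi> :: "(real^2) set \<Rightarrow> ennreal" and r d :: real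
  assumes exponents: "0 \<le> r" "0 \<le> d"
    and linear_image: "\<lbrakk>compact K; 0 < emeasure lborel K; linear T; det (matrix T) \<noteq> 0\<rbrakk>
      \<Longrightarrow> \<Phi> (T ` K) = ennreal (\<bar>det (matrix T)\<bar> powr r) * \<Phi> K"
    and mono: "\<lbrakk>compact K; compact L; 0 < emeasure lborel K; K \<subseteq> L\<rbrakk>
      \<Longrightarrow> \<Phi> K \<le> ennreal ((measure lborel L / measure lborel K) powr d) * \<Phi> L"
    and shear: "\<lbrakk>compact K; 0 < emeasure lborel K; e \<noteq> 0; 0 \<le> h; 0 < s; 0 < t\<rbrakk>
      \<Longrightarrow> \<Phi> K \<le> ennreal (t / (s + t)) * \<Phi> (cap_shear e h (- s) ` K)
            + ennreal (s / (s + t)) * \<Phi> (cap_shear e h t ` K)"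
begin

lemma parallelogram_eq_square:
  assumes Q: "centered_square Q" and D: "cross2 p q \<noteq> 0"
    and area: "emeasure lborel (zonogon {#p, q#}) = emeasure lborel Q"
  shows "\<Phi> (zonogon {#p, q#}) = \<Phi> Q"
proof -
  let ?Z = "zonogon {#p, q#}"
  obtain T where T: "linear T" "det (matrix T) \<noteq> 0" "Q = T ` ?Z"
    using centered_square_linear_image[OF Q D] .
  have sp: "spanning {#p, q#}" using D by (auto simp: spanning_def)
  have "emeasure lborel ?Z = ennreal \<bar>det (matrix T)\<bar> * emeasure lborel ?Z"
    using area_scaling_distr(4)[OF area_scaling_linear[OF T(1,2)], of ?Z] area closed_zonogon
    by (simp add: T(3))
  moreover have "emeasure lborel ?Z < \<infinity>" using compact_zonogon[OF sp] by (intro emeasure_bounded_finite compact_imp_bounded)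
  ultimately have "\<bar>det (matrix T)\<bar> = 1"
    using emeasure_zonogon_pos[OF sp] by (cases "emeasure lborel ?Z") (auto simp flip: ennreal_mult')
  note det1 = this
  show ?thesis
    using linear_image[OF compact_zonogon[OF sp] emeasure_zonogon_pos[OF sp] T(1,2)]
    unfolding T(3)[symmetric] det1 by simp
qed

lemma zonogon_le_square:
  assumes Q: "centered_square Q"
  shows "spanning W \<Longrightarrow> emeasure lborel (zonogon W) = emeasure lborel Q \<Longrightarrow> \<Phi> (zonogon W) \<le> \<Phi> Q"
proof (induction "size W" arbitrary: W rule: less_induct)
  case less
  obtain p0 where "p0 \<in># W" using less.prems by (auto simp: spanning_def)
  define f where "f = (\<lambda>w. if cross2 p0 w < 0 then - w else w)"
  have f: "f w = w \<or> f w = - w" for w by (simp add: f_def)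
  obtain V0 where W: "W = add_mset p0 V0" using \<open>p0 \<in># W\<close> by (metis insert_DiffM)
  define V where "V = image_mset f V0"
  define p where "p = p0"
  have fp: "f p0 = p0" by (simp add: f_def)
  have spV: "spanning (add_mset p V)"
    using spanning_flip[of W f] f less.prems(1) by (simp add: W fp V_def p_def)
  have zV: "zonogon (add_mset p V) = zonogon W"
    using zonogon_flip[of W f] f by (simp add: W fp V_def p_def)
  have sizeV: "size (add_mset p V) = size W" by (simp add: W V_def)
  have ge: "0 \<le> cross2 p w" if "w \<in># V" for w
    using that by (auto simp: V_def f_def p_def cross2.bilinear)
  have step: ?case if "spanning W'" "zonogon W' = zonogon W" "size W' < size W" for W'
    using less.hyps[OF that(3,1)] less.prems(2) that(2) by simp
  show ?case
  proof (cases "\<exists>w\<in>#V. cross2 p w = 0")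
    case True
    then obtain w V1 where "cross2 p w = 0" "V = add_mset w V1" by (metis insert_DiffM)
    then obtain p' where "spanning (add_mset p' V1)" "zonogon (add_mset p' V1) = zonogon (add_mset p V)"
      using zonogon_merge_parallel[of p w V1] spV by auto
    then show ?thesis
      using zV sizeV \<open>V = add_mset w V1\<close> by (intro step[of "add_mset p' V1"]) auto
  next
    case False
    have pos: "0 < cross2 p w" if "w \<in># V" for w using ge[OF that] False that by force
    have "V \<noteq> {#}" using spV by (auto simp: spanning_def)
    \<comment> \<open>\<open>q\<close> follows \<open>p\<close> in angular order, so the two
      generators belong to edges that meet in a vertex.\<close>
    then obtain q where q: "q \<in># V" "\<And>w. w \<in># V \<Longrightarrow> 0 \<le> cross2 q w"
      using angular_extremes(1)[of "set_mset V" p] pos by auto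
    then obtain R where V: "V = add_mset q R" by (metis insert_DiffM)
    define D where "D = cross2 p q"
    have D: "0 < D" using pos[OF q(1)] by (simp add: D_def)
    show ?thesis
    proof (cases "R = {#}")
      case True
      then show ?thesis
        using parallelogram_eq_square[OF Q, of p q] D less.prems(2) zV by (simp add: V D_def)
    next
      case False
      show ?thesis
      proof (cases "\<exists>w\<in>#R. cross2 q w = 0")
        case True
        then obtain w R1 where w: "cross2 q w = 0" "R = add_mset w R1" by (metis insert_DiffM)
        have perm: "add_mset p V = add_mset q (add_mset w (add_mset p R1))" by (simp add: V w add_mset_commute)
        then have "spanning (add_mset q (add_mset w (add_mset p R1)))" using spV by (simp only:)
        from zonogon_merge_parallel[OF this w(1)]
        obtain p' where "spanning (add_mset p' (add_mset p R1))"
          "zonogon (add_mset p' (add_mset p R1)) = zonogon (add_mset q (add_mset w (add_mset p R1)))"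
          by blast
        then show ?thesis
          using zV sizeV w(2) unfolding perm by (intro step[of "add_mset p' (add_mset p R1)"]) (simp_all add: V)
      next
        case nz: False
        have posp: "0 < cross2 p w" if "w \<in># R" for w using pos that by (simp add: V)
        have posq: "0 < cross2 q w" if "w \<in># R" for w using q(2)[of w] that nz by (force simp: V)
        obtain k l where k: "k \<in># R" and l: "l \<in># R" and first: "\<And>w. w \<in># R \<Longrightarrow> 0 \<le> cross2 k w"
          and last: "\<And>w. w \<in># R \<Longrightarrow> 0 \<le> cross2 w l"
          using angular_extremes[of "set_mset R" p] posp False by auto
        obtain Rk where Rk: "R = add_mset k Rk" using k by (metis insert_DiffM)
        obtain Rl where Rl: "R = add_mset l Rl" using l by (metis insert_DiffM)
        define e where "e = p + q"
        define h where "h = cross2 e (\<Sum>\<^sub># R)"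
        have R0: "0 \<notin># R" and p0: "p \<noteq> 0" "q \<noteq> 0" using spV by (auto simp: spanning_def V)
        have knz: "k \<noteq> 0" "l \<noteq> 0" using R0 k l by auto
        have Xqp: "cross2 q p = - D" using cross2.anti[of q p] by (simp add: D_def)
        have epos: "0 < cross2 e w" if "w \<in># R" for w
          using posp[OF that] posq[OF that] by (simp add: e_def cross2.bilinear)
        have h: "0 \<le> h"
        proof -
          have "h = (\<Sum>v\<in>#R. cross2 e v)" by (simp add: h_def cross2.sum_mset_right)
          also have "\<dots> = (\<Sum>v\<in>#R. \<bar>cross2 e v\<bar>)" using epos by (intro arg_cong[of _ _ sum_mset] image_mset_cong) (simp add: less_imp_le)
          also have "0 \<le> \<dots>" by (induction R) auto
          finally show ?thesis .
        qed
        have enz: "e \<noteq> 0" using epos[OF k] by auto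
        \<comment> \<open>The times at which \<open>q - t e\<close> becomes parallel to
          \<open>k\<close> and, in the opposite motion, \<open>p - s e\<close> becomes parallel to
          \<open>l\<close>.\<close>
        define t where "t = cross2 q k / cross2 e k"
        define s where "s = cross2 p l / cross2 e l"
        have t: "0 < t" "t < 1" using posq[OF k] posp[OF k] epos[OF k] by (auto simp: t_def e_def cross2.bilinear)
        have s: "0 < s" "s < 1" using posq[OF l] posp[OF l] epos[OF l] by (auto simp: s_def e_def cross2.bilinear)
        have "cross2 (q - t *\<^sub>R e) k = 0" using epos[OF k] by (simp add: cross2.bilinear t_def)
        then obtain \<mu> where \<mu>: "q - t *\<^sub>R e = \<mu> *\<^sub>R k" using cross2_eq_0_imp_scaled knz by metis
        \<comment> \<open>Pairing with \<open>p\<close> shows that \<open>q - t e\<close> points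
          along \<open>k\<close> and not against it.\<close>
        have "\<mu> * cross2 p k = D * (1 - t)"
          using arg_cong[OF \<mu>, of "cross2 p"] by (simp add: cross2.bilinear e_def D_def algebra_simps)
        moreover have "0 < D * (1 - t)" using D t by simp
        ultimately have \<mu>pos: "0 < \<mu>" using posp[OF k] by (metis zero_less_mult_pos2)
        have "cross2 (p - s *\<^sub>R e) l = 0" using epos[OF l] by (simp add: cross2.bilinear s_def)
        then obtain \<nu>' where \<nu>': "p - s *\<^sub>R e = \<nu>' *\<^sub>R l" using cross2_eq_0_imp_scaled knz by metis
        define \<nu> where "\<nu> = - \<nu>'"
        have \<nu>: "p - s *\<^sub>R e = \<nu> *\<^sub>R (- l)" using \<nu>' by (simp add: \<nu>_def)
        have "\<nu> * cross2 q l = D * (1 - s)"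
          using arg_cong[OF \<nu>, of "cross2 q"] by (simp add: cross2.bilinear e_def Xqp algebra_simps)
        moreover have "0 < D * (1 - s)" using D s by simp
        ultimately have \<nu>pos: "0 < \<nu>" using posq[OF l] by (metis zero_less_mult_pos2)
        let ?Z = "zonogon (add_mset p V)"
        define W1 where "W1 = add_mset (p + t *\<^sub>R e) (add_mset ((1 + \<mu>) *\<^sub>R k) Rk)"
        define W2 where "W2 = add_mset (q + s *\<^sub>R e) (add_mset ((1 + \<nu>) *\<^sub>R (- l)) (image_mset uminus Rl))"
        have 1: "cap_shear e h (- (t / D)) ` ?Z = zonogon W1"
          using cross2.cap_shear_zonogon[of p q R k Rk l t \<mu>] D Rk l posp posq first last t \<mu> \<mu>pos
          by (simp add: V e_def h_def W1_def D_def)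
        \<comment> \<open>With the orientation reversed, \<open>p\<close> and \<open>q\<close>
          exchange roles and the remaining generators are negated to stay on the positive side;
          \<open>- l\<close> now comes first and \<open>- k\<close> last.\<close>
        have 2: "cap_shear e h (s / D) ` ?Z = zonogon W2"
        proof -
          have "\<Sum>\<^sub># (image_mset uminus R) = - \<Sum>\<^sub># R" by (induction R) auto
          then have h': "- cross2 (q + p) (\<Sum>\<^sub># (image_mset uminus R)) = h"
            by (simp add: h_def e_def cross2.bilinear)
          have comm: "q + p = e" by (simp add: e_def)
          have "neg_cross2.cap_shear (q + p) (- cross2 (q + p) (\<Sum>\<^sub># (image_mset uminus R))) (- s / (- cross2 q p)) `
              neg_cross2.zonogon (add_mset q (add_mset p (image_mset uminus R)))
            = neg_cross2.zonogon (add_mset (q + s *\<^sub>R (q + p)) (add_mset ((1 + \<nu>) *\<^sub>R (- l)) (image_mset uminus Rl)))"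
          proof (rule neg_cross2.cap_shear_zonogon)
            show "0 < - cross2 q p" using D Xqp by simp
            show "image_mset uminus R = add_mset (- l) (image_mset uminus Rl)" by (simp add: Rl)
            show "- k \<in># image_mset uminus R" using k by simp
            show "p - s *\<^sub>R (q + p) = \<nu> *\<^sub>R - l" using \<nu> by (simp add: comm)
          qed (use posp posq first last s \<nu>pos cross2.anti[of l] cross2.anti[of _ k] in \<open>auto simp: cross2.bilinear\<close>)
          moreover have "zonogon (add_mset q (add_mset p (image_mset uminus R))) = ?Z"
          proof -
            define g where "g = (\<lambda>w. if w \<in># R then - w else w)"
            have "p \<notin># R" "q \<notin># R" using posp posq by force+
            then have "image_mset g (add_mset q (add_mset p R)) = add_mset q (add_mset p (image_mset uminus R))"
              by (auto simp: g_def intro!: image_mset_cong)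
            then show ?thesis
              using zonogon_flip[of "add_mset q (add_mset p R)" g] by (simp add: g_def V add_mset_commute)
          qed
          ultimately show ?thesis
            unfolding h' by (simp add: neg_zonogon neg_cap_shear Xqp comm W2_def)
        qed
        have area: "emeasure lborel (cap_shear e h u ` ?Z) = emeasure lborel Q" for u
          using area_scaling_distr(4)[OF area_scaling_cap_shear[OF h], of ?Z e u] less.prems(2)
          by (simp add: zV closed_zonogon)
        have "0 < cross2 p k + t * cross2 e k" "0 < cross2 q l + s * cross2 e l"
          using posp[OF k] posq[OF l] epos[OF k] epos[OF l] t s by (simp_all add: add_pos_pos)
        moreover have "0 \<notin># Rk" "0 \<notin># Rl" using R0 Rk Rl by (metis add_mset_add_single union_iff)+
        ultimately have sp1: "spanning W1" and sp2: "spanning W2"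
          using \<mu>pos \<nu>pos unfolding W1_def W2_def
          by (auto intro!: spanning_add_mset2 simp: cross2.add_left cross2.scale_left cross2.scale_right cross2.minus_right)
        have size: "size W1 < size W" "size W2 < size W"
          unfolding sizeV[symmetric] by (simp add: W1_def V Rk, simp add: W2_def V Rl)
        \<comment> \<open>Position 0 is a weighted mean of the end positions \<open>- t / D\<close>
          and \<open>s / D\<close>, and both end bodies have fewer generators.\<close>
        have "\<Phi> ?Z \<le> ennreal (s / D / (t / D + s / D)) * \<Phi> (cap_shear e h (- (t / D)) ` ?Z)
            + ennreal (t / D / (t / D + s / D)) * \<Phi> (cap_shear e h (s / D) ` ?Z)"
          using D s t h enz by (intro shear compact_zonogon spV emeasure_zonogon_pos) auto
        also have "\<dots> \<le> ennreal (s / D / (t / D + s / D)) * \<Phi> Q + ennreal (t / D / (t / D + s / D)) * \<Phi> Q"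
          using less.hyps[OF size(1) sp1] less.hyps[OF size(2) sp2] area[of "- (t / D)"] area[of "s / D"]
          unfolding 1 2 by (intro add_mono mult_left_mono) auto
        also have "\<dots> = ennreal (s / D / (t / D + s / D) + t / D / (t / D + s / D)) * \<Phi> Q"
          using D s t by (subst ennreal_plus) (auto simp: distrib_right)
        also have "s / D / (t / D + s / D) + t / D / (t / D + s / D) = 1"
          using D s t by (simp add: add_pos_pos less_imp_neq[symmetric] flip: add_divide_distrib)
        finally show ?thesis by (simp add: zV)
      qed
    qed
  qed
qed

end

section \<open>Polar areas of shadow systems\<close>

text \<open>Functions that vanish along a line are wanted here: they are the support functions that
  belong to samples on a line through the origin.\<close>

definition seminorm :: "('a::euclidean_space \<Rightarrow> real) \<Rightarrow> bool" where
  "seminorm f \<longleftrightarrow> (\<forall>c x. f (c *\<^sub>R x) = \<bar>c\<bar> * f x) \<and> (\<forall>x y. f (x + y) \<le> f x + f y)"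

lemma seminormD:
  assumes "seminorm f"
  shows "f (c *\<^sub>R x) = \<bar>c\<bar> * f x" "f (x + y) \<le> f x + f y" "f 0 = 0" "f (- x) = f x" "0 \<le> f x"
proof -
  show 1: "f (c *\<^sub>R x) = \<bar>c\<bar> * f x" "f (x + y) \<le> f x + f y" for c x y
    using assms by (auto simp: seminorm_def)
  show 2: "f 0 = 0" using 1(1)[of 0 x] by simp
  show 3: "f (- x) = f x" using 1(1)[of "-1" x] by simp
  show "0 \<le> f x" using 1(2)[of x "- x"] 2 3 by simp
qed

lemma seminorm_convex_comb:
  assumes "seminorm f" "0 \<le> a" "0 \<le> b"
  shows "f (a *\<^sub>R x + b *\<^sub>R y) \<le> a * f x + b * f y"
  using seminormD(2)[OF assms(1), of "a *\<^sub>R x" "b *\<^sub>R y"] seminormD(1)[OF assms(1)] assms by simp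

lemma convex_on_seminorm: "seminorm f \<Longrightarrow> convex_on UNIV f"
  by (simp add: convex_on_def seminorm_convex_comb)

lemma continuous_on_seminorm: "seminorm f \<Longrightarrow> continuous_on A f"
  using convex_on_continuous[OF open_UNIV convex_on_seminorm] continuous_on_subset by blast

lemma seminorm_ball:
  assumes "seminorm f"
  shows "closed {x. f x \<le> 1}" "convex {x. f x \<le> 1}"
proof -
  show "closed {x. f x \<le> 1}"
    by (intro closed_Collect_le continuous_on_seminorm[OF assms] continuous_on_const)
  show "convex {x. f x \<le> 1}"
  proof (rule convexI)
    fix x y u v assume "x \<in> {x. f x \<le> 1}" "y \<in> {x. f x \<le> 1}" "0 \<le> u" "0 \<le> v" "u + v = (1::real)"
    then show "u *\<^sub>R x + v *\<^sub>R y \<in> {x. f x \<le> 1}"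
      using seminorm_convex_comb[OF assms, of u v x y] convex_bound_le[of "f x" 1 "f y" u v] by simp
  qed
qed

lemma seminorm_add_norm: "seminorm f \<Longrightarrow> 0 \<le> c \<Longrightarrow> seminorm (\<lambda>x. f x + c * norm x)"
  unfolding seminorm_def
proof (intro conjI allI)
  fix x y assume f: "(\<forall>c x. f (c *\<^sub>R x) = \<bar>c\<bar> * f x) \<and> (\<forall>x y. f (x + y) \<le> f x + f y)" and c: "0 \<le> c"
  have "f (x + y) \<le> f x + f y" using f by blast
  moreover have "c * norm (x + y) \<le> c * (norm x + norm y)"
    using c norm_triangle_ineq by (intro mult_left_mono) auto
  ultimately show "f (x + y) + c * norm (x + y) \<le> f x + c * norm x + (f y + c * norm y)"
    by (simp add: algebra_simps)
qed (simp add: algebra_simps)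

text \<open>An interior point other than 0 can be moved outward a little within the ball, and
  homogeneity then puts its own value strictly below 1.\<close>

lemma interior_seminorm_ball:
  assumes "seminorm f"
  shows "0 \<in> interior {x. f x \<le> 1}" "interior {x. f x \<le> 1} \<subseteq> {x. f x < 1}"
proof -
  have "open {x. f x < 1}"
    by (intro open_Collect_less continuous_on_seminorm[OF assms] continuous_on_const)
  then show "0 \<in> interior {x. f x \<le> 1}"
    by (rule interiorI) (auto simp: seminormD(3)[OF assms])
  show "interior {x. f x \<le> 1} \<subseteq> {x. f x < 1}"
  proof
    fix x assume "x \<in> interior {x. f x \<le> 1}"
    then obtain d where d: "0 < d" "cball x d \<subseteq> {x. f x \<le> 1}" by (auto simp: mem_interior_cball)
    show "x \<in> {x. f x < 1}"
    proof (cases "x = 0")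
      case False
      define c where "c = 1 + d / norm x"
      have c: "1 < c" using d False by (simp add: c_def)
      have "c *\<^sub>R x \<in> cball x d"
        using d False by (simp add: c_def dist_norm algebra_simps)
      then have "c * f x \<le> 1" using d c seminormD(1)[OF assms, of c x] by auto
      then have "f x \<le> 1 / c" using c by (simp add: field_simps)
      also have "\<dots> < 1" using c by simp
      finally show ?thesis by simp
    qed (simp add: seminormD(3)[OF assms])
  qed
qed

lemma emeasure_seminorm_ball_pos:
  assumes "seminorm f"
  shows "0 < emeasure lborel {x. f x \<le> 1}"
  using interior_seminorm_ball(1)[OF assms] seminorm_ball(1)[OF assms]
  by (intro emeasure_lborel_pos) auto

lemma compact_norm_ball:
  assumes f: "seminorm f" and c: "0 < c" "\<And>x. c * norm x \<le> f x"
  shows "compact {x. f x \<le> 1}"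
proof -
  have "norm x \<le> 1 / c" if "f x \<le> 1" for x
    using that c(2)[of x] c(1) by (simp add: field_simps)
  then have "bounded {x. f x \<le> 1}" unfolding bounded_iff by blast
  then show ?thesis using seminorm_ball(1)[OF f] compact_eq_bounded_closed by blast
qed

section \<open>Areas by fibres, and the Brunn-Minkowski argument for polars\<close>

lemma continuous_on_vector2: "continuous_on A (\<lambda>(b, a). vector [a, b] :: real^2)"
proof -
  have "(\<lambda>(b, a). vector [a, b] :: real^2) = (\<lambda>z. snd z *\<^sub>R axis 1 1 + fst z *\<^sub>R axis 2 1)"
    by (auto simp: fun_eq_iff vec_eq_iff forall_2 axis_def)
  then show ?thesis by (auto intro!: continuous_intros)
qed

lemma lborel_vec2_distr: "(lborel :: (real^2) measure) = distr (lborel \<Otimes>\<^sub>M lborel) borel (\<lambda>(b, a). vector [a, b])"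
proof (rule lborel_eqI)
  have [measurable]: "(\<lambda>(b, a). vector [a, b] :: real^2) \<in> lborel \<Otimes>\<^sub>M lborel \<rightarrow>\<^sub>M borel"
    unfolding lborel_prod using borel_measurable_continuous_onI[OF continuous_on_vector2] by simp
  fix l u :: "real^2" assume le: "\<And>b. b \<in> Basis \<Longrightarrow> l \<bullet> b \<le> u \<bullet> b"
  have le': "l $ i \<le> u $ i" for i using le[of "axis i 1"] by (simp add: inner_axis)
  have "(\<lambda>(b, a). vector [a, b] :: real^2) -` box l u \<inter> space (lborel \<Otimes>\<^sub>M lborel)
      = {l $ 2<..<u $ 2} \<times> {l $ 1<..<u $ 1}"
    by (auto simp: space_pair_measure mem_box_cart forall_2)
  then have "emeasure (distr (lborel \<Otimes>\<^sub>M lborel) borel (\<lambda>(b, a). vector [a, b])) (box l u)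
      = ennreal (u $ 2 - l $ 2) * ennreal (u $ 1 - l $ 1)"
    using le' by (simp add: emeasure_distr lborel.emeasure_pair_measure_Times)
  also have "\<dots> = ennreal (\<Prod>b\<in>Basis. (u - l) \<bullet> b)"
  proof -
    have B: "(Basis :: (real^2) set) = {axis 1 1, axis 2 1}"
      by (auto simp: Basis_vec_def UNIV_2)
    have "axis 1 1 \<noteq> (axis 2 1 :: real^2)" by (simp add: axis_eq_axis)
    then have "(\<Prod>b\<in>Basis. (u - l) \<bullet> b) = (u $ 1 - l $ 1) * (u $ 2 - l $ 2)"
      unfolding B by (simp add: inner_axis)
    then show ?thesis using le' by (simp add: ennreal_mult' mult.commute)
  qed
  finally show "emeasure (distr (lborel \<Otimes>\<^sub>M lborel) borel (\<lambda>(b, a). vector [a, b])) (box l u)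
      = ennreal (\<Prod>b\<in>Basis. (u - l) \<bullet> b)" .
qed simp

text \<open>Fubini after the rotation that takes the coordinate axes to \<open>u\<close> and
  \<open>v\<close>; \<open>u\<close> is \<open>v\<close> turned by a right angle, in the sense that
  gives determinant 1.\<close>

lemma area_by_fibers:
  fixes v :: "real^2"
  assumes v: "norm v = 1" and P: "P \<in> sets borel"
  defines "u \<equiv> vector [v $ 2, - v $ 1]"
  shows "(\<lambda>b. emeasure lborel {a. a *\<^sub>R u + b *\<^sub>R v \<in> P}) \<in> borel_measurable borel"
    and "emeasure lborel P = (\<integral>\<^sup>+b. emeasure lborel {a. a *\<^sub>R u + b *\<^sub>R v \<in> P} \<partial>lborel)"
proof -
  let ?G = "\<lambda>(b, a). vector [a, b] :: real^2"
  define L where "L = (\<lambda>x::real^2. x $ 1 *\<^sub>R u + x $ 2 *\<^sub>R v)"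
  have L: "linear L"
    by (rule linearI) (simp_all add: L_def algebra_simps)
  have vv: "(v $ 1)\<^sup>2 + (v $ 2)\<^sup>2 = 1"
    using v by (simp add: norm_vec_def L2_set_def sum_2)
  have "det (matrix L) = 1"
    using vv by (simp add: det_2 matrix_def L_def u_def axis_def power2_eq_square algebra_simps)
  then have L1: "area_scaling 1 L"
    using area_scaling_linear[OF L] by simp
  have LP: "L -` P \<in> sets borel"
    using measurable_sets_borel[OF area_scaling_distr(1)[OF L1] P] .
  have [measurable]: "?G \<in> lborel \<Otimes>\<^sub>M lborel \<rightarrow>\<^sub>M borel"
    unfolding lborel_prod using borel_measurable_continuous_onI[OF continuous_on_vector2] by simp
  define S where "S = ?G -` (L -` P)"
  have S: "S \<in> sets (lborel \<Otimes>\<^sub>M lborel)"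
    using measurable_sets[of ?G "lborel \<Otimes>\<^sub>M lborel" borel "L -` P"] LP by (simp add: S_def space_pair_measure)
  have fib: "Pair b -` S = {a. a *\<^sub>R u + b *\<^sub>R v \<in> P}" for b
    by (auto simp: S_def L_def)
  show "(\<lambda>b. emeasure lborel {a. a *\<^sub>R u + b *\<^sub>R v \<in> P}) \<in> borel_measurable borel"
    using lborel.measurable_emeasure_Pair[OF S] by (simp add: fib)
  have "emeasure lborel P = emeasure lborel (L -` P)"
    using area_scaling_distr(5)[OF L1 P] by simp
  also have "\<dots> = emeasure (lborel \<Otimes>\<^sub>M lborel) S"
    by (subst lborel_vec2_distr) (use LP in \<open>simp add: emeasure_distr S_def space_pair_measure\<close>)
  also have "\<dots> = (\<integral>\<^sup>+b. emeasure lborel (Pair b -` S) \<partial>lborel)"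
    by (rule lborel.emeasure_pair_measure_alt[OF S])
  finally show "emeasure lborel P = (\<integral>\<^sup>+b. emeasure lborel {a. a *\<^sub>R u + b *\<^sub>R v \<in> P} \<partial>lborel)"
    by (simp add: fib)
qed

text \<open>Brunn-Minkowski on the line. A nonempty compact convex set is an interval, so the
  combined set is the interval between the combined endpoints.\<close>

lemma interval_combination_measure:
  fixes A0 A1 C :: "real set"
  assumes A0: "compact A0" "convex A0" "A0 \<noteq> {}" and A1: "compact A1" "convex A1" "A1 \<noteq> {}"
    and C: "C \<in> sets borel" and \<mu>: "0 \<le> \<mu>0" "0 \<le> \<mu>1"
    and sub: "\<And>x y. x \<in> A0 \<Longrightarrow> y \<in> A1 \<Longrightarrow> \<mu>0 * x + \<mu>1 * y \<in> C"
  shows "ennreal \<mu>0 * emeasure lborel A0 + ennreal \<mu>1 * emeasure lborel A1 \<le> emeasure lborel C"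
proof -
  obtain l0 r0 where 0: "A0 = {l0..r0}"
    using A0 connected_compact_interval_1[of A0] convex_connected by auto
  obtain l1 r1 where 1: "A1 = {l1..r1}"
    using A1 connected_compact_interval_1[of A1] convex_connected by auto
  have le: "l0 \<le> r0" "l1 \<le> r1" using A0 A1 0 1 by auto
  have "{\<mu>0 * l0 + \<mu>1 * l1..\<mu>0 * r0 + \<mu>1 * r1} \<subseteq> C"
  proof
    fix z assume "z \<in> {\<mu>0 * l0 + \<mu>1 * l1..\<mu>0 * r0 + \<mu>1 * r1}"
    then have "z \<in> closed_segment (\<mu>0 * l0 + \<mu>1 * l1) (\<mu>0 * r0 + \<mu>1 * r1)"
      by (subst closed_segment_eq_real_ivl1) auto
    then obtain \<tau> where \<tau>: "0 \<le> \<tau>" "\<tau> \<le> 1" "z = (1 - \<tau>) * (\<mu>0 * l0 + \<mu>1 * l1) + \<tau> * (\<mu>0 * r0 + \<mu>1 * r1)"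
      by (force simp: closed_segment_def)
    have "\<mu>0 * ((1 - \<tau>) * l0 + \<tau> * r0) + \<mu>1 * ((1 - \<tau>) * l1 + \<tau> * r1) \<in> C"
    proof (rule sub)
      show "(1 - \<tau>) * l0 + \<tau> * r0 \<in> A0" "(1 - \<tau>) * l1 + \<tau> * r1 \<in> A1"
        using A0(2) A1(2) le \<tau> by (auto simp: convex_alt 0 1)
    qed
    then show "z \<in> C" by (simp add: \<tau>(3) algebra_simps)
  qed
  then have "emeasure lborel {\<mu>0 * l0 + \<mu>1 * l1..\<mu>0 * r0 + \<mu>1 * r1} \<le> emeasure lborel C"
    using C by (intro emeasure_mono) auto
  moreover have "emeasure lborel {\<mu>0 * l0 + \<mu>1 * l1..\<mu>0 * r0 + \<mu>1 * r1}
     = ennreal (\<mu>0 * (r0 - l0) + \<mu>1 * (r1 - l1))"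
    using le \<mu> by (subst emeasure_lborel_Icc) (auto simp: algebra_simps add_mono mult_left_mono)
  moreover have "\<dots> = ennreal \<mu>0 * emeasure lborel A0 + ennreal \<mu>1 * emeasure lborel A1"
    using le \<mu> by (simp add: 0 1 ennreal_mult)
  ultimately show ?thesis by simp
qed

text \<open>With \<open>x = 1 / B0\<close> and \<open>y = 1 / B1\<close> this is Cauchy-Schwarz for
  \<open>\<alpha> x + \<beta> y\<close>. The right-hand side is the lower bound for the area that
  integration of the fibrewise inequality gives in \<open>polar_shadow_area\<close>.\<close>

lemma harmonic_cauchy:
  fixes a0 a1 B0 B1 \<alpha> \<beta> :: real
  assumes "0 < a0" "0 < a1" "0 < B0" "0 < B1" "0 < \<alpha>" "0 < \<beta>"
  defines "B \<equiv> 1 / (\<alpha> / B0 + \<beta> / B1)"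
  shows "1 / (\<alpha> / a0 + \<beta> / a1) \<le> B * ((\<alpha> * B / B0) * (a0 / B0) + (\<beta> * B / B1) * (a1 / B1))"
proof -
  define x where "x = 1 / B0"
  define y where "y = 1 / B1"
  have xy: "0 < x" "0 < y" using assms by (auto simp: x_def y_def)
  have B: "B = 1 / (\<alpha> * x + \<beta> * y)" by (simp add: B_def x_def y_def)
  have pos: "0 < \<alpha> * x + \<beta> * y" using xy assms by (simp add: add_pos_pos)
  have pos2: "0 < \<alpha> / a0 + \<beta> / a1" using assms by (simp add: add_pos_pos)
  have "(\<alpha> * x\<^sup>2 * a0 + \<beta> * y\<^sup>2 * a1) * (\<alpha> / a0 + \<beta> / a1) - (\<alpha> * x + \<beta> * y)\<^sup>2
      = \<alpha> * \<beta> * (x * a0 - y * a1)\<^sup>2 / (a0 * a1)"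
    using assms by (simp add: field_simps power2_eq_square)
  also have "\<dots> \<ge> 0" using assms by simp
  finally have "(\<alpha> * x + \<beta> * y)\<^sup>2 \<le> (\<alpha> * x\<^sup>2 * a0 + \<beta> * y\<^sup>2 * a1) * (\<alpha> / a0 + \<beta> / a1)" by simp
  then have "1 / (\<alpha> / a0 + \<beta> / a1) \<le> (\<alpha> * x\<^sup>2 * a0 + \<beta> * y\<^sup>2 * a1) / (\<alpha> * x + \<beta> * y)\<^sup>2"
    using pos pos2 by (simp add: divide_simps)
  also have "\<dots> = B * ((\<alpha> * B * x) * (a0 * x) + (\<beta> * B * y) * (a1 * y))"
    using pos by (simp add: B power2_eq_square divide_simps)
  finally show ?thesis by (simp add: x_def y_def)
qed

lemma ennreal_divide_mult_cancel: "0 < c \<Longrightarrow> ennreal (1 / c) * (ennreal c * X) = X"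
  by (simp add: mult.assoc[symmetric] ennreal_mult[symmetric])

text \<open>Convexity of the inverse area, in the form of a harmonic mean. \<open>comb\<close> is
  all that is used of a shadow system: a displacement along \<open>e\<close> sees of
  \<open>w\<close> only \<open>e \<bullet> w\<close>, and the weights are tied to exactly these
  components.\<close>

lemma polar_shadow_area:
  fixes f0 f1 f :: "real^2 \<Rightarrow> real"
  assumes f0: "seminorm f0" "0 < c0" "\<And>x. c0 * norm x \<le> f0 x"
    and f1: "seminorm f1" "0 < c1" "\<And>x. c1 * norm x \<le> f1 x"
    and f: "seminorm f"
    and ab: "0 < \<alpha>" "0 < \<beta>" "\<alpha> + \<beta> = 1" and e: "e \<noteq> 0"
    and comb: "\<And>\<mu>0 \<mu>1 w0 w1 b. \<lbrakk>0 \<le> \<mu>0; 0 \<le> \<mu>1; \<mu>0 + \<mu>1 = 1; \<mu>0 * (e \<bullet> w0) = \<alpha> * b; \<mu>1 * (e \<bullet> w1) = \<beta> * b\<rbrakk>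
      \<Longrightarrow> f (\<mu>0 *\<^sub>R w0 + \<mu>1 *\<^sub>R w1) \<le> \<mu>0 * f0 w0 + \<mu>1 * f1 w1"
  shows "ennreal (1 / (\<alpha> / measure lborel {x. f0 x \<le> 1} + \<beta> / measure lborel {x. f1 x \<le> 1})) \<le> emeasure lborel {x. f x \<le> 1}"
proof -
  define v where "v = e /\<^sub>R norm e"
  have v: "norm v = 1" using e by (simp add: v_def)
  have ev: "e \<bullet> w = norm e * (v \<bullet> w)" for w using e by (simp add: v_def)
  define u :: "real^2" where "u = vector [v $ 2, - v $ 1]"
  have vu: "v \<bullet> u = 0" by (simp add: u_def inner_vec_def sum_2)
  have vv: "v \<bullet> v = 1" using v by (simp add: norm_eq_1)
  have vv': "v $ 1 * v $ 1 + v $ 2 * v $ 2 = 1" using vv by (simp add: inner_vec_def sum_2)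
  have span: "(u \<bullet> w) *\<^sub>R u + (v \<bullet> w) *\<^sub>R v = w" for w
  proof -
    have "(u \<bullet> w) *\<^sub>R u + (v \<bullet> w) *\<^sub>R v = (v $ 1 * v $ 1 + v $ 2 * v $ 2) *\<^sub>R w"
      by (simp add: u_def inner_vec_def sum_2 vec_eq_iff forall_2 algebra_simps)
    then show ?thesis by (simp add: vv')
  qed
  define P0 where "P0 = {x. f0 x \<le> 1}"
  define P1 where "P1 = {x. f1 x \<le> 1}"
  define P where "P = {x. f x \<le> 1}"
  have compact: "compact P0" "compact P1"
    unfolding P0_def P1_def by (rule compact_norm_ball[OF f0], rule compact_norm_ball[OF f1])
  have convex: "convex P0" "convex P1"
    unfolding P0_def P1_def by (simp_all add: seminorm_ball f0(1) f1(1))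
  have borel: "P0 \<in> sets borel" "P1 \<in> sets borel" "P \<in> sets borel"
    unfolding P0_def P1_def P_def by (simp_all add: seminorm_ball borel_closed f0(1) f1(1) f)
  \<comment> \<open>Measured in units of the maximal heights \<open>B0\<close> and
    \<open>B1\<close>, the fibres of both balls have the same range of the parameter
    \<open>\<theta>\<close>, from -1 to 1.\<close>
  have height: "\<exists>B>0. \<exists>m\<in>{x. g x \<le> 1}. v \<bullet> m = B \<and> (\<forall>x\<in>{x. g x \<le> 1}. \<bar>v \<bullet> x\<bar> \<le> B)"
    if g: "seminorm g" "0 < c" "\<And>x. c * norm x \<le> g x" for g :: "real^2 \<Rightarrow> real" and c
  proof -
    have "{x. g x \<le> 1} \<noteq> {}" using seminormD(3)[OF g(1)] by (metis (mono_tags) empty_iff mem_Collect_eq zero_le_one)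
    moreover have "continuous_on {x. g x \<le> 1} (\<lambda>x. v \<bullet> x)" by (intro continuous_intros)
    ultimately obtain m where m: "m \<in> {x. g x \<le> 1}" "\<forall>x\<in>{x. g x \<le> 1}. v \<bullet> x \<le> v \<bullet> m"
      using continuous_attains_sup[OF compact_norm_ball[OF g]] by blast
    have gv: "0 < g v" using g(3)[of v] g(2) v by simp
    then have "(1 / g v) *\<^sub>R v \<in> {x. g x \<le> 1}" by (simp add: seminormD(1)[OF g(1)])
    from bspec[OF m(2) this] have "0 < v \<bullet> m" using gv vv by (simp add: less_le_trans[of 0 "1 / g v"])
    moreover have "\<bar>v \<bullet> x\<bar> \<le> v \<bullet> m" if "x \<in> {x. g x \<le> 1}" for x
      using bspec[OF m(2), of x] bspec[OF m(2), of "- x"] that by (simp add: seminormD(4)[OF g(1)] abs_le_iff)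
    ultimately show ?thesis using m(1) by blast
  qed
  obtain B0 m0 where B0: "0 < B0" and m0: "m0 \<in> P0" "v \<bullet> m0 = B0" "\<And>x. x \<in> P0 \<Longrightarrow> \<bar>v \<bullet> x\<bar> \<le> B0"
    using height[OF f0] unfolding P0_def by blast
  obtain B1 m1 where B1: "0 < B1" and m1: "m1 \<in> P1" "v \<bullet> m1 = B1" "\<And>x. x \<in> P1 \<Longrightarrow> \<bar>v \<bullet> x\<bar> \<le> B1"
    using height[OF f1] unfolding P1_def by blast
  txt \<open>With \<open>B\<close> the harmonic mean of \<open>B0\<close> and \<open>B1\<close>, the fibres of \<open>P0\<close>, \<open>P1\<close> and \<open>P\<close> at the heights \<open>B0 \<theta>\<close>, \<open>B1 \<theta>\<close> and
    \<open>B \<theta>\<close> are related by \<open>comb\<close> with weights \<open>\<mu>0, \<mu>1\<close> that do not depend on \<open>\<theta>\<close>.\<close>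
  define B where "B = 1 / (\<alpha> / B0 + \<beta> / B1)"
  have B: "0 < B" using ab B0 B1 by (simp add: B_def add_pos_pos)
  define \<mu>0 where "\<mu>0 = \<alpha> * B / B0"
  define \<mu>1 where "\<mu>1 = \<beta> * B / B1"
  have \<mu>: "0 < \<mu>0" "0 < \<mu>1" using ab B B0 B1 by (auto simp: \<mu>0_def \<mu>1_def)
  have \<mu>sum: "\<mu>0 + \<mu>1 = 1"
  proof -
    have "\<mu>0 + \<mu>1 = B * (\<alpha> / B0 + \<beta> / B1)" by (simp add: \<mu>0_def \<mu>1_def algebra_simps)
    also have "\<dots> = 1" using ab B0 B1 by (simp add: B_def add_pos_pos less_imp_neq[symmetric])
    finally show ?thesis .
  qed
  define F where "F = (\<lambda>S b. emeasure lborel {a. a *\<^sub>R u + b *\<^sub>R v \<in> S})"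
  have F_meas: "F S \<in> borel_measurable borel" and F_int: "emeasure lborel S = (\<integral>\<^sup>+b. F S b \<partial>lborel)"
    if "S \<in> sets borel" for S
    using area_by_fibers[OF v that] by (simp_all add: F_def u_def)
  have F_scaled: "emeasure lborel S = ennreal c * (\<integral>\<^sup>+\<theta>. F S (c * \<theta>) \<partial>lborel)"
    if "S \<in> sets borel" "0 < c" for S c
    unfolding F_int[OF that(1)]
    using nn_integral_real_affine[OF F_meas[OF that(1)], of c 0] that(2) by simp
  have inner_fib: "v \<bullet> (a *\<^sub>R u + b *\<^sub>R v) = b" for a b
    using vu vv by (simp add: inner_add_right)
  have cont: "continuous_on UNIV (\<lambda>a. a *\<^sub>R u + b *\<^sub>R v)" for b
    by (intro continuous_intros)
  have fib_convex: "convex {a. a *\<^sub>R u + b *\<^sub>R v \<in> S}" if "convex S" for S b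
  proof (rule convexI)
    fix x y s t :: real assume "x \<in> {a. a *\<^sub>R u + b *\<^sub>R v \<in> S}" "y \<in> {a. a *\<^sub>R u + b *\<^sub>R v \<in> S}" "0 \<le> s" "0 \<le> t" "s + t = 1"
    then have "s *\<^sub>R (x *\<^sub>R u + b *\<^sub>R v) + t *\<^sub>R (y *\<^sub>R u + b *\<^sub>R v) \<in> S"
      using convexD[OF that, of "x *\<^sub>R u + b *\<^sub>R v" "y *\<^sub>R u + b *\<^sub>R v" s t] by simp
    moreover have "s *\<^sub>R (x *\<^sub>R u + b *\<^sub>R v) + t *\<^sub>R (y *\<^sub>R u + b *\<^sub>R v) = (s * x + t * y) *\<^sub>R u + ((s + t) * b) *\<^sub>R v"
      by (simp add: algebra_simps)
    ultimately show "s *\<^sub>R x + t *\<^sub>R y \<in> {a. a *\<^sub>R u + b *\<^sub>R v \<in> S}"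
      using \<open>s + t = 1\<close> by simp
  qed
  have uu: "norm u = 1" using vv' by (simp add: norm_eq_1 u_def inner_vec_def sum_2 algebra_simps)
  have fib_compact: "compact {a. a *\<^sub>R u + b *\<^sub>R v \<in> S}" if S: "compact S" for S b
  proof -
    have "closed {a. a *\<^sub>R u + b *\<^sub>R v \<in> S}"
      using continuous_closed_vimage[of S "\<lambda>a. a *\<^sub>R u + b *\<^sub>R v"] cont[of b] compact_imp_closed[OF S]
      by (simp add: vimage_def continuous_on_eq_continuous_at)
    moreover have "bounded {a. a *\<^sub>R u + b *\<^sub>R v \<in> S}"
    proof -
      obtain R where R: "\<And>x. x \<in> S \<Longrightarrow> norm x \<le> R"
        using compact_imp_bounded[OF S] by (auto simp: bounded_iff)
      have "\<bar>a\<bar> \<le> R" if "a *\<^sub>R u + b *\<^sub>R v \<in> S" for a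
      proof -
        have "u \<bullet> u = 1" using uu by (simp add: norm_eq_1)
        then have "\<bar>a\<bar> = \<bar>u \<bullet> (a *\<^sub>R u + b *\<^sub>R v)\<bar>"
          using vu by (simp add: inner_add_right inner_commute)
        also have "\<dots> \<le> norm u * norm (a *\<^sub>R u + b *\<^sub>R v)" by (rule Cauchy_Schwarz_ineq2)
        finally show ?thesis using R[OF that] uu by simp
      qed
      then show ?thesis by (auto simp: bounded_iff)
    qed
    ultimately show ?thesis by (simp add: compact_eq_bounded_closed)
  qed
  \<comment> \<open>The point \<open>\<theta> m\<close> lies on the fibre. Nonempty fibres on both
    sides are essential, since the one-dimensional inequality fails when one summand is
    empty.\<close>
  have fib_ne: "{a. a *\<^sub>R u + (\<beta>' * \<theta>) *\<^sub>R v \<in> {x. g x \<le> 1}} \<noteq> {}"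
    if g: "seminorm g" "m \<in> {x. g x \<le> 1}" "v \<bullet> m = \<beta>'" and \<theta>: "\<bar>\<theta>\<bar> \<le> 1" for g m \<beta>' \<theta>
  proof -
    have "g (\<theta> *\<^sub>R m) \<le> 1" using g(2) \<theta> seminormD(5)[OF g(1), of m] by (simp add: seminormD(1)[OF g(1)] mult_le_one)
    moreover have "(u \<bullet> (\<theta> *\<^sub>R m)) *\<^sub>R u + (\<beta>' * \<theta>) *\<^sub>R v = \<theta> *\<^sub>R m"
      using span[of "\<theta> *\<^sub>R m"] g(3) by (simp add: mult.commute)
    ultimately have "u \<bullet> (\<theta> *\<^sub>R m) \<in> {a. a *\<^sub>R u + (\<beta>' * \<theta>) *\<^sub>R v \<in> {x. g x \<le> 1}}" by (metis mem_Collect_eq)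
    then show ?thesis by blast
  qed
  have pointwise: "ennreal \<mu>0 * F P0 (B0 * \<theta>) + ennreal \<mu>1 * F P1 (B1 * \<theta>) \<le> F P (B * \<theta>)" for \<theta>
  proof (cases "\<bar>\<theta>\<bar> \<le> 1")
    case True
    show ?thesis
      unfolding F_def
    proof (rule interval_combination_measure)
      show "{a. a *\<^sub>R u + (B0 * \<theta>) *\<^sub>R v \<in> P0} \<noteq> {}" "{a. a *\<^sub>R u + (B1 * \<theta>) *\<^sub>R v \<in> P1} \<noteq> {}"
        using fib_ne[OF f0(1) _ m0(2) True] fib_ne[OF f1(1) _ m1(2) True] m0(1) m1(1) by (simp_all add: P0_def P1_def)
      have "(\<lambda>a. a *\<^sub>R u + (B * \<theta>) *\<^sub>R v) \<in> borel_measurable borel"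
        using cont by (intro borel_measurable_continuous_onI)
      from measurable_sets_borel[OF this borel(3)]
      show "{a. a *\<^sub>R u + (B * \<theta>) *\<^sub>R v \<in> P} \<in> sets borel" by (simp add: vimage_def)
      fix x y assume "x \<in> {a. a *\<^sub>R u + (B0 * \<theta>) *\<^sub>R v \<in> P0}" "y \<in> {a. a *\<^sub>R u + (B1 * \<theta>) *\<^sub>R v \<in> P1}"
      then have xy: "f0 (x *\<^sub>R u + (B0 * \<theta>) *\<^sub>R v) \<le> 1" "f1 (y *\<^sub>R u + (B1 * \<theta>) *\<^sub>R v) \<le> 1"
        by (simp_all add: P0_def P1_def)
      let ?w0 = "x *\<^sub>R u + (B0 * \<theta>) *\<^sub>R v" and ?w1 = "y *\<^sub>R u + (B1 * \<theta>) *\<^sub>R v"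
      have "f (\<mu>0 *\<^sub>R ?w0 + \<mu>1 *\<^sub>R ?w1) \<le> \<mu>0 * f0 ?w0 + \<mu>1 * f1 ?w1"
      proof (rule comb)
        show "\<mu>0 * (e \<bullet> ?w0) = \<alpha> * (norm e * B * \<theta>)" "\<mu>1 * (e \<bullet> ?w1) = \<beta> * (norm e * B * \<theta>)"
          unfolding ev inner_fib using B0 B1 by (simp_all add: \<mu>0_def \<mu>1_def)
      qed (use \<mu> \<mu>sum in auto)
      also have "\<dots> \<le> \<mu>0 * 1 + \<mu>1 * 1"
        using xy \<mu> by (intro add_mono mult_left_mono) auto
      finally have "f (\<mu>0 *\<^sub>R ?w0 + \<mu>1 *\<^sub>R ?w1) \<le> 1" using \<mu>sum by simp
      moreover have eq: "\<mu>0 * (B0 * \<theta>) + \<mu>1 * (B1 * \<theta>) = B * \<theta>"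
      proof -
        have "\<mu>0 * (B0 * \<theta>) + \<mu>1 * (B1 * \<theta>) = (\<alpha> + \<beta>) * (B * \<theta>)"
          using B0 B1 by (simp add: \<mu>0_def \<mu>1_def algebra_simps)
        then show ?thesis by (simp add: ab(3))
      qed
      have "\<mu>0 *\<^sub>R ?w0 + \<mu>1 *\<^sub>R ?w1 = (\<mu>0 * x + \<mu>1 * y) *\<^sub>R u + (B * \<theta>) *\<^sub>R v"
        unfolding eq[symmetric] by (simp add: scaleR_add_left scaleR_add_right)
      ultimately show "\<mu>0 * x + \<mu>1 * y \<in> {a. a *\<^sub>R u + (B * \<theta>) *\<^sub>R v \<in> P}"
        by (simp add: P_def)
    qed (use compact convex fib_compact fib_convex \<mu> in auto)
  next
    case False
    have "{a. a *\<^sub>R u + (B0 * \<theta>) *\<^sub>R v \<in> P0} = {}" "{a. a *\<^sub>R u + (B1 * \<theta>) *\<^sub>R v \<in> P1} = {}"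
      using m0(3) m1(3) inner_fib B0 B1 False
      by (auto dest!: m0(3) m1(3) simp: inner_fib abs_mult)
    then show ?thesis by (simp add: F_def)
  qed
  define a0 where "a0 = measure lborel P0"
  define a1 where "a1 = measure lborel P1"
  have fin: "emeasure lborel P0 < \<infinity>" "emeasure lborel P1 < \<infinity>"
    using compact[THEN compact_imp_bounded, THEN emeasure_bounded_finite] by auto
  have E: "emeasure lborel P0 = ennreal a0" "emeasure lborel P1 = ennreal a1"
    using fin by (auto simp: a0_def a1_def emeasure_eq_ennreal_measure)
  have a: "0 < a0" "0 < a1"
    using emeasure_seminorm_ball_pos[OF f0(1)] emeasure_seminorm_ball_pos[OF f1(1)] E by (simp_all add: P0_def P1_def)
  have I: "(\<integral>\<^sup>+\<theta>. F S (b * \<theta>) \<partial>lborel) = ennreal (c / b)"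
    if S: "S \<in> sets borel" "emeasure lborel S = ennreal c" and b: "0 < b" and c: "0 < c" for S b c
  proof -
    have "ennreal (1 / b) * ennreal c = (\<integral>\<^sup>+\<theta>. F S (b * \<theta>) \<partial>lborel)"
      using F_scaled[OF S(1) b] by (simp only: S(2) ennreal_divide_mult_cancel[OF b])
    then show ?thesis using b c by (simp flip: ennreal_mult)
  qed
  have I0: "(\<integral>\<^sup>+\<theta>. F P0 (B0 * \<theta>) \<partial>lborel) = ennreal (a0 / B0)" by (rule I[OF borel(1) E(1) B0 a(1)])
  have I1: "(\<integral>\<^sup>+\<theta>. F P1 (B1 * \<theta>) \<partial>lborel) = ennreal (a1 / B1)" by (rule I[OF borel(2) E(2) B1 a(2)])
  note [measurable] = F_meas[OF borel(1)] F_meas[OF borel(2)] F_meas[OF borel(3)]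
  have "ennreal (1 / (\<alpha> / a0 + \<beta> / a1)) \<le> ennreal (B * (\<mu>0 * (a0 / B0) + \<mu>1 * (a1 / B1)))"
    unfolding \<mu>0_def \<mu>1_def B_def using a B0 B1 ab by (intro ennreal_leI harmonic_cauchy) auto
  also have "\<dots> = ennreal B * (ennreal \<mu>0 * ennreal (a0 / B0) + ennreal \<mu>1 * ennreal (a1 / B1))"
    using \<mu> B a B0 B1 by (simp add: ennreal_mult[symmetric] ennreal_plus[symmetric] del: ennreal_plus)
  also have "\<dots> = ennreal B * (\<integral>\<^sup>+\<theta>. ennreal \<mu>0 * F P0 (B0 * \<theta>) + ennreal \<mu>1 * F P1 (B1 * \<theta>) \<partial>lborel)"
    by (simp add: nn_integral_add nn_integral_cmult I0 I1)
  also have "\<dots> \<le> ennreal B * (\<integral>\<^sup>+\<theta>. F P (B * \<theta>) \<partial>lborel)"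
    by (intro mult_left_mono nn_integral_mono pointwise) auto
  also have "\<dots> = emeasure lborel P"
    by (rule F_scaled[OF borel(3) B, symmetric])
  finally show ?thesis by (simp add: a0_def a1_def P0_def P1_def P_def)
qed

section \<open>Convexity of powers of the inverse area\<close>

lemma vol_powr_neg_nonneg [simp]: "0 \<le> vol_powr_neg S r"
  by (simp add: vol_powr_neg_def)

text \<open>Reduces the exponent \<open>r\<close> to the exponent 1. The convention for infinite
  area is respected because \<open>0 powr r = 0\<close>.\<close>

lemma vol_powr_neg_eq_powr: "vol_powr_neg S r = vol_powr_neg S 1 powr r"
proof -
  have "x powr (- r) = (x powr (- 1)) powr r" for x :: real by (subst powr_powr) simp
  then show ?thesis by (cases "emeasure lborel S = \<infinity>") (simp_all only: vol_powr_neg_def simp_thms if_True if_False powr_0)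
qed

lemma vol_powr_neg_le_inverse:
  assumes "0 < a" "ennreal a \<le> emeasure lborel S"
  shows "vol_powr_neg S 1 \<le> 1 / a"
proof (cases "emeasure lborel S = \<infinity>")
  case False
  then have "a \<le> measure lborel S" using assms by (simp add: emeasure_eq_ennreal_measure)
  then show ?thesis using False assms by (simp add: vol_powr_neg_def powr_minus divide_inverse le_imp_inverse_le)
qed (use assms in \<open>simp add: vol_powr_neg_def\<close>)

text \<open>The argument 0 has to be included because it is the value assigned to an infinite
  area.\<close>

lemma powr_convex_nonneg:
  fixes x y s t q :: real
  assumes "0 \<le> x" "0 \<le> y" "0 \<le> s" "0 \<le> t" "s + t = 1" "1 \<le> q"
  shows "(s * x + t * y) powr q \<le> s * x powr q + t * y powr q"
proof -
  have zero: "(a * z) powr q \<le> a * z powr q" if "0 \<le> a" "a \<le> 1" "0 \<le> z" for a z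
  proof -
    have "a powr q \<le> a powr 1" using that assms(6) powr_mono'[of 1 q a] by simp
    then have "a powr q \<le> a" using that by (cases "a = 0") simp_all
    then show ?thesis using that by (simp add: powr_mult mult_right_mono)
  qed
  consider "x = 0" | "y = 0" | "0 < x" "0 < y" using assms by fastforce
  then show ?thesis
  proof cases
    case 1 then show ?thesis using zero[of t y] assms by simp
  next
    case 2 then show ?thesis using zero[of s x] assms by simp
  next
    case 3
    have "s = 1 - t" "t \<le> 1" using assms by auto
    then show ?thesis using convex_onD[OF powr_convex[OF assms(6)], of t x y] 3 assms(4) by simp
  qed
qed

text \<open>Unit balls of degenerate seminorms are unbounded; adding a small multiple of the norm makes them compact.\<close>

lemma vol_powr_neg_seminorm_limit:
  fixes f :: "real^2 \<Rightarrow> real"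
  assumes f: "seminorm f"
  shows "(\<lambda>n. vol_powr_neg {x. f x + inverse (real (Suc n)) * norm x \<le> 1} 1) \<longlonglongrightarrow> vol_powr_neg {x. f x \<le> 1} 1"
proof -
  define P where "P = {x. f x \<le> 1}"
  define A where "A = (\<lambda>n. {x. f x + inverse (real (Suc n)) * norm x \<le> 1})"
  have sn: "seminorm (\<lambda>x. f x + inverse (real (Suc n)) * norm x)" for n
    by (rule seminorm_add_norm[OF f]) simp
  have A_borel: "A n \<in> sets borel" for n
    unfolding A_def by (intro borel_closed seminorm_ball(1) sn)
  have P_borel: "P \<in> sets borel" unfolding P_def by (intro borel_closed seminorm_ball(1) f)
  have "compact (A n)" for n
    unfolding A_def
  proof (rule compact_norm_ball[OF sn])
    show "0 < inverse (real (Suc n))" by simp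
    show "inverse (real (Suc n)) * norm x \<le> f x + inverse (real (Suc n)) * norm x" for x
      using seminormD(5)[OF f] by simp
  qed
  then have A_fin: "emeasure lborel (A n) < \<infinity>" for n
    by (intro emeasure_bounded_finite compact_imp_bounded)
  have inc: "incseq A"
  proof (rule incseq_SucI)
    fix n show "A n \<subseteq> A (Suc n)"
    proof
      fix x assume x: "x \<in> A n"
      have "inverse (real (Suc (Suc n))) * norm x \<le> inverse (real (Suc n)) * norm x"
        by (intro mult_right_mono le_imp_inverse_le) auto
      then show "x \<in> A (Suc n)" using x unfolding A_def by simp
    qed
  qed
  have lim: "(\<lambda>n. emeasure lborel (A n)) \<longlonglongrightarrow> emeasure lborel P"
  proof -
    have sub1: "(\<Union>n. A n) \<subseteq> P"
    proof
      fix x assume "x \<in> (\<Union>n. A n)"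
      then obtain n where "f x + inverse (real (Suc n)) * norm x \<le> 1" by (auto simp: A_def)
      moreover have "0 \<le> inverse (real (Suc n)) * norm x" by simp
      ultimately show "x \<in> P" unfolding P_def mem_Collect_eq by linarith
    qed
    \<comment> \<open>The points that all regularized balls miss satisfy \<open>f x = 1\<close>, so
      they lie in the frontier of a convex set, which has measure zero.\<close>
    have sub2: "P - (\<Union>n. A n) \<subseteq> frontier P"
    proof
      fix x assume x: "x \<in> P - (\<Union>n. A n)"
      have "f x = 1"
      proof (rule ccontr)
        assume "f x \<noteq> 1"
        then have fx: "0 < 1 - f x" using x by (simp add: P_def)
        then obtain n where n: "inverse (real (Suc n)) < (1 - f x) / (norm x + 1)"
          using reals_Archimedean[of "(1 - f x) / (norm x + 1)"] by (auto simp: add_nonneg_pos)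
        have "inverse (real (Suc n)) * norm x \<le> inverse (real (Suc n)) * (norm x + 1)" by (intro mult_left_mono) auto
        also have "\<dots> \<le> 1 - f x" using n by (simp add: pos_less_divide_eq add_nonneg_pos less_imp_le del: of_nat_Suc)
        finally have "x \<in> A n" unfolding A_def mem_Collect_eq by linarith
        then show False using x by blast
      qed
      then have "x \<notin> interior P" using interior_seminorm_ball(2)[OF f] by (auto simp: P_def)
      then show "x \<in> frontier P" using x closure_subset by (auto simp: frontier_def)
    qed
    have "negligible (frontier P)"
      unfolding P_def by (intro negligible_convex_frontier seminorm_ball f)
    then have "P - (\<Union>n. A n) \<in> null_sets lebesgue"
      using sub2 negligible_subset by (auto simp: negligible_iff_null_sets)
    then have null: "emeasure lborel (P - (\<Union>n. A n)) = 0"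
      using A_borel P_borel by (simp add: null_sets_def)
    have "emeasure lborel P = emeasure lborel (\<Union>n. A n)"
    proof -
      have "emeasure lborel P = emeasure lborel ((\<Union>n. A n) \<union> (P - (\<Union>n. A n)))"
        using sub1 by (simp add: Un_absorb1)
      also have "\<dots> = emeasure lborel (\<Union>n. A n) + emeasure lborel (P - (\<Union>n. A n))"
        using A_borel P_borel by (intro plus_emeasure[symmetric]) auto
      finally show ?thesis by (simp add: null)
    qed
    then show ?thesis
      using Lim_emeasure_incseq[of A lborel] A_borel inc by auto
  qed
  have eqA: "emeasure lborel (A n) = ennreal (measure lborel (A n))" for n
    using less_imp_neq[OF A_fin[of n]] by (simp add: emeasure_eq_ennreal_measure)
  have "(\<lambda>n. vol_powr_neg (A n) 1) = (\<lambda>n. measure lborel (A n) powr (- 1))"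
    using less_imp_neq[OF A_fin] by (simp add: vol_powr_neg_def)
  also have "\<dots> \<longlonglongrightarrow> vol_powr_neg P 1"
  \<comment> \<open>For infinite area the value 0 of the convention is the actual limit of the
    regularized values.\<close>
  proof (cases "emeasure lborel P = \<infinity>")
    case True
    then have "filterlim (\<lambda>n. measure lborel (A n)) at_top sequentially"
      using lim unfolding eqA by (simp add: ennreal_tendsto_top_eq_at_top)
    then show ?thesis
      using True tendsto_neg_powr[of "-1" "\<lambda>n. measure lborel (A n)" sequentially] by (simp add: vol_powr_neg_def)
  next
    case False
    then have P: "emeasure lborel P = ennreal (measure lborel P)" by (simp add: emeasure_eq_ennreal_measure)
    have "0 < measure lborel P"
      using emeasure_seminorm_ball_pos[OF f] P by (simp add: P_def)
    moreover have "(\<lambda>n. measure lborel (A n)) \<longlonglongrightarrow> measure lborel P"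
      using lim unfolding eqA P by simp
    ultimately show ?thesis
      using False by (auto simp: vol_powr_neg_def intro!: tendsto_divide tendsto_const)
  qed
  finally show ?thesis by (simp add: A_def P_def)
qed

text \<open>Only \<open>f0\<close> and \<open>f1\<close> are regularized: enlarging them keeps
  \<open>comb\<close>, so the left-hand side stays fixed while the right-hand side converges. The
  exponent \<open>r\<close> comes in at the end, through monotonicity and convexity of the power
  function.\<close>

lemma vol_powr_neg_convex:
  fixes f0 f1 f :: "real^2 \<Rightarrow> real"
  assumes f0: "seminorm f0" and f1: "seminorm f1" and f: "seminorm f"
    and ab: "0 < \<alpha>" "0 < \<beta>" "\<alpha> + \<beta> = 1" and e: "e \<noteq> 0" and r: "1 \<le> r"
    and comb: "\<And>\<mu>0 \<mu>1 w0 w1 b. \<lbrakk>0 \<le> \<mu>0; 0 \<le> \<mu>1; \<mu>0 + \<mu>1 = 1; \<mu>0 * (e \<bullet> w0) = \<alpha> * b; \<mu>1 * (e \<bullet> w1) = \<beta> * b\<rbrakk>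
      \<Longrightarrow> f (\<mu>0 *\<^sub>R w0 + \<mu>1 *\<^sub>R w1) \<le> \<mu>0 * f0 w0 + \<mu>1 * f1 w1"
  shows "vol_powr_neg {x. f x \<le> 1} r \<le> \<alpha> * vol_powr_neg {x. f0 x \<le> 1} r + \<beta> * vol_powr_neg {x. f1 x \<le> 1} r"
proof -
  define V where "V = (\<lambda>g::real^2 \<Rightarrow> real. vol_powr_neg {x. g x \<le> 1} 1)"
  have approx: "V f \<le> \<alpha> * V (\<lambda>x. f0 x + inverse (real (Suc n)) * norm x) + \<beta> * V (\<lambda>x. f1 x + inverse (real (Suc n)) * norm x)" for n
  proof -
    define \<epsilon> where "\<epsilon> = inverse (real (Suc n))"
    have \<epsilon>: "0 < \<epsilon>" by (simp add: \<epsilon>_def)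
    define g0 where "g0 = (\<lambda>x. f0 x + \<epsilon> * norm x)"
    define g1 where "g1 = (\<lambda>x. f1 x + \<epsilon> * norm x)"
    have g: "seminorm g0" "seminorm g1" "\<epsilon> * norm x \<le> g0 x" "\<epsilon> * norm x \<le> g1 x" for x
      using seminorm_add_norm[OF f0 less_imp_le[OF \<epsilon>]] seminorm_add_norm[OF f1 less_imp_le[OF \<epsilon>]]
        seminormD(5)[OF f0, of x] seminormD(5)[OF f1, of x] by (simp_all add: g0_def g1_def)
    define a0 where "a0 = measure lborel {x. g0 x \<le> 1}"
    define a1 where "a1 = measure lborel {x. g1 x \<le> 1}"
    have fin: "emeasure lborel {x. g0 x \<le> 1} < \<infinity>" "emeasure lborel {x. g1 x \<le> 1} < \<infinity>"
      using compact_norm_ball[OF g(1) \<epsilon> g(3)] compact_norm_ball[OF g(2) \<epsilon> g(4)]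
      by (simp_all only: compact_imp_bounded emeasure_bounded_finite)
    have a: "0 < a0" "0 < a1"
      using emeasure_seminorm_ball_pos[OF g(1)] emeasure_seminorm_ball_pos[OF g(2)] fin
      by (auto simp: a0_def a1_def measure_def enn2real_positive_iff)
    have V: "V g0 = 1 / a0" "V g1 = 1 / a1"
      using fin a by (auto simp: V_def vol_powr_neg_def a0_def a1_def powr_minus divide_inverse)
    have "ennreal (1 / (\<alpha> / a0 + \<beta> / a1)) \<le> emeasure lborel {x. f x \<le> 1}"
      unfolding a0_def a1_def
    proof (rule polar_shadow_area[OF g(1) \<epsilon> g(3) g(2) \<epsilon> g(4) f ab e])
      fix \<mu>0 \<mu>1 w0 w1 b
      assume *: "0 \<le> \<mu>0" "0 \<le> \<mu>1" "\<mu>0 + \<mu>1 = 1" "\<mu>0 * (e \<bullet> w0) = \<alpha> * b" "\<mu>1 * (e \<bullet> w1) = \<beta> * b"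
      have "f (\<mu>0 *\<^sub>R w0 + \<mu>1 *\<^sub>R w1) \<le> \<mu>0 * f0 w0 + \<mu>1 * f1 w1" by (rule comb[OF *])
      also have "\<dots> \<le> \<mu>0 * g0 w0 + \<mu>1 * g1 w1"
        using * \<epsilon> by (intro add_mono mult_left_mono) (auto simp: g0_def g1_def)
      finally show "f (\<mu>0 *\<^sub>R w0 + \<mu>1 *\<^sub>R w1) \<le> \<mu>0 * g0 w0 + \<mu>1 * g1 w1" .
    qed
    then have "V f \<le> 1 / (1 / (\<alpha> / a0 + \<beta> / a1))"
      unfolding V_def using a ab by (intro vol_powr_neg_le_inverse) (auto simp: add_pos_pos)
    then show ?thesis using V by (simp add: g0_def g1_def \<epsilon>_def)
  qed
  have "V f \<le> \<alpha> * V f0 + \<beta> * V f1"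
  proof (rule LIMSEQ_le_const)
    show "(\<lambda>n. \<alpha> * V (\<lambda>x. f0 x + inverse (real (Suc n)) * norm x) + \<beta> * V (\<lambda>x. f1 x + inverse (real (Suc n)) * norm x))
        \<longlonglongrightarrow> \<alpha> * V f0 + \<beta> * V f1"
      unfolding V_def by (intro tendsto_intros vol_powr_neg_seminorm_limit f0 f1)
  qed (use approx in blast)
  then have "V f powr r \<le> (\<alpha> * V f0 + \<beta> * V f1) powr r"
    using r by (intro powr_mono2) (auto simp: V_def)
  also have "\<dots> \<le> \<alpha> * V f0 powr r + \<beta> * V f1 powr r"
    using ab r by (intro powr_convex_nonneg) (auto simp: V_def)
  finally show ?thesis
    unfolding V_def vol_powr_neg_eq_powr[symmetric] .
qed

section \<open>Centroid bodies as unit balls of seminorms\<close>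

lemma seminorm_bounded:
  assumes "seminorm h"
  obtains C where "\<And>x. h x \<le> C * norm x"
proof -
  have "compact (h ` cball 0 1)"
    by (intro compact_continuous_image continuous_on_seminorm assms compact_cball)
  then have "bounded (h ` cball 0 1)" by (rule compact_imp_bounded)
  then obtain C where C: "\<forall>x\<in>cball 0 1. \<bar>h x\<bar> \<le> C" unfolding bounded_iff by auto
  have "h x \<le> C * norm x" for x
  proof (cases "x = 0")
    case False
    have "h (x /\<^sub>R norm x) \<le> C" using bspec[OF C, of "x /\<^sub>R norm x"] False by auto
    moreover have "h (x /\<^sub>R norm x) = h x / norm x"
      using seminormD(1)[OF assms, of "inverse (norm x)" x] by (simp add: divide_inverse mult.commute)
    ultimately show ?thesis using False by (simp add: pos_divide_le_eq)
  qed (simp add: seminormD(3)[OF assms])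
  then show ?thesis using that by blast
qed

text \<open>Hahn-Banach: a hyperplane separates the point \<open>(z, h z)\<close> from the strict
  epigraph of \<open>h\<close>. The vertical component of its normal is positive, so the hyperplane
  is the graph of an affine function.\<close>

lemma seminorm_supporting_functional:
  fixes h :: "'a::euclidean_space \<Rightarrow> real"
  assumes h: "seminorm h"
  obtains x where "\<And>y. x \<bullet> y \<le> h y" "x \<bullet> z = h z"
proof -
  define T where "T = {(y, s). h y < s}"
  have "convex T"
  proof (rule convexI)
    fix a b :: "'a \<times> real" and u v :: real
    assume *: "a \<in> T" "b \<in> T" "0 \<le> u" "0 \<le> v" "u + v = 1"
    have "h (u *\<^sub>R fst a + v *\<^sub>R fst b) \<le> u * h (fst a) + v * h (fst b)"
      using * by (intro seminorm_convex_comb h)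
    also have "\<dots> < u * snd a + v * snd b"
    proof -
      have "u * h (fst a) \<le> u * snd a" "v * h (fst b) \<le> v * snd b"
        using * by (auto simp: T_def intro!: mult_left_mono)
      moreover have "u * h (fst a) < u * snd a \<or> v * h (fst b) < v * snd b"
        using * by (cases "u = 0") (auto simp: T_def)
      ultimately show ?thesis by linarith
    qed
    finally show "u *\<^sub>R a + v *\<^sub>R b \<in> T" by (simp add: T_def case_prod_unfold)
  qed
  moreover have "(0, 1) \<in> T" by (simp add: T_def seminormD(3)[OF h])
  moreover have "{(z, h z)} \<inter> T = {}" by (simp add: T_def)
  ultimately have "\<exists>a b. a \<noteq> 0 \<and> (\<forall>w\<in>{(z, h z)}. a \<bullet> w \<le> b) \<and> (\<forall>w\<in>T. b \<le> a \<bullet> w)"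
    by (intro separating_hyperplane_sets) auto
  then obtain a b where ab: "a \<noteq> 0" "a \<bullet> (z, h z) \<le> b" "\<And>w. w \<in> T \<Longrightarrow> b \<le> a \<bullet> w"
    by blast
  obtain c d where a: "a = (c, d)" by (cases a)
  have sep: "c \<bullet> z + d * h z \<le> c \<bullet> y + d * s" if "h y < s" for y s
    using ab(2) ab(3)[of "(y, s)"] that by (simp add: T_def a)
  have "0 \<le> d"
  proof (rule ccontr)
    assume "\<not> 0 \<le> d"
    then have d: "d < 0" by simp
    have "c \<bullet> z + d * h z \<le> c \<bullet> z + d * (h z + 1)" by (rule sep) simp
    then show False using d by (simp add: algebra_simps)
  qed
  moreover have "d \<noteq> 0"
  proof
    assume d: "d = 0"
    then have "c \<noteq> 0" using ab(1) a by (simp add: zero_prod_def)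
    moreover have "c \<bullet> z \<le> c \<bullet> (z - c)"
      using sep[of "z - c" "h (z - c) + 1"] d by simp
    then have "c \<bullet> c \<le> 0" by (simp add: inner_diff_right)
    ultimately show False by (metis inner_gt_zero_iff not_le)
  qed
  ultimately have d: "0 < d" by simp
  define x where "x = - (c /\<^sub>R d)"
  have c: "c = - (d *\<^sub>R x)" using d by (simp add: x_def)
  define m where "m = x \<bullet> z - h z"
  have le: "x \<bullet> y - h y \<le> m" for y
  proof (rule field_le_epsilon)
    fix \<epsilon> :: real assume "0 < \<epsilon>"
    then have "d * (h z - x \<bullet> z) \<le> d * (h y + \<epsilon> - x \<bullet> y)"
      using sep[of y "h y + \<epsilon>"] by (simp add: c algebra_simps)
    then show "x \<bullet> y - h y \<le> m + \<epsilon>" using d by (simp add: m_def)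
  qed
  \<comment> \<open>Homogeneity removes the additive constant: \<open>y = 0\<close> gives
    \<open>0 \<le> m\<close>, and \<open>y = 2 z\<close> gives \<open>2 m \<le> m\<close>.\<close>
  have "0 \<le> m" using le[of 0] by (simp add: seminormD(3)[OF h])
  moreover have "m \<le> 0" using le[of "2 *\<^sub>R z"] seminormD(1)[OF h, of 2 z] by (simp add: m_def)
  ultimately have m: "m = 0" by simp
  show ?thesis using that[of x] le m by (simp add: m_def)
qed

text \<open>Resolves the definite description: the intersection of the half-spaces prescribed by
  \<open>h\<close> attains \<open>h\<close> through the supporting functionals, and separation of
  points from closed convex sets gives uniqueness.\<close>

lemma body_of_support_seminorm:
  fixes h :: "'a::euclidean_space \<Rightarrow> real"
  assumes h: "seminorm h"
  shows "body_of_support h = {x. \<forall>z. x \<bullet> z \<le> h z}"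
proof -
  define L0 where "L0 = {x. \<forall>z. x \<bullet> z \<le> h z}"
  have L0_eq: "L0 = (\<Inter>z. {x. x \<bullet> z \<le> h z})" by (auto simp: L0_def)
  have "closed L0" unfolding L0_eq by (intro closed_INT ballI closed_Collect_le continuous_intros)
  moreover have "bounded L0"
  proof -
    obtain C where C: "\<And>x. h x \<le> C * norm x" using seminorm_bounded[OF h] by blast
    have "norm x \<le> C" if "x \<in> L0" for x
    proof (cases "x = 0")
      case False
      have "norm x * norm x = x \<bullet> x" by (simp add: power2_norm_eq_inner flip: power2_eq_square)
      then have "norm x * norm x \<le> h x" using that by (simp add: L0_def)
      also have "\<dots> \<le> C * norm x" by (rule C)
      finally show ?thesis using False by simp
    next
      case True
      have "0 \<le> C * norm (SOME b::'a. b \<in> Basis)" using C seminormD(5)[OF h] order_trans by blast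
      then show ?thesis using True by (simp add: SOME_Basis)
    qed
    then show ?thesis unfolding bounded_iff by blast
  qed
  ultimately have "compact L0" by (simp add: compact_eq_bounded_closed)
  moreover have "convex L0"
    unfolding L0_eq by (intro convex_INT) (simp add: inner_commute convex_halfspace_le)
  moreover obtain x0 where "x0 \<in> L0" using seminorm_supporting_functional[OF h, of 0] by (auto simp: L0_def)
  moreover have "support_function L0 z = h z" for z
  proof -
    obtain x where "\<And>y. x \<bullet> y \<le> h y" "x \<bullet> z = h z" using seminorm_supporting_functional[OF h] by blast
    then show ?thesis
      unfolding support_function_def by (intro cSup_eq_maximum) (auto simp: L0_def image_iff intro!: exI[of _ x])
  qed
  moreover have "L = L0" if L: "compact L" "convex L" "L \<noteq> {}" "\<forall>z. support_function L z = h z" for L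
  proof
    have le: "x \<bullet> z \<le> h z" if "x \<in> L" for x z
    proof -
      have "compact ((\<lambda>x. x \<bullet> z) ` L)" by (intro compact_continuous_image L continuous_intros)
      then have "bdd_above ((\<lambda>x. x \<bullet> z) ` L)" by (rule bounded_imp_bdd_above[OF compact_imp_bounded])
      then have "x \<bullet> z \<le> support_function L z" unfolding support_function_def using that by (intro cSUP_upper)
      then show ?thesis using L by simp
    qed
    then show "L \<subseteq> L0" by (auto simp: L0_def)
    show "L0 \<subseteq> L"
    proof
      fix x assume x: "x \<in> L0"
      show "x \<in> L"
      proof (rule ccontr)
        assume "x \<notin> L"
        then obtain a b where ab: "a \<bullet> x < b" "\<And>y. y \<in> L \<Longrightarrow> b < a \<bullet> y"
          using separating_hyperplane_closed_point[OF L(2) compact_imp_closed[OF L(1)]] by blast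
        have "support_function L (- a) \<le> - b"
          unfolding support_function_def using L ab(2) by (intro cSUP_least) (auto simp: inner_commute intro: less_imp_le)
        moreover have "x \<bullet> (- a) \<le> h (- a)" using x unfolding L0_def by blast
        ultimately show False using L(4) ab(1) by (simp add: inner_commute)
      qed
    qed
  qed
  ultimately show ?thesis
    unfolding body_of_support_def L0_def[symmetric] by (intro the_equality) blast+
qed

text \<open>By this identity the areas of polars become areas of unit balls of explicit
  seminorms.\<close>

lemma polar_body_of_support:
  fixes h :: "'a::euclidean_space \<Rightarrow> real"
  assumes h: "seminorm h"
  shows "polar (body_of_support h) = {w. h w \<le> 1}"
proof -
  have "(\<forall>x. (\<forall>z. x \<bullet> z \<le> h z) \<longrightarrow> w \<bullet> x \<le> 1) \<longleftrightarrow> h w \<le> 1" for w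
  proof
    assume *: "\<forall>x. (\<forall>z. x \<bullet> z \<le> h z) \<longrightarrow> w \<bullet> x \<le> 1"
    obtain x where "\<And>y. x \<bullet> y \<le> h y" "x \<bullet> w = h w" using seminorm_supporting_functional[OF h] by blast
    then show "h w \<le> 1" using *[rule_format, of x] by (simp add: inner_commute)
  next
    assume "h w \<le> 1"
    then show "\<forall>x. (\<forall>z. x \<bullet> z \<le> h z) \<longrightarrow> w \<bullet> x \<le> 1" by (metis inner_commute order_trans)
  qed
  then show ?thesis by (simp add: polar_def body_of_support_seminorm[OF h])
qed

text \<open>The L^p norm for \<open>\<nu>\<close> scaled to total mass 1. Counting measure on the
  indices gives the empirical body and Lebesgue measure on \<open>K\<close> the centroid body, so
  one argument covers both. At \<open>p = \<infinity>\<close> a true supremum is taken, as in the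
  definitions of the two bodies.\<close>

definition mean_norm :: "ennreal \<Rightarrow> 'i measure \<Rightarrow> ('i \<Rightarrow> real) \<Rightarrow> real" where
  "mean_norm p \<nu> c = (if p = \<infinity> then (SUP i\<in>space \<nu>. \<bar>c i\<bar>)
     else ((LINT i|\<nu>. \<bar>c i\<bar> powr enn2real p) / measure \<nu> (space \<nu>)) powr (1 / enn2real p))"

text \<open>Bounded at every point and not just almost everywhere, since the supremum at
  \<open>p = \<infinity>\<close> must be that of a set bounded above.\<close>

definition bounded_measurable :: "'i measure \<Rightarrow> ('i \<Rightarrow> 'a::euclidean_space) set" where
  "bounded_measurable \<nu> = {c \<in> borel_measurable \<nu>. bounded (c ` space \<nu>)}"

lemma bounded_measurableE:
  assumes "c \<in> bounded_measurable \<nu>"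
  obtains B where "c \<in> borel_measurable \<nu>" "0 \<le> B" "\<And>i. i \<in> space \<nu> \<Longrightarrow> norm (c i) \<le> B"
proof -
  obtain B where "\<And>i. i \<in> space \<nu> \<Longrightarrow> norm (c i) \<le> B"
    using assms by (auto simp: bounded_measurable_def bounded_iff)
  then have "norm (c i) \<le> \<bar>B\<bar>" if "i \<in> space \<nu>" for i using that by force
  then show ?thesis using assms that[of "\<bar>B\<bar>"] by (auto simp: bounded_measurable_def)
qed

lemma bounded_measurableI:
  "c \<in> borel_measurable \<nu> \<Longrightarrow> (\<And>i. i \<in> space \<nu> \<Longrightarrow> norm (c i) \<le> B) \<Longrightarrow> c \<in> bounded_measurable \<nu>"
  by (auto simp: bounded_measurable_def bounded_iff)

lemma bounded_measurable_linear:
  fixes c d :: "'i \<Rightarrow> 'a::euclidean_space"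
  assumes c: "c \<in> bounded_measurable \<nu>" and d: "d \<in> bounded_measurable \<nu>"
  shows "(\<lambda>i. c i + d i) \<in> bounded_measurable \<nu>" "(\<lambda>i. a *\<^sub>R c i) \<in> bounded_measurable \<nu>"
    "(\<lambda>i. c i \<bullet> w) \<in> bounded_measurable \<nu>"
proof -
  obtain B where B: "c \<in> borel_measurable \<nu>" "\<And>i. i \<in> space \<nu> \<Longrightarrow> norm (c i) \<le> B"
    using bounded_measurableE[OF c] by metis
  obtain B' where B': "d \<in> borel_measurable \<nu>" "\<And>i. i \<in> space \<nu> \<Longrightarrow> norm (d i) \<le> B'"
    using bounded_measurableE[OF d] by metis
  have [measurable]: "c \<in> borel_measurable \<nu>" "d \<in> borel_measurable \<nu>" using B B' by auto
  show "(\<lambda>i. c i + d i) \<in> bounded_measurable \<nu>"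
    by (rule bounded_measurableI[where B = "B + B'"]) (auto intro!: norm_triangle_le add_mono B B')
  show "(\<lambda>i. a *\<^sub>R c i) \<in> bounded_measurable \<nu>"
    by (rule bounded_measurableI[where B = "\<bar>a\<bar> * B"]) (auto intro!: mult_left_mono B)
  show "(\<lambda>i. c i \<bullet> w) \<in> bounded_measurable \<nu>"
    by (rule bounded_measurableI[where B = "B * norm w"])
       (auto intro!: order_trans[OF Cauchy_Schwarz_ineq2] mult_right_mono B)
qed

locale mean_norm_space = finite_measure \<nu> for \<nu> :: "'i measure" +
  fixes p :: ennreal
  assumes p: "1 \<le> p" and total: "0 < measure \<nu> (space \<nu>)"
begin

lemma space_nonempty: "space \<nu> \<noteq> {}"
  using total by (metis less_irrefl measure_empty)

lemma p_finite: "p \<noteq> \<infinity> \<Longrightarrow> 1 \<le> enn2real p"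
  using p by (cases p) auto

lemma integrable_powr:
  fixes c :: "'i \<Rightarrow> real"
  assumes c: "c \<in> bounded_measurable \<nu>" and q: "0 \<le> q"
  shows "integrable \<nu> (\<lambda>i. \<bar>c i\<bar> powr q)"
proof -
  obtain B where B: "c \<in> borel_measurable \<nu>" "0 \<le> B" "\<And>i. i \<in> space \<nu> \<Longrightarrow> norm (c i) \<le> B"
    using bounded_measurableE[OF c] by blast
  note [measurable] = B(1)
  show ?thesis
    by (rule integrable_const_bound[where B = "B powr q"]) (auto intro!: powr_mono2 q B(3)[simplified])
qed

lemma mean_norm_nonneg:
  fixes c :: "'i \<Rightarrow> real"
  assumes c: "c \<in> bounded_measurable \<nu>"
  shows "0 \<le> mean_norm p \<nu> c"
proof (cases "p = \<infinity>")
  case True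
  obtain B where B: "\<And>i. i \<in> space \<nu> \<Longrightarrow> \<bar>c i\<bar> \<le> B" using bounded_measurableE[OF c] unfolding real_norm_def by blast
  obtain i where i: "i \<in> space \<nu>" using space_nonempty by blast
  have "\<bar>c i\<bar> \<le> (SUP i\<in>space \<nu>. \<bar>c i\<bar>)" using i B by (intro cSUP_upper bdd_aboveI2)
  then show ?thesis using True by (simp add: mean_norm_def)
qed (simp add: mean_norm_def)

lemma mean_norm_bound:
  fixes c :: "'i \<Rightarrow> real"
  assumes c: "c \<in> bounded_measurable \<nu>" and B: "\<And>i. i \<in> space \<nu> \<Longrightarrow> \<bar>c i\<bar> \<le> B"
  shows "mean_norm p \<nu> c \<le> B"
proof (cases "p = \<infinity>")
  case True
  then show ?thesis using B space_nonempty by (simp add: mean_norm_def cSUP_least)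
next
  case False
  define q where "q = enn2real p"
  have q: "1 \<le> q" using p_finite[OF False] by (simp add: q_def)
  have B0: "0 \<le> B" using B space_nonempty by force
  have "(LINT i|\<nu>. \<bar>c i\<bar> powr q) \<le> (LINT i|\<nu>. B powr q)"
    using q B by (intro integral_mono integrable_powr c integrable_const powr_mono2) auto
  then have "(LINT i|\<nu>. \<bar>c i\<bar> powr q) / measure \<nu> (space \<nu>) \<le> B powr q"
    using total by (simp add: field_simps)
  then have "((LINT i|\<nu>. \<bar>c i\<bar> powr q) / measure \<nu> (space \<nu>)) powr (1 / q) \<le> (B powr q) powr (1 / q)"
    using q by (intro powr_mono2) auto
  then show ?thesis using q B0 False by (simp add: mean_norm_def q_def[symmetric] powr_powr)
qed

lemma mean_norm_scale:
  fixes c :: "'i \<Rightarrow> real"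
  assumes c: "c \<in> bounded_measurable \<nu>"
  shows "mean_norm p \<nu> (\<lambda>i. a * c i) = \<bar>a\<bar> * mean_norm p \<nu> c"
proof (cases "p = \<infinity>")
  case True
  obtain B where B: "\<And>i. i \<in> space \<nu> \<Longrightarrow> \<bar>c i\<bar> \<le> B" using bounded_measurableE[OF c] unfolding real_norm_def by blast
  have "bdd_above ((\<lambda>i. \<bar>c i\<bar>) ` space \<nu>)" using B by (intro bdd_aboveI2)
  moreover have "continuous (at_left (SUP i\<in>space \<nu>. \<bar>c i\<bar>)) (\<lambda>x. \<bar>a\<bar> * x)" by (intro continuous_intros)
  ultimately show ?thesis
    using True space_nonempty
      continuous_at_Sup_mono[of "\<lambda>x. \<bar>a\<bar> * x" "(\<lambda>i. \<bar>c i\<bar>) ` space \<nu>"]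
    by (simp add: mean_norm_def abs_mult image_image mono_def mult_left_mono)
next
  case False
  define q where "q = enn2real p"
  have q: "1 \<le> q" using p_finite[OF False] by (simp add: q_def)
  have "(LINT i|\<nu>. \<bar>a * c i\<bar> powr q) = \<bar>a\<bar> powr q * (LINT i|\<nu>. \<bar>c i\<bar> powr q)"
    by (simp add: abs_mult powr_mult)
  then show ?thesis
    using q False by (simp add: mean_norm_def q_def[symmetric] powr_mult powr_powr powr_divide)
qed

text \<open>For finite \<open>p\<close> Minkowski's inequality follows from homogeneity: dividing
  \<open>c\<close> and \<open>d\<close> by numbers just above their norms puts both into the unit
  ball, whose convexity is that of the power function.\<close>

lemma mean_norm_triangle:
  fixes c d :: "'i \<Rightarrow> real"
  assumes c: "c \<in> bounded_measurable \<nu>" and d: "d \<in> bounded_measurable \<nu>"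
  shows "mean_norm p \<nu> (\<lambda>i. c i + d i) \<le> mean_norm p \<nu> c + mean_norm p \<nu> d"
proof (cases "p = \<infinity>")
  case True
  have bdd: "bdd_above ((\<lambda>i. \<bar>c i\<bar>) ` space \<nu>)" if c: "c \<in> bounded_measurable \<nu>" for c :: "'i \<Rightarrow> real"
  proof -
    obtain B where "\<And>i. i \<in> space \<nu> \<Longrightarrow> \<bar>c i\<bar> \<le> B" using bounded_measurableE[OF c] unfolding real_norm_def by blast
    then show ?thesis by (intro bdd_aboveI2)
  qed
  have "\<bar>c i + d i\<bar> \<le> (SUP i\<in>space \<nu>. \<bar>c i\<bar>) + (SUP i\<in>space \<nu>. \<bar>d i\<bar>)" if "i \<in> space \<nu>" for i
    using cSUP_upper[OF that bdd[OF c]] cSUP_upper[OF that bdd[OF d]] by linarith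
  then show ?thesis using True space_nonempty by (simp add: mean_norm_def cSUP_least)
next
  case False
  define q where "q = enn2real p"
  have q: "1 \<le> q" using p_finite[OF False] by (simp add: q_def)
  let ?N = "mean_norm p \<nu>"
  let ?m = "measure \<nu> (space \<nu>)"
  define J where "J = (\<lambda>c. (LINT i|\<nu>. \<bar>c i\<bar> powr q) / ?m)"
  have N: "?N c = J c powr (1 / q)" for c using False by (simp add: mean_norm_def J_def q_def)
  have J0: "0 \<le> J c" for c by (simp add: J_def)
  have le1: "?N c \<le> 1 \<longleftrightarrow> J c \<le> 1" for c
  proof -
    have "J c \<le> 1 \<Longrightarrow> J c powr (1 / q) \<le> 1" using q J0[of c] by (intro powr_le1) auto
    moreover have "1 < J c \<Longrightarrow> 1 < J c powr (1 / q)" using q by (intro gr_one_powr) auto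
    ultimately show ?thesis unfolding N by (meson not_le)
  qed
  show ?thesis
  proof (rule field_le_epsilon)
    fix \<epsilon> :: real assume \<epsilon>: "0 < \<epsilon>"
    \<comment> \<open>The additional \<open>\<epsilon> / 2\<close> keeps the divisors positive when
      a norm vanishes.\<close>
    define a where "a = ?N c + \<epsilon> / 2"
    define b where "b = ?N d + \<epsilon> / 2"
    have a: "0 < a" "?N c \<le> a" and b: "0 < b" "?N d \<le> b"
      using mean_norm_nonneg[OF c] mean_norm_nonneg[OF d] \<epsilon> by (auto simp: a_def b_def)
    have bc: "(\<lambda>i. c i / a) \<in> bounded_measurable \<nu>" and bd: "(\<lambda>i. d i / b) \<in> bounded_measurable \<nu>"
      using bounded_measurable_linear(2)[OF c c, of "1 / a"] bounded_measurable_linear(2)[OF d d, of "1 / b"] by auto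
    have "?N (\<lambda>i. c i / a) = ?N c / a"
      using mean_norm_scale[OF c, of "1 / a"] a by simp
    then have "?N (\<lambda>i. c i / a) \<le> 1" using a by simp
    then have Jc: "J (\<lambda>i. c i / a) \<le> 1" by (simp add: le1)
    have "?N (\<lambda>i. d i / b) = ?N d / b"
      using mean_norm_scale[OF d, of "1 / b"] b by simp
    then have "?N (\<lambda>i. d i / b) \<le> 1" using b by simp
    then have Jd: "J (\<lambda>i. d i / b) \<le> 1" by (simp add: le1)
    define s where "s = a / (a + b)"
    define t where "t = b / (a + b)"
    have st: "0 \<le> s" "0 \<le> t" "s + t = 1" using a b by (auto simp: s_def t_def add_divide_distrib[symmetric])
    have "(LINT i|\<nu>. \<bar>s * (c i / a) + t * (d i / b)\<bar> powr q)
        \<le> (LINT i|\<nu>. s * \<bar>c i / a\<bar> powr q + t * \<bar>d i / b\<bar> powr q)"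
    proof (rule integral_mono)
      show "integrable \<nu> (\<lambda>i. \<bar>s * (c i / a) + t * (d i / b)\<bar> powr q)"
        using q bounded_measurable_linear(1)[OF bounded_measurable_linear(2)[OF bc bc, of s] bounded_measurable_linear(2)[OF bd bd, of t]]
        by (intro integrable_powr) auto
      show "integrable \<nu> (\<lambda>i. s * \<bar>c i / a\<bar> powr q + t * \<bar>d i / b\<bar> powr q)"
        using q by (intro Bochner_Integration.integrable_add integrable_mult_right integrable_powr bc bd) auto
      fix i
      have "\<bar>s * (c i / a) + t * (d i / b)\<bar> \<le> s * \<bar>c i / a\<bar> + t * \<bar>d i / b\<bar>"
        using abs_triangle_ineq[of "s * (c i / a)" "t * (d i / b)"] st by (simp only: abs_mult) simp
      then have "\<bar>s * (c i / a) + t * (d i / b)\<bar> powr q \<le> (s * \<bar>c i / a\<bar> + t * \<bar>d i / b\<bar>) powr q"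
        using q by (intro powr_mono2) auto
      also have "\<dots> \<le> s * \<bar>c i / a\<bar> powr q + t * \<bar>d i / b\<bar> powr q"
        using st q by (intro powr_convex_nonneg) auto
      finally show "\<bar>s * (c i / a) + t * (d i / b)\<bar> powr q \<le> s * \<bar>c i / a\<bar> powr q + t * \<bar>d i / b\<bar> powr q" .
    qed
    also have "\<dots> = s * (LINT i|\<nu>. \<bar>c i / a\<bar> powr q) + t * (LINT i|\<nu>. \<bar>d i / b\<bar> powr q)"
      using integrable_powr[OF bc, of q] integrable_powr[OF bd, of q] q by simp
    finally have "J (\<lambda>i. s * (c i / a) + t * (d i / b)) \<le> s * J (\<lambda>i. c i / a) + t * J (\<lambda>i. d i / b)"
      using total by (simp add: J_def divide_right_mono flip: add_divide_distrib)
    also have "\<dots> \<le> s * 1 + t * 1" using st Jc Jd by (intro add_mono mult_left_mono) auto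
    finally have "?N (\<lambda>i. s * (c i / a) + t * (d i / b)) \<le> 1" using st by (simp add: le1)
    moreover have "(\<lambda>i. c i + d i) = (\<lambda>i. (a + b) * (s * (c i / a) + t * (d i / b)))"
    proof -
      have "(a + b) * s = a" "(a + b) * t = b" using a b by (auto simp: s_def t_def)
      then show ?thesis using a b by (simp add: fun_eq_iff distrib_left mult.assoc[symmetric])
    qed
    moreover have "(\<lambda>i. s * (c i / a) + t * (d i / b)) \<in> bounded_measurable \<nu>"
      using bounded_measurable_linear(1)[OF bounded_measurable_linear(2)[OF bc bc, of s] bounded_measurable_linear(2)[OF bd bd, of t]] by simp
    ultimately have "?N (\<lambda>i. c i + d i) \<le> (a + b) * 1"
      using a b mean_norm_scale[of "\<lambda>i. s * (c i / a) + t * (d i / b)" "a + b"] by (simp add: mult_left_le)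
    then show "?N (\<lambda>i. c i + d i) \<le> ?N c + ?N d + \<epsilon>" by (simp add: a_def b_def)
  qed
qed

lemma seminorm_mean_norm:
  fixes x :: "'i \<Rightarrow> 'a::euclidean_space"
  assumes x: "x \<in> bounded_measurable \<nu>"
  shows "seminorm (\<lambda>w. mean_norm p \<nu> (\<lambda>i. x i \<bullet> w))"
  unfolding seminorm_def
proof (intro conjI allI)
  fix a :: real and v w :: 'a
  show "mean_norm p \<nu> (\<lambda>i. x i \<bullet> (a *\<^sub>R w)) = \<bar>a\<bar> * mean_norm p \<nu> (\<lambda>i. x i \<bullet> w)"
    using mean_norm_scale[OF bounded_measurable_linear(3)[OF x x], of a w] by simp
  show "mean_norm p \<nu> (\<lambda>i. x i \<bullet> (v + w)) \<le> mean_norm p \<nu> (\<lambda>i. x i \<bullet> v) + mean_norm p \<nu> (\<lambda>i. x i \<bullet> w)"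
    using mean_norm_triangle[OF bounded_measurable_linear(3)[OF x x, of v] bounded_measurable_linear(3)[OF x x, of w]]
    by (simp add: inner_add_right)
qed

text \<open>The theorem of Campi and Gronchi on polars of shadow systems.\<close>

lemma vol_powr_neg_shadow_convex:
  fixes x :: "'i \<Rightarrow> real^2" and g :: "'i \<Rightarrow> real"
  assumes x: "x \<in> bounded_measurable \<nu>" and g: "g \<in> bounded_measurable \<nu>"
    and e: "e \<noteq> 0" and ab: "0 < \<alpha>" "0 < \<beta>" "\<alpha> + \<beta> = 1" and r: "1 \<le> r"
  defines "P \<equiv> \<lambda>t. {w. mean_norm p \<nu> (\<lambda>i. (x i + (t * g i) *\<^sub>R e) \<bullet> w) \<le> 1}"
  shows "vol_powr_neg (P (\<alpha> * s + \<beta> * t)) r \<le> \<alpha> * vol_powr_neg (P s) r + \<beta> * vol_powr_neg (P t) r"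
proof -
  define y where "y = (\<lambda>t i. x i + (t * g i) *\<^sub>R e)"
  have y: "y t \<in> bounded_measurable \<nu>" for t
  proof -
    obtain B where B: "x \<in> borel_measurable \<nu>" "\<And>i. i \<in> space \<nu> \<Longrightarrow> norm (x i) \<le> B"
      using bounded_measurableE[OF x] by metis
    obtain B' where B': "g \<in> borel_measurable \<nu>" "\<And>i. i \<in> space \<nu> \<Longrightarrow> norm (g i) \<le> B'"
      using bounded_measurableE[OF g] by metis
    note [measurable] = B(1) B'(1)
    show ?thesis
      unfolding y_def
    proof (rule bounded_measurableI[where B = "B + \<bar>t\<bar> * B' * norm e"])
      fix i assume i: "i \<in> space \<nu>"
      show "norm (x i + (t * g i) *\<^sub>R e) \<le> B + \<bar>t\<bar> * B' * norm e"
        using B(2)[OF i] B'(2)[OF i] by (intro norm_triangle_le add_mono) (auto simp: abs_mult intro!: mult_right_mono mult_left_mono)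
    qed simp
  qed
  have y_eq: "x i + (t * g i) *\<^sub>R e = y t i" for t i by (simp add: y_def)
  show ?thesis
    unfolding P_def y_eq
  proof (rule vol_powr_neg_convex[OF _ _ _ ab e r])
    fix \<mu>0 \<mu>1 b :: real and w0 w1 :: "real^2"
    assume \<mu>: "0 \<le> \<mu>0" "0 \<le> \<mu>1" "\<mu>0 + \<mu>1 = 1" and b: "\<mu>0 * (e \<bullet> w0) = \<alpha> * b" "\<mu>1 * (e \<bullet> w1) = \<beta> * b"
    have eb: "\<mu>0 * (e \<bullet> w0) + \<mu>1 * (e \<bullet> w1) = b" unfolding b using ab(3) by (simp flip: distrib_right)
    \<comment> \<open>The pairing splits exactly: \<open>\<mu>0 (e \<bullet> w0)\<close> and
      \<open>\<mu>1 (e \<bullet> w1)\<close> are the shares \<open>\<alpha> b\<close> and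
      \<open>\<beta> b\<close> of the same \<open>b\<close>, which distributes the displacement at
      time \<open>\<alpha> s + \<beta> t\<close> over the times \<open>s\<close> and
      \<open>t\<close>.\<close>
    have "y (\<alpha> * s + \<beta> * t) i \<bullet> (\<mu>0 *\<^sub>R w0 + \<mu>1 *\<^sub>R w1) = \<mu>0 * (y s i \<bullet> w0) + \<mu>1 * (y t i \<bullet> w1)" for i
    proof -
      have "y (\<alpha> * s + \<beta> * t) i \<bullet> (\<mu>0 *\<^sub>R w0 + \<mu>1 *\<^sub>R w1)
         = \<mu>0 * (x i \<bullet> w0) + \<mu>1 * (x i \<bullet> w1) + (\<alpha> * s + \<beta> * t) * g i * (\<mu>0 * (e \<bullet> w0) + \<mu>1 * (e \<bullet> w1))"
        by (simp add: y_def inner_add_left inner_add_right algebra_simps)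
      also have "\<dots> = \<mu>0 * (x i \<bullet> w0) + \<mu>1 * (x i \<bullet> w1) + s * g i * (\<alpha> * b) + t * g i * (\<beta> * b)"
        unfolding eb by (simp add: algebra_simps)
      also have "\<dots> = \<mu>0 * (y s i \<bullet> w0) + \<mu>1 * (y t i \<bullet> w1)"
        unfolding b[symmetric] by (simp add: y_def inner_add_left algebra_simps)
      finally show ?thesis .
    qed
    then have "mean_norm p \<nu> (\<lambda>i. y (\<alpha> * s + \<beta> * t) i \<bullet> (\<mu>0 *\<^sub>R w0 + \<mu>1 *\<^sub>R w1))
       = mean_norm p \<nu> (\<lambda>i. \<mu>0 * (y s i \<bullet> w0) + \<mu>1 * (y t i \<bullet> w1))" by simp
    also have "\<dots> \<le> mean_norm p \<nu> (\<lambda>i. \<mu>0 * (y s i \<bullet> w0)) + mean_norm p \<nu> (\<lambda>i. \<mu>1 * (y t i \<bullet> w1))"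
      using bounded_measurable_linear(2)[OF bounded_measurable_linear(3)[OF y y] bounded_measurable_linear(3)[OF y y]]
      by (intro mean_norm_triangle) auto
    also have "\<dots> = \<mu>0 * mean_norm p \<nu> (\<lambda>i. y s i \<bullet> w0) + \<mu>1 * mean_norm p \<nu> (\<lambda>i. y t i \<bullet> w1)"
      using \<mu> by (simp add: mean_norm_scale bounded_measurable_linear(3)[OF y y])
    finally show "mean_norm p \<nu> (\<lambda>i. y (\<alpha> * s + \<beta> * t) i \<bullet> (\<mu>0 *\<^sub>R w0 + \<mu>1 *\<^sub>R w1))
      \<le> \<mu>0 * mean_norm p \<nu> (\<lambda>i. y s i \<bullet> w0) + \<mu>1 * mean_norm p \<nu> (\<lambda>i. y t i \<bullet> w1)" .
  qed (intro seminorm_mean_norm y)+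
qed

end

section \<open>Approximation by zonogons\<close>

lemma compact_centered_square:
  assumes "centered_square Q"
  shows "compact Q"
proof -
  obtain a and f :: "real^2 \<Rightarrow> real^2" where a: "orthogonal_transformation f" "Q = f ` {x. \<forall>i. \<bar>x $ i\<bar> \<le> a}"
    using assms unfolding centered_square_def by blast
  have "{x::real^2. \<forall>i. \<bar>x $ i\<bar> \<le> a} = cbox (vector [- a, - a]) (vector [a, a])"
    by (auto simp: mem_box_cart forall_2 abs_le_iff minus_le_iff)
  then show ?thesis
    using a by (auto intro!: compact_continuous_image linear_continuous_on orthogonal_transformation_linear simp: linear_conv_bounded_linear[symmetric])
qed

lemma abs_cross2_le: "\<bar>cross2 a b\<bar> \<le> norm a * norm b"
proof -
  have "cross2 a b = a \<bullet> vector [b $ 2, - b $ 1]" by (simp add: cross2_def inner_vec_def sum_2)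
  moreover have "norm (vector [b $ 2, - b $ 1] :: real^2) = norm b"
    by (simp add: norm_vec_def L2_set_def sum_2 add.commute)
  ultimately show ?thesis by (metis Cauchy_Schwarz_ineq2)
qed

lemma interior_centrally_symmetric:
  assumes K: "convex_body K" "centrally_symmetric K"
  shows "0 \<in> interior K"
proof -
  obtain x where x: "x \<in> interior K" using K by (auto simp: convex_body_def)
  have "- x \<in> interior (uminus ` K)" using x by (simp add: interior_negations)
  then have "- x \<in> interior K" using K by (simp add: centrally_symmetric_def)
  moreover have "convex (interior K)" using K by (simp add: convex_body_def)
  ultimately have "(1/2) *\<^sub>R x + (1/2) *\<^sub>R (- x) \<in> interior K" using x by (intro convexD) auto
  then show ?thesis by simp
qed

text \<open>The support function of a symmetric \<open>K\<close>, evaluated at \<open>n\<close>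
  turned by a right angle; with \<open>cross2\<close> it compares directly with the strips of a
  zonogon.\<close>

definition width :: "(real^2) set \<Rightarrow> real^2 \<Rightarrow> real" where
  "width K n = (SUP y\<in>K. \<bar>cross2 n y\<bar>)"

lemma width_bounds:
  assumes K: "compact K" "K \<noteq> {}"
  shows "y \<in> K \<Longrightarrow> \<bar>cross2 n y\<bar> \<le> width K n"
    and "(\<And>y. y \<in> K \<Longrightarrow> \<bar>cross2 n y\<bar> \<le> B) \<Longrightarrow> width K n \<le> B"
proof -
  obtain R where R: "\<And>y. y \<in> K \<Longrightarrow> norm y \<le> R" using compact_imp_bounded[OF K(1)] by (auto simp: bounded_iff)
  have "bdd_above ((\<lambda>y. \<bar>cross2 n y\<bar>) ` K)"
    using R by (intro bdd_aboveI2[where M = "norm n * R"] order_trans[OF abs_cross2_le] mult_left_mono) auto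
  then show "y \<in> K \<Longrightarrow> \<bar>cross2 n y\<bar> \<le> width K n" unfolding width_def by (intro cSUP_upper)
  show "(\<And>y. y \<in> K \<Longrightarrow> \<bar>cross2 n y\<bar> \<le> B) \<Longrightarrow> width K n \<le> B"
    unfolding width_def using K(2) by (intro cSUP_least)
qed

lemma width_triangle:
  assumes K: "compact K" "K \<noteq> {}"
  shows "width K (m + n) \<le> width K m + width K n"
proof (rule width_bounds(2)[OF K])
  fix y assume y: "y \<in> K"
  show "\<bar>cross2 (m + n) y\<bar> \<le> width K m + width K n"
    using width_bounds(1)[OF K y, of m] width_bounds(1)[OF K y, of n] by (simp add: cross2.bilinear)
qed

lemma width_scale:
  assumes K: "compact K" "K \<noteq> {}" and a: "0 \<le> a"
  shows "width K (a *\<^sub>R n) = a * width K n"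
proof (cases "a = 0")
  case True
  have "width K 0 \<le> 0" by (rule width_bounds(2)[OF K]) simp
  moreover obtain y where "y \<in> K" using K by blast
  then have "0 \<le> width K 0" using width_bounds(1)[OF K, of y 0] by simp
  ultimately show ?thesis using True by simp
next
  case False
  then have a: "0 < a" using a by simp
  show ?thesis
  proof (rule antisym)
    show "width K (a *\<^sub>R n) \<le> a * width K n"
      using a by (intro width_bounds(2)[OF K]) (simp add: cross2.bilinear abs_mult width_bounds(1)[OF K])
    have "width K n \<le> width K (a *\<^sub>R n) / a"
      using a width_bounds(1)[OF K, of _ "a *\<^sub>R n"]
      by (intro width_bounds(2)[OF K]) (simp add: cross2.bilinear abs_mult pos_le_divide_eq mult.commute)
    then show "a * width K n \<le> width K (a *\<^sub>R n)" using a by (simp add: pos_le_divide_eq mult.commute)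
  qed
qed

lemma width_uminus: "width K (- n) = width K n"
  by (simp add: width_def cross2.bilinear)

text \<open>A line separating \<open>x\<close> from \<open>K\<close> yields a violated strip once
  its normal is turned by a right angle; symmetry of \<open>K\<close> turns the half-plane bound
  into one on the absolute value.\<close>

lemma mem_if_le_width:
  assumes K: "compact K" "convex K" "K \<noteq> {}" "centrally_symmetric K"
    and x: "\<And>n. norm n = 1 \<Longrightarrow> \<bar>cross2 n x\<bar> \<le> width K n"
  shows "x \<in> K"
proof (rule ccontr)
  assume "x \<notin> K"
  then obtain a b where ab: "a \<bullet> x < b" "\<And>y. y \<in> K \<Longrightarrow> b < a \<bullet> y"
    using separating_hyperplane_closed_point[OF K(2) compact_imp_closed[OF K(1)]] by blast
  define n :: "real^2" where "n = vector [- a $ 2, a $ 1]"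
  have n: "cross2 n y = - (a \<bullet> y)" for y by (simp add: n_def cross2_def inner_vec_def sum_2)
  have sym: "- y \<in> K" if "y \<in> K" for y using K(4) that by (metis centrally_symmetric_def imageI)
  have "\<bar>cross2 n y\<bar> \<le> - b" if "y \<in> K" for y
    using ab(2)[OF that] ab(2)[OF sym[OF that]] by (simp add: n)
  then have "width K n \<le> - b" by (rule width_bounds(2)[OF K(1,3)])
  moreover have "\<bar>cross2 n x\<bar> \<le> width K n"
  proof (cases "n = 0")
    case True
    obtain y where "y \<in> K" using K by blast
    then show ?thesis using True width_bounds(1)[OF K(1,3), of y 0] by simp
  next
    case False
    have "\<bar>cross2 (n /\<^sub>R norm n) x\<bar> \<le> width K (n /\<^sub>R norm n)" using False by (intro x) simp
    then have "\<bar>cross2 n x\<bar> / norm n \<le> width K n / norm n"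
      by (simp add: cross2.bilinear width_scale[OF K(1,3)] abs_mult divide_inverse mult.commute)
    then show ?thesis using False by (simp add: divide_le_cancel)
  qed
  ultimately show False using ab(1) by (simp add: n)
qed

section \<open>Equally spaced directions and circumscribed polygons\<close>

definition direction :: "real \<Rightarrow> real^2" where
  "direction \<theta> = vector [cos \<theta>, sin \<theta>]"

lemma norm_direction [simp]: "norm (direction \<theta>) = 1"
  by (simp add: direction_def norm_vec_def L2_set_def sum_2)

lemma cross2_direction: "cross2 (direction a) (direction b) = sin (b - a)"
  by (simp add: direction_def cross2_def sin_diff)

lemma direction_add_pi: "direction (\<theta> + pi) = - direction \<theta>"
  by (simp add: direction_def vec_eq_iff forall_2)

lemma direction_three_term: "direction (\<theta> - \<delta>) + direction (\<theta> + \<delta>) = (2 * cos \<delta>) *\<^sub>R direction \<theta>"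
  by (simp add: direction_def vec_eq_iff forall_2 cos_add cos_diff sin_add sin_diff)

lemma direction_dist: "norm (direction a - direction b) \<le> 2 * \<bar>a - b\<bar>"
proof -
  have "norm (direction a - direction b) \<le> \<bar>cos a - cos b\<bar> + \<bar>sin a - sin b\<bar>"
    using L2_set_le_sum_abs[of "\<lambda>i. norm ((direction a - direction b) $ i)" UNIV]
    by (simp add: norm_vec_def sum_2 direction_def)
  also have "\<bar>cos a - cos b\<bar> \<le> \<bar>a - b\<bar>"
  proof -
    have "\<bar>cos a - cos b\<bar> = 2 * (\<bar>sin ((a + b) / 2)\<bar> * \<bar>sin ((b - a) / 2)\<bar>)"
      by (simp add: cos_diff_cos abs_mult)
    also have "\<dots> \<le> 2 * (1 * \<bar>(b - a) / 2\<bar>)"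
      by (intro mult_left_mono mult_mono abs_sin_x_le_abs_x abs_sin_le_one) auto
    finally show ?thesis by simp
  qed
  also have "\<bar>sin a - sin b\<bar> \<le> \<bar>a - b\<bar>"
  proof -
    have "\<bar>sin a - sin b\<bar> = 2 * (\<bar>sin ((a - b) / 2)\<bar> * \<bar>cos ((a + b) / 2)\<bar>)"
      by (simp add: sin_diff_sin abs_mult)
    also have "\<dots> \<le> 2 * (\<bar>(a - b) / 2\<bar> * 1)"
      by (intro mult_left_mono mult_mono abs_sin_x_le_abs_x abs_cos_le_one) auto
    finally show ?thesis by simp
  qed
  finally show ?thesis by simp
qed

lemma direction_surj:
  assumes "norm u = 1"
  obtains \<theta> where "0 \<le> \<theta>" "\<theta> < 2 * pi" "u = direction \<theta>"
proof -
  have "(u $ 1)\<^sup>2 + (u $ 2)\<^sup>2 = 1" using assms by (simp add: norm_vec_def L2_set_def sum_2)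
  then obtain \<theta> where "0 \<le> \<theta>" "\<theta> < 2 * pi" "u $ 1 = cos \<theta>" "u $ 2 = sin \<theta>"
    using sincos_total_2pi by metis
  then show ?thesis using that by (simp add: direction_def vec_eq_iff forall_2)
qed

text \<open>Opposite directions define the same strip, so a half circle of directions suffices.
  Rounding the angle down costs at most one step \<open>pi / m\<close>, which
  \<open>direction_dist\<close> doubles.\<close>

lemma direction_net:
  assumes m: "0 < m" and u: "norm u = 1"
  obtains j s where "j < m" "s = 1 \<or> s = - 1" "norm (u - s *\<^sub>R direction (real j * (pi / real m))) \<le> 2 * (pi / real m)"
proof -
  define \<delta> where "\<delta> = pi / real m"
  have \<delta>: "0 < \<delta>" and m\<delta>: "real m * \<delta> = pi" using m by (auto simp: \<delta>_def)
  obtain \<theta> where \<theta>: "0 \<le> \<theta>" "\<theta> < 2 * pi" "u = direction \<theta>" using direction_surj[OF u] .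
  define k where "k = nat \<lfloor>\<theta> / \<delta>\<rfloor>"
  have k: "real k \<le> \<theta> / \<delta>" "\<theta> / \<delta> < real k + 1"
    using \<theta>(1) \<delta> by (auto simp: k_def of_nat_nat)
  have close: "norm (u - direction (real k * \<delta>)) \<le> 2 * \<delta>"
  proof -
    have "\<bar>\<theta> - real k * \<delta>\<bar> \<le> \<delta>"
      using k \<delta> by (auto simp: pos_le_divide_eq pos_divide_less_eq abs_le_iff algebra_simps)
    then show ?thesis using direction_dist[of \<theta> "real k * \<delta>"] \<theta>(3) by simp
  qed
  have "real k * \<delta> \<le> \<theta>" using k(1) \<delta> by (simp add: pos_le_divide_eq)
  then have "real k * \<delta> < 2 * (real m * \<delta>)" unfolding m\<delta> using \<theta>(2) by linarith
  then have "real k < 2 * real m" using mult_less_cancel_right_pos[OF \<delta>, of "real k" "2 * real m"] by (simp only: mult.assoc)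
  then have k2: "k < 2 * m" by linarith
  show ?thesis
  proof (cases "k < m")
    case True
    then show ?thesis using that[of k 1] close by (simp add: \<delta>_def)
  next
    case False
    have "direction (real k * \<delta>) = - direction (real (k - m) * \<delta>)"
      using direction_add_pi[of "real (k - m) * \<delta>"] False m\<delta> by (simp add: of_nat_diff algebra_simps)
    then show ?thesis using that[of "k - m" "- 1"] close k2 False by (simp add: \<delta>_def)
  qed
qed

text \<open>Cyclic reindexing, for the summation by parts in
  \<open>polygon_is_zonogon\<close>.\<close>

lemma sum_shift_periodic:
  fixes f :: "real \<Rightarrow> real"
  assumes "f (real m) = f 0"
  shows "(\<Sum>j<m. f (real j + 1)) = (\<Sum>j<m. f (real j))"
proof -
  have "(\<Sum>j<Suc m. f (real j)) = f 0 + (\<Sum>j<m. f (real j + 1))"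
    by (subst sum.lessThan_Suc_shift) (simp add: add.commute)
  then show ?thesis using assms by simp
qed

text \<open>\<open>sin (k * \<delta>)\<close> is annihilated by this difference operator, and so is
  its absolute value away from the kink at \<open>k = 0\<close>. The absolute sine is thus a
  fundamental solution of the operator with period \<open>m\<close>.\<close>

lemma abs_sin_second_difference:
  fixes i j m :: nat
  assumes "i < m" "j < m"
  defines "\<delta> \<equiv> pi / real m" and "k \<equiv> real j - real i"
  shows "\<bar>sin ((k + 1) * \<delta>)\<bar> + \<bar>sin ((k - 1) * \<delta>)\<bar> - 2 * cos \<delta> * \<bar>sin (k * \<delta>)\<bar> = (if j = i then 2 * sin \<delta> else 0)"
proof -
  have m: "0 < m" using assms by simp
  have \<delta>: "0 < \<delta>" "real m * \<delta> = pi" "\<delta> \<le> pi" using m by (auto simp: \<delta>_def divide_le_eq)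
  have sin_nonneg: "0 \<le> sin (t * \<delta>)" if "0 \<le> t" "t \<le> real m" for t
    using that \<delta> mult_right_mono[of t "real m" \<delta>] by (intro sin_ge_zero) auto
  \<comment> \<open>The condition keeps \<open>t - 1\<close> and \<open>t + 1\<close> within one
    arch of the sine; index differences of modulus 1 to \<open>m - 1\<close> satisfy it.\<close>
  have pos: "\<bar>sin ((t + 1) * \<delta>)\<bar> + \<bar>sin ((t - 1) * \<delta>)\<bar> = 2 * cos \<delta> * \<bar>sin (t * \<delta>)\<bar>" if "1 \<le> t" "t + 1 \<le> real m" for t
    using that sin_nonneg[of "t + 1"] sin_nonneg[of "t - 1"] sin_nonneg[of t]
    by (simp add: distrib_right left_diff_distrib sin_add sin_diff)
  consider "j = i" | "i < j" | "j < i" by linarith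
  then show ?thesis
  proof cases
    case 1
    then show ?thesis using sin_nonneg[of 1] m by (simp add: k_def)
  next
    case 2
    then have "1 \<le> k" "k + 1 \<le> real m" using assms by (auto simp: k_def)
    then show ?thesis using 2 pos[of k] by simp
  next
    case 3
    then have "1 \<le> - k" "- k + 1 \<le> real m" using assms by (auto simp: k_def)
    moreover have "\<bar>sin ((- k + 1) * \<delta>)\<bar> = \<bar>sin ((k - 1) * \<delta>)\<bar>" "\<bar>sin ((- k - 1) * \<delta>)\<bar> = \<bar>sin ((k + 1) * \<delta>)\<bar>"
      "\<bar>sin (- k * \<delta>)\<bar> = \<bar>sin (k * \<delta>)\<bar>"
    proof -
      have "\<bar>sin (- x)\<bar> = \<bar>sin x\<bar>" for x :: real by simp
      moreover have "(- k + 1) * \<delta> = - ((k - 1) * \<delta>)" "(- k - 1) * \<delta> = - ((k + 1) * \<delta>)" "- k * \<delta> = - (k * \<delta>)"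
        by (simp_all add: algebra_simps)
      ultimately show "\<bar>sin ((- k + 1) * \<delta>)\<bar> = \<bar>sin ((k - 1) * \<delta>)\<bar>" "\<bar>sin ((- k - 1) * \<delta>)\<bar> = \<bar>sin ((k + 1) * \<delta>)\<bar>"
        "\<bar>sin (- k * \<delta>)\<bar> = \<bar>sin (k * \<delta>)\<bar>" by metis+
    qed
    ultimately show ?thesis using 3 pos[of "- k"] by simp
  qed
qed

text \<open>The edge lengths of the polygon are, up to a constant, the second differences
  \<open>c(j-1) + c(j+1) - 2 cos(\<pi>/m) c(j)\<close> of its support numbers.\<close>

lemma polygon_is_zonogon:
  fixes c :: "real \<Rightarrow> real"
  assumes m: "2 \<le> m" and per: "\<And>t. c (t + real m) = c t"
    and edge: "\<And>t. 2 * cos (pi / real m) * c t < c (t - 1) + c (t + 1)"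
  obtains W where "spanning W"
    "zonogon W = {x. \<forall>j<m. \<bar>cross2 (direction (real j * (pi / real m))) x\<bar> \<le> c (real j)}"
proof -
  define \<delta> where "\<delta> = pi / real m"
  have \<delta>: "0 < \<delta>" "\<delta> < pi" "real m * \<delta> = pi" using m by (auto simp: \<delta>_def divide_less_eq)
  have sin\<delta>: "0 < sin \<delta>" using \<delta> by (intro sin_gt_zero)
  \<comment> \<open>Half the edge length, because a generator \<open>w\<close> contributes an edge
    of length twice its norm.\<close>
  define l where "l = (\<lambda>t. (c (t - 1) + c (t + 1) - 2 * cos \<delta> * c t) / (2 * sin \<delta>))"
  have l: "0 < l t" for t using edge[of t] sin\<delta> by (simp add: l_def \<delta>_def)
  define n where "n = (\<lambda>j::nat. direction (real j * \<delta>))"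
  define w where "w = (\<lambda>j::nat. l (real j) *\<^sub>R n j)"
  define W where "W = image_mset w (mset_set {..<m})"
  have set_W: "set_mset W = w ` {..<m}" by (simp add: W_def)
  define s where "s = (\<lambda>t. \<bar>sin (t * \<delta>)\<bar>)"
  have s_per: "s (t + real m) = s t" for t
    using \<delta>(3) by (simp add: s_def distrib_right)
  \<comment> \<open>Inverts the second difference: summation by parts over a period moves it from
    \<open>c\<close> to the absolute sine, where only the term \<open>j = i\<close> remains.\<close>
  have key: "(\<Sum>j<m. l (real j) * s (real j - real i)) = c (real i)" if i: "i < m" for i
  proof -
    have "2 * sin \<delta> * (\<Sum>j<m. l (real j) * s (real j - real i))
        = (\<Sum>j<m. (c (real j - 1) + c (real j + 1) - 2 * cos \<delta> * c (real j)) * s (real j - real i))"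
      unfolding sum_distrib_left using sin\<delta> by (intro sum.cong) (auto simp: l_def)
    also have "\<dots> = (\<Sum>j<m. c (real j - 1) * s (real j - real i)) + (\<Sum>j<m. c (real j + 1) * s (real j - real i))
        - (\<Sum>j<m. 2 * cos \<delta> * c (real j) * s (real j - real i))"
      by (simp add: sum.distrib sum_subtractf algebra_simps)
    also have "(\<Sum>j<m. c (real j - 1) * s (real j - real i)) = (\<Sum>j<m. c (real j) * s (real j + 1 - real i))"
    proof -
      have "(\<Sum>j<m. c (real j + 1 - 1) * s (real j + 1 - real i)) = (\<Sum>j<m. c (real j - 1) * s (real j - real i))"
        using per[of "- 1"] s_per[of "- real i"]
        by (intro sum_shift_periodic[of "\<lambda>t. c (t - 1) * s (t - real i)"]) (simp add: algebra_simps)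
      then show ?thesis by simp
    qed
    also have "(\<Sum>j<m. c (real j + 1) * s (real j - real i)) = (\<Sum>j<m. c (real j) * s (real j - 1 - real i))"
    proof -
      have "(\<Sum>j<m. c (real j + 1) * s (real j + 1 - 1 - real i)) = (\<Sum>j<m. c (real j) * s (real j - 1 - real i))"
        using per[of 0] s_per[of "- 1 - real i"]
        by (intro sum_shift_periodic[of "\<lambda>t. c t * s (t - 1 - real i)"]) (simp add: algebra_simps)
      then show ?thesis by simp
    qed
    also have "(\<Sum>j<m. c (real j) * s (real j + 1 - real i)) + (\<Sum>j<m. c (real j) * s (real j - 1 - real i))
        - (\<Sum>j<m. 2 * cos \<delta> * c (real j) * s (real j - real i))
      = (\<Sum>j<m. c (real j) * (if j = i then 2 * sin \<delta> else 0))"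
    proof -
      have "c (real j) * s (real j + 1 - real i) + c (real j) * s (real j - 1 - real i) - 2 * cos \<delta> * c (real j) * s (real j - real i)
          = c (real j) * (if j = i then 2 * sin \<delta> else 0)" if "j < m" for j
      proof -
        have "s (real j + 1 - real i) + s (real j - 1 - real i) - 2 * cos \<delta> * s (real j - real i) = (if j = i then 2 * sin \<delta> else 0)"
        proof -
          have eqs: "real j + 1 - real i = real j - real i + 1" "real j - 1 - real i = real j - real i - 1" by simp_all
          show ?thesis
            using abs_sin_second_difference[OF i that] unfolding s_def eqs \<delta>_def[symmetric] .
        qed
        then have "c (real j) * (s (real j + 1 - real i) + s (real j - 1 - real i) - 2 * cos \<delta> * s (real j - real i))
            = c (real j) * (if j = i then 2 * sin \<delta> else 0)" by (rule arg_cong)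
        then show ?thesis by (simp only: right_diff_distrib distrib_left mult.assoc mult.left_commute[of "c (real j)"])
      qed
      then show ?thesis
        unfolding sum.distrib[symmetric] sum_subtractf[symmetric] by (intro sum.cong) auto
    qed
    also have "\<dots> = 2 * sin \<delta> * c (real i)" using i by (simp add: if_distrib cong: if_cong)
    finally show ?thesis using sin\<delta> by simp
  qed
  have sum_W: "(\<Sum>v\<in>#W. \<bar>cross2 (w i) v\<bar>) = l (real i) * c (real i)" if "i < m" for i
  proof -
    have "(\<Sum>v\<in>#W. \<bar>cross2 (w i) v\<bar>) = (\<Sum>j<m. \<bar>cross2 (w i) (w j)\<bar>)"
      by (simp add: W_def multiset.map_comp comp_def sum_unfold_sum_mset)
    also have "\<dots> = (\<Sum>j<m. l (real i) * (l (real j) * s (real j - real i)))"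
      using l by (intro sum.cong) (auto simp: w_def n_def cross2.bilinear cross2_direction abs_mult s_def left_diff_distrib less_imp_le)
    also have "\<dots> = l (real i) * c (real i)" by (simp add: sum_distrib_left[symmetric] key[OF that])
    finally show ?thesis .
  qed
  have "zonogon W = {x. \<forall>j<m. \<bar>cross2 (n j) x\<bar> \<le> c (real j)}"
  proof -
    have "\<bar>cross2 (w j) x\<bar> \<le> l (real j) * c (real j) \<longleftrightarrow> \<bar>cross2 (n j) x\<bar> \<le> c (real j)" for j x
      using l[of "real j"] by (simp add: w_def cross2.bilinear abs_mult)
    then show ?thesis by (auto simp: cross2.zonogon_def set_W sum_W)
  qed
  moreover have "spanning W"
  proof -
    have "n j \<noteq> 0" for j unfolding n_def by (metis norm_direction norm_zero zero_neq_one)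
    then have "w j \<noteq> 0" for j using l[of "real j"] by (simp add: w_def)
    then have "0 \<notin># W" unfolding set_W by (metis imageE)
    moreover have "cross2 (w 0) (w 1) \<noteq> 0"
      using l[of 0] l[of 1] sin\<delta> by (simp add: w_def n_def cross2.bilinear cross2_direction)
    moreover have "w 0 \<in># W" "w 1 \<in># W" using m by (auto simp: set_W)
    ultimately show ?thesis unfolding spanning_def by blast
  qed
  ultimately show ?thesis using that by (simp add: n_def \<delta>_def)
qed

text \<open>The zonogon is a polygon around \<open>K\<close> with \<open>m\<close> pairs of parallel
  edges at equal angles. The support numbers \<open>width K\<close> alone might yield edges of
  length zero; the additional \<open>\<epsilon>\<close> makes all edges positive.\<close>

lemma zonogon_approximation:
  assumes K: "convex_body K" "centrally_symmetric K" and \<eta>: "0 < \<eta>"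
  obtains W where "spanning W" "K \<subseteq> zonogon W" "zonogon W \<subseteq> (\<lambda>x. (1 + \<eta>) *\<^sub>R x) ` K"
proof -
  have cK: "compact K" "convex K" using K by (auto simp: convex_body_def)
  have K0: "0 \<in> interior K" by (rule interior_centrally_symmetric[OF K])
  then have ne: "K \<noteq> {}" using interior_subset by blast
  obtain \<rho>' where \<rho>': "0 < \<rho>'" "cball 0 \<rho>' \<subseteq> K" using K0 by (auto simp: mem_interior_cball)
  define \<rho> where "\<rho> = \<rho>'"
  have \<rho>: "0 < \<rho>" using \<rho>' by (simp add: \<rho>_def)
  obtain R' where R': "\<And>y. y \<in> K \<Longrightarrow> norm y \<le> R'"
    using compact_imp_bounded[OF cK(1)] by (auto simp: bounded_iff)
  define R where "R = \<bar>R'\<bar> + 1"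
  have R: "0 < R" "\<And>y. y \<in> K \<Longrightarrow> norm y \<le> R" using R' by (force simp: R_def)+
  let ?h = "width K"
  note wb = width_bounds[OF cK(1) ne]
  have h_le: "?h n \<le> R * norm n" for n
  proof (rule wb(2))
    fix y assume "y \<in> K"
    have "\<bar>cross2 n y\<bar> \<le> norm n * norm y" by (rule abs_cross2_le)
    also have "\<dots> \<le> norm n * R" using R(2)[OF \<open>y \<in> K\<close>] by (intro mult_left_mono) auto
    finally show "\<bar>cross2 n y\<bar> \<le> R * norm n" by (simp add: mult.commute)
  qed
  have h_ge: "\<rho> \<le> ?h n" if "norm n = 1" for n
  proof -
    define y :: "real^2" where "y = \<rho> *\<^sub>R vector [- n $ 2, n $ 1]"
    have nn: "n $ 1 * n $ 1 + n $ 2 * n $ 2 = 1" using that by (simp add: norm_eq_1 inner_vec_def sum_2)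
    have "norm (vector [- n $ 2, n $ 1] :: real^2) = norm n"
      by (simp add: norm_vec_def L2_set_def sum_2 add.commute)
    then have "norm y = \<rho>" using \<rho> that by (simp add: y_def)
    then have "y \<in> K" using \<rho>' by (auto simp: \<rho>_def)
    moreover have "cross2 n y = \<rho> * (n $ 1 * n $ 1 + n $ 2 * n $ 2)"
      by (simp add: cross2_def y_def algebra_simps)
    ultimately show ?thesis using wb(1)[of y n] \<rho> by (simp add: nn)
  qed
  \<comment> \<open>One half of the permitted error \<open>\<eta> \<rho>\<close>; the bound by
    \<open>R\<close> serves the estimate of \<open>norm x\<close> below.\<close>
  define \<epsilon> where "\<epsilon> = min R (\<eta> * \<rho> / 2)"
  have \<epsilon>: "0 < \<epsilon>" "\<epsilon> \<le> R" "\<epsilon> \<le> \<eta> * \<rho> / 2" using R \<eta> \<rho> by (auto simp: \<epsilon>_def)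
  \<comment> \<open>Chosen to give \<open>\<delta> \<le> 1 / 4\<close> and
    \<open>12 \<delta> R \<le> \<eta> \<rho> / 2\<close>. Here 12 is \<open>2 + 2 * 5\<close>, with
    5 from the bound \<open>norm x \<le> 5 R\<close>.\<close>
  obtain m0 :: nat where m0: "max (4 * pi) (24 * pi * R / (\<eta> * \<rho>)) \<le> real m0" using real_arch_simple by blast
  define m where "m = m0 + 2"
  define \<delta> where "\<delta> = pi / real m"
  have m: "2 \<le> m" "4 * pi \<le> real m" "24 * pi * R / (\<eta> * \<rho>) \<le> real m" using m0 by (auto simp: m_def)
  have \<delta>: "0 < \<delta>" "\<delta> \<le> 1 / 4" "12 * \<delta> * R \<le> \<eta> * \<rho> / 2" "\<delta> \<le> pi / 2" "real m * \<delta> = pi"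
    using m \<eta> \<rho> by (auto simp: \<delta>_def field_simps)
  define c where "c = (\<lambda>t. ?h (direction (t * \<delta>)) + \<epsilon>)"
  have cper: "c (t + real m) = c t" for t
    using direction_add_pi[of "t * \<delta>"] by (simp add: c_def distrib_right \<delta>(5) width_uminus)
  have edge: "2 * cos (pi / real m) * c t < c (t - 1) + c (t + 1)" for t
  proof -
    have cos: "0 \<le> cos \<delta>" "cos \<delta> < 1"
      using \<delta> cos_monotone_0_pi[of 0 \<delta>] by (auto intro!: cos_ge_zero)
    have "2 * cos \<delta> * ?h (direction (t * \<delta>)) = ?h ((2 * cos \<delta>) *\<^sub>R direction (t * \<delta>))"
      using cos by (simp add: width_scale[OF cK(1) ne])
    also have "\<dots> = ?h (direction ((t - 1) * \<delta>) + direction ((t + 1) * \<delta>))"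
      using direction_three_term[of "t * \<delta>" \<delta>] by (simp add: algebra_simps)
    also have "\<dots> \<le> ?h (direction ((t - 1) * \<delta>)) + ?h (direction ((t + 1) * \<delta>))"
      by (rule width_triangle[OF cK(1) ne])
    finally have 1: "2 * cos \<delta> * ?h (direction (t * \<delta>)) \<le> ?h (direction ((t - 1) * \<delta>)) + ?h (direction ((t + 1) * \<delta>))" .
    \<comment> \<open>The width has a nonnegative second difference by its triangle inequality;
      strictness comes from \<open>\<epsilon>\<close> and \<open>cos \<delta> < 1\<close>.\<close>
    have 2: "2 * cos \<delta> * \<epsilon> < 2 * \<epsilon>" using cos \<epsilon> by simp
    have "2 * cos \<delta> * c t < c (t - 1) + c (t + 1)"
      unfolding c_def distrib_left using 1 2 by linarith
    then show ?thesis by (simp add: \<delta>_def)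
  qed
  obtain W where W: "spanning W"
    "zonogon W = {x. \<forall>j<m. \<bar>cross2 (direction (real j * (pi / real m))) x\<bar> \<le> c (real j)}"
    using polygon_is_zonogon[OF m(1) cper edge] .
  have "K \<subseteq> zonogon W"
    using wb(1) \<epsilon> unfolding W(2) c_def \<delta>_def by (fastforce intro: order_trans)
  moreover have "x \<in> (\<lambda>x. (1 + \<eta>) *\<^sub>R x) ` K" if x: "x \<in> zonogon W" for x
  proof -
    have bound: "\<bar>cross2 u x\<bar> \<le> ?h u + 2 * \<delta> * R + \<epsilon> + 2 * \<delta> * norm x" if u: "norm u = 1" for u
    proof -
      obtain j s where js: "j < m" "s = 1 \<or> s = - 1" "norm (u - s *\<^sub>R direction (real j * (pi / real m))) \<le> 2 * (pi / real m)"
        using direction_net[OF _ u, of m] m(1) by auto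
      define v where "v = s *\<^sub>R direction (real j * \<delta>)"
      have uv: "norm (u - v) \<le> 2 * \<delta>" using js(3) by (simp add: v_def \<delta>_def)
      have hv: "?h v = ?h (direction (real j * \<delta>))" "\<bar>cross2 v x\<bar> = \<bar>cross2 (direction (real j * \<delta>)) x\<bar>"
        using js(2) by (auto simp: v_def width_uminus cross2.bilinear)
      have "\<bar>cross2 u x\<bar> \<le> \<bar>cross2 v x\<bar> + \<bar>cross2 (u - v) x\<bar>" by (simp add: cross2.bilinear)
      also have "\<bar>cross2 v x\<bar> \<le> ?h v + \<epsilon>" using x js(1) unfolding W(2) hv by (simp add: c_def \<delta>_def)
      also have "?h v \<le> ?h u + ?h (v - u)" using width_triangle[OF cK(1) ne, of u "v - u"] by simp
      also have "?h (v - u) \<le> R * (2 * \<delta>)"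
        using h_le[of "v - u"] mult_left_mono[OF uv less_imp_le[OF R(1)]] unfolding norm_minus_commute[of v u] by linarith
      also have "\<bar>cross2 (u - v) x\<bar> \<le> 2 * \<delta> * norm x"
        using abs_cross2_le[of "u - v" x] mult_right_mono[OF uv, of "norm x"] by simp
      finally show ?thesis by (simp add: algebra_simps)
    qed
    \<comment> \<open>The error in \<open>bound\<close> contains \<open>norm x\<close> itself. With
      \<open>u\<close> orthogonal to \<open>x\<close> the left-hand side is \<open>norm x\<close>,
      which absorbs that term because \<open>\<delta> \<le> 1 / 4\<close>.\<close>
    have normx: "norm x \<le> 5 * R"
    proof (cases "x = 0")
      case False
      define u :: "real^2" where "u = vector [x $ 2, - x $ 1] /\<^sub>R norm x"
      have nx: "norm (vector [x $ 2, - x $ 1] :: real^2) = norm x"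
        by (simp add: norm_vec_def L2_set_def sum_2 add.commute)
      have u: "norm u = 1" using False by (simp add: u_def nx)
      have "cross2 u x = norm x"
      proof -
        have "norm x * norm x = x $ 2 * x $ 2 + x $ 1 * x $ 1"
          by (simp add: norm_vec_def L2_set_def sum_2 power2_eq_square add.commute)
        moreover have "cross2 u x = (x $ 2 * x $ 2 + x $ 1 * x $ 1) / norm x"
          by (simp add: u_def cross2_def divide_inverse algebra_simps)
        ultimately show ?thesis using False by (simp add: nonzero_eq_divide_eq flip: \<open>norm x * norm x = _\<close>)
      qed
      then have "norm x \<le> ?h u + 2 * \<delta> * R + \<epsilon> + 2 * \<delta> * norm x" using bound[OF u] by simp
      also have "?h u \<le> R" using h_le[of u] u by simp
      also have "2 * \<delta> * R \<le> 1 / 2 * R" using \<delta>(2) R by (intro mult_right_mono) auto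
      also have "2 * \<delta> * norm x \<le> 1 / 2 * norm x" using \<delta>(2) by (intro mult_right_mono) auto
      finally show ?thesis using \<epsilon>(2) by simp
    qed (use R in simp)
    have le: "\<bar>cross2 u x\<bar> \<le> (1 + \<eta>) * ?h u" if u: "norm u = 1" for u
    proof -
      have "2 * \<delta> * norm x \<le> 2 * \<delta> * (5 * R)" using normx \<delta>(1) by (intro mult_left_mono) auto
      moreover have "12 * \<delta> * R = 2 * \<delta> * R + 2 * \<delta> * (5 * R)" by simp
      ultimately have "\<bar>cross2 u x\<bar> \<le> ?h u + 12 * \<delta> * R + \<epsilon>" using bound[OF u] by linarith
      also have "\<dots> \<le> ?h u + \<eta> * \<rho>" using \<delta>(3) \<epsilon>(3) by simp
      also have "\<eta> * \<rho> \<le> \<eta> * ?h u" using h_ge[OF u] \<eta> by (intro mult_left_mono) auto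
      finally show ?thesis by (simp add: algebra_simps)
    qed
    have "inverse (1 + \<eta>) *\<^sub>R x \<in> K"
    proof (rule mem_if_le_width[OF cK ne K(2)])
      fix n :: "real^2" assume "norm n = 1"
      then show "\<bar>cross2 n (inverse (1 + \<eta>) *\<^sub>R x)\<bar> \<le> ?h n"
        using le[of n] \<eta> by (simp add: cross2.bilinear abs_mult field_simps)
    qed
    moreover have "x = (1 + \<eta>) *\<^sub>R (inverse (1 + \<eta>) *\<^sub>R x)" using \<eta> by simp
    ultimately show ?thesis by blast
  qed
  ultimately show ?thesis using that[OF W(1)] by blast
qed

text \<open>The zonogon around \<open>K\<close> may be larger than \<open>Q\<close>, so it is
  compared with a dilated square \<open>Q'\<close> of its own area. Passing to the zonogon costs the
  area ratio to the power \<open>d\<close>, undoing the dilation costs the power \<open>r\<close>,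
  and the ratio tends to 1 with \<open>\<eta>\<close> tending to 0.\<close>

lemma (in planar_functional) symmetric_body_le_square:
  assumes K: "convex_body K" "centrally_symmetric K" and Q: "centered_square Q"
    and area: "emeasure lborel Q = emeasure lborel K"
  shows "\<Phi> K \<le> \<Phi> Q"
proof -
  have cK: "compact K" using K by (simp add: convex_body_def)
  have posK: "0 < emeasure lborel K"
    using K by (intro emeasure_lborel_pos) (auto simp: convex_body_def compact_imp_closed)
  have finK: "emeasure lborel K < \<infinity>" using cK by (intro emeasure_bounded_finite compact_imp_bounded)
  define k where "k = measure lborel K"
  have k1: "emeasure lborel K = ennreal k"
    using less_imp_neq[OF finK] by (simp add: k_def emeasure_eq_ennreal_measure)
  then have k: "emeasure lborel K = ennreal k" "0 < k" using posK by simp_all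
  obtain a and f :: "real^2 \<Rightarrow> real^2" where a: "0 < a" "orthogonal_transformation f" "Q = f ` {x. \<forall>i. \<bar>x $ i\<bar> \<le> a}"
    using Q unfolding centered_square_def by blast
  have cQ: "compact Q" by (rule compact_centered_square[OF Q])
  have bound: "\<Phi> K \<le> ennreal ((1 + \<eta>) powr (2 * d + 2 * r)) * \<Phi> Q" if \<eta>: "0 < \<eta>" for \<eta>
  proof -
    obtain W where W: "spanning W" "K \<subseteq> zonogon W" "zonogon W \<subseteq> (\<lambda>x. (1 + \<eta>) *\<^sub>R x) ` K"
      using zonogon_approximation[OF K \<eta>] .
    have scaling: "linear (\<lambda>x::real^2. c *\<^sub>R x)" "det (matrix (\<lambda>x::real^2. c *\<^sub>R x)) = c\<^sup>2" for c :: real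
      by (auto intro: linearI simp: algebra_simps det_2 matrix_def axis_def power2_eq_square)
    have scaled: "emeasure lborel ((\<lambda>x. c *\<^sub>R x) ` A) = ennreal (c\<^sup>2) * emeasure lborel A" if "0 < c" "A \<in> sets borel" for c and A :: "(real^2) set"
      using area_scaling_distr(4)[OF area_scaling_homothety] that .
    define z where "z = measure lborel (zonogon W)"
    have cZ: "compact (zonogon W)" by (rule compact_zonogon[OF W(1)])
    have finZ: "emeasure lborel (zonogon W) < \<infinity>" using cZ by (intro emeasure_bounded_finite compact_imp_bounded)
    then have z1: "emeasure lborel (zonogon W) = ennreal z"
      using less_imp_neq[OF finZ] by (simp add: z_def emeasure_eq_ennreal_measure)
    then have z: "emeasure lborel (zonogon W) = ennreal z" "0 < z"
      using emeasure_zonogon_pos[OF W(1)] by simp_all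
    have "ennreal z \<le> emeasure lborel ((\<lambda>x. (1 + \<eta>) *\<^sub>R x) ` K)"
      unfolding z(1)[symmetric] using cK by (intro emeasure_mono W(3)) (auto intro!: borel_compact compact_scaling)
    also have "\<dots> = ennreal ((1 + \<eta>)\<^sup>2 * k)"
      using \<eta> cK k by (subst scaled) (auto simp: borel_compact ennreal_mult)
    finally have zk: "z / k \<le> (1 + \<eta>)\<^sup>2" using k \<eta> by (simp add: pos_divide_le_eq)
    define s where "s = sqrt (z / k)"
    have s: "0 < s" "s\<^sup>2 = z / k" using z k by (auto simp: s_def)
    define Q' where "Q' = (\<lambda>x. s *\<^sub>R x) ` Q"
    have "centered_square Q'"
    proof -
      have "Q' = f ` {x. \<forall>i. \<bar>x $ i\<bar> \<le> s * a}"
      proof -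
        have "(\<lambda>x. s *\<^sub>R x) ` {x::real^2. \<forall>i. \<bar>x $ i\<bar> \<le> a} = {x. \<forall>i. \<bar>x $ i\<bar> \<le> s * a}"
        proof (intro equalityI subsetI)
          fix x :: "real^2" assume "x \<in> {x. \<forall>i. \<bar>x $ i\<bar> \<le> s * a}"
          then have "x /\<^sub>R s \<in> {x. \<forall>i. \<bar>x $ i\<bar> \<le> a}" using s by (simp add: abs_mult field_simps)
          moreover have "x = s *\<^sub>R (x /\<^sub>R s)" using s by simp
          ultimately show "x \<in> (\<lambda>x. s *\<^sub>R x) ` {x::real^2. \<forall>i. \<bar>x $ i\<bar> \<le> a}" by blast
        qed (use s in \<open>auto simp: abs_mult\<close>)
        moreover have "Q' = f ` (\<lambda>x. s *\<^sub>R x) ` {x::real^2. \<forall>i. \<bar>x $ i\<bar> \<le> a}"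
          using linear_scale[OF orthogonal_transformation_linear[OF a(2)]] by (simp add: Q'_def a(3) image_image)
        ultimately show ?thesis by simp
      qed
      then show ?thesis using a s unfolding centered_square_def by (intro exI[of _ "s * a"] conjI exI[of _ f]) auto
    qed
    moreover have "emeasure lborel (zonogon W) = emeasure lborel Q'"
    proof -
      have "emeasure lborel Q' = ennreal (z / k) * ennreal k"
        using s cQ area k unfolding Q'_def by (subst scaled) (auto simp: borel_compact)
      then show ?thesis using z k by (simp add: z(1) flip: ennreal_mult)
    qed
    ultimately have ZQ: "\<Phi> (zonogon W) \<le> \<Phi> Q'" using zonogon_le_square[OF _ W(1)] by blast
    have Q': "\<Phi> Q' = ennreal ((z / k) powr r) * \<Phi> Q"
      unfolding Q'_def using s posK area z k by (subst linear_image[OF cQ _ scaling(1)]) (auto simp: scaling(2))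
    have "\<Phi> K \<le> ennreal ((z / k) powr d) * \<Phi> (zonogon W)"
      using mono[OF cK cZ posK W(2)] by (simp add: z_def k_def)
    also have "\<dots> \<le> ennreal ((z / k) powr d) * (ennreal ((z / k) powr r) * \<Phi> Q)"
      using ZQ unfolding Q' by (intro mult_left_mono) auto
    also have "\<dots> = ennreal ((z / k) powr (d + r)) * \<Phi> Q"
      by (simp add: powr_add ennreal_mult mult.assoc)
    also have "\<dots> \<le> ennreal ((1 + \<eta>) powr (2 * d + 2 * r)) * \<Phi> Q"
    proof (intro mult_right_mono ennreal_leI)
      have "(z / k) powr (d + r) \<le> ((1 + \<eta>)\<^sup>2) powr (d + r)"
        using zk z k exponents by (intro powr_mono2) auto
      also have "\<dots> = (1 + \<eta>) powr (2 * d + 2 * r)"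
        using \<eta> by (simp add: powr_powr distrib_left flip: powr_numeral)
      finally show "(z / k) powr (d + r) \<le> (1 + \<eta>) powr (2 * d + 2 * r)" .
    qed simp
    finally show ?thesis .
  qed
  show ?thesis
  proof (cases "\<Phi> Q = \<infinity>")
    case False
    then obtain q where q: "\<Phi> Q = ennreal q" "0 \<le> q" by (cases "\<Phi> Q") auto
    have "\<Phi> K < \<infinity>" using bound[of 1] q by (auto simp: ennreal_mult_less_top le_less_trans)
    then obtain c where c: "\<Phi> K = ennreal c" "0 \<le> c" by (cases "\<Phi> K") auto
    have "c \<le> (1 + inverse (real (Suc n))) powr (2 * d + 2 * r) * q" for n
      using bound[of "inverse (real (Suc n))"] q c by (simp flip: ennreal_mult)
    moreover have "(\<lambda>n. (1 + inverse (real (Suc n))) powr (2 * d + 2 * r) * q) \<longlonglongrightarrow> (1 + 0) powr (2 * d + 2 * r) * q"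
      by (intro tendsto_intros LIMSEQ_inverse_real_of_nat) auto
    ultimately have "c \<le> (1 + 0) powr (2 * d + 2 * r) * q" by (intro LIMSEQ_le_const) auto
    then show ?thesis using q c by simp
  qed simp
qed

section \<open>The expected inverse volume\<close>

text \<open>Positive area of the smaller set excludes the default \<open>0 powr (- r) = 0\<close>,
  which would spoil the inequality.\<close>

lemma vol_powr_neg_antimono:
  assumes "S \<subseteq> S'" "S' \<in> sets lborel" "0 < emeasure lborel S" "0 \<le> r"
  shows "vol_powr_neg S' r \<le> vol_powr_neg S r"
proof (cases "emeasure lborel S' = \<infinity>")
  case False
  have le: "emeasure lborel S \<le> emeasure lborel S'" using assms by (intro emeasure_mono)
  then have fin: "emeasure lborel S \<noteq> \<infinity>" using False by (auto simp: top_unique)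
  have "0 < measure lborel S" "measure lborel S \<le> measure lborel S'"
    using le fin False assms(3) by (simp_all add: emeasure_eq_ennreal_measure)
  then show ?thesis
    using False fin assms(4) by (simp add: vol_powr_neg_def powr_minus le_imp_inverse_le powr_mono2)
qed (simp add: vol_powr_neg_def)

lemma vol_powr_neg_vimage:
  assumes T: "area_scaling c T" and S: "S \<in> sets borel"
  shows "vol_powr_neg (T -` S) r = c powr r * vol_powr_neg S r"
proof -
  have c: "0 < c" using T by (simp add: area_scaling_def)
  have em: "emeasure lborel (T -` S) = ennreal (1 / c) * emeasure lborel S"
    by (rule area_scaling_distr(5)[OF T S])
  show ?thesis
  proof (cases "emeasure lborel S = \<infinity>")
    case True
    then show ?thesis using em c by (simp add: vol_powr_neg_def ennreal_mult_top)
  next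
    case False
    then have "emeasure lborel (T -` S) \<noteq> \<infinity>" using em by (simp add: ennreal_mult_eq_top_iff)
    moreover have "measure lborel (T -` S) = measure lborel S / c"
      using em c by (simp add: measure_def enn2real_mult)
    moreover have "(m / c) powr (- r) = c powr r * m powr (- r)" if "0 \<le> m" for m
      using powr_divide[of m c "- r"] by (simp add: powr_minus[of c] divide_inverse)
    ultimately show ?thesis using False by (simp add: vol_powr_neg_def)
  qed
qed

definition polar_ball :: "ennreal \<Rightarrow> 'i measure \<Rightarrow> ('i \<Rightarrow> real^2) \<Rightarrow> (real^2) set" where
  "polar_ball p \<nu> x = {w. mean_norm p \<nu> (\<lambda>i. x i \<bullet> w) \<le> 1}"

lemma mean_norm_cong: "(\<And>i. i \<in> space \<nu> \<Longrightarrow> c i = d i) \<Longrightarrow> mean_norm p \<nu> c = mean_norm p \<nu> d"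
  by (simp add: mean_norm_def cong: Bochner_Integration.integral_cong)

lemma polar_ball_cong:
  assumes "\<And>i. i \<in> space \<nu> \<Longrightarrow> x i = y i"
  shows "polar_ball p \<nu> x = polar_ball p \<nu> y"
proof -
  have "mean_norm p \<nu> (\<lambda>i. x i \<bullet> w) = mean_norm p \<nu> (\<lambda>i. y i \<bullet> w)" for w
    using assms by (intro mean_norm_cong) simp
  then show ?thesis by (simp add: polar_ball_def)
qed

lemma polar_ball_linear:
  assumes "linear T"
  shows "polar_ball p \<nu> (\<lambda>i. T (x i)) = adjoint T -` polar_ball p \<nu> x"
  by (simp add: polar_ball_def adjoint_works[OF assms] vimage_def)

lemma area_scaling_adjoint:
  fixes T :: "real^2 \<Rightarrow> real^2"
  assumes "linear T" "det (matrix T) \<noteq> 0"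
  shows "area_scaling \<bar>det (matrix T)\<bar> (adjoint T)"
  using area_scaling_linear[OF adjoint_linear[OF assms(1)]] assms
  by (simp add: matrix_adjoint)

context mean_norm_space
begin

lemma polar_ball_borel: "x \<in> bounded_measurable \<nu> \<Longrightarrow> polar_ball p \<nu> x \<in> sets borel"
  unfolding polar_ball_def by (intro borel_closed seminorm_ball(1) seminorm_mean_norm)

lemma polar_ball_pos: "x \<in> bounded_measurable \<nu> \<Longrightarrow> 0 < emeasure lborel (polar_ball p \<nu> x)"
  unfolding polar_ball_def by (intro emeasure_seminorm_ball_pos seminorm_mean_norm)

text \<open>The polar of points in a ball of radius \<open>R\<close> contains the ball of radius
  \<open>1 / R\<close>. This uniform bound makes the expectations finite.\<close>

lemma vol_powr_neg_polar_ball_bound: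
  assumes x: "x \<in> bounded_measurable \<nu>" and R: "0 < R" "\<And>i. i \<in> space \<nu> \<Longrightarrow> norm (x i) \<le> R" and r: "0 \<le> r"
  shows "vol_powr_neg (polar_ball p \<nu> x) r \<le> vol_powr_neg (cball 0 (1 / R) :: (real^2) set) r"
proof (rule vol_powr_neg_antimono)
  show "cball 0 (1 / R) \<subseteq> polar_ball p \<nu> x"
  proof
    fix w :: "real^2" assume w: "w \<in> cball 0 (1 / R)"
    have "mean_norm p \<nu> (\<lambda>i. x i \<bullet> w) \<le> 1"
    proof (rule mean_norm_bound)
      show "(\<lambda>i. x i \<bullet> w) \<in> bounded_measurable \<nu>" by (rule bounded_measurable_linear(3)[OF x x])
      fix i assume i: "i \<in> space \<nu>"
      have "\<bar>x i \<bullet> w\<bar> \<le> norm (x i) * norm w" by (rule Cauchy_Schwarz_ineq2)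
      also have "\<dots> \<le> R * (1 / R)" using w R i by (intro mult_mono) auto
      finally show "\<bar>x i \<bullet> w\<bar> \<le> 1" using R by simp
    qed
    then show "w \<in> polar_ball p \<nu> x" by (simp add: polar_ball_def)
  qed
  show "0 < emeasure lborel (cball 0 (1 / R) :: (real^2) set)"
    using R by (intro emeasure_lborel_pos) (auto simp: interior_cball)
qed (use polar_ball_borel[OF x] r in auto)

end

lemma mean_norm_space_empirical:
  fixes N :: nat
  assumes "1 \<le> p" "1 \<le> N"
  shows "mean_norm_space (count_space {1..N}) p"
proof -
  interpret finite_measure "count_space {1..N}" by (rule finite_measure_count_space) simp
  show ?thesis by unfold_locales (use assms in auto)
qed

lemma bounded_measurable_empirical: "x \<in> bounded_measurable (count_space {1..N::nat})"
  by (simp add: bounded_measurable_def finite_imp_bounded)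

lemma polar_empirical_centroid_body:
  fixes x :: "nat \<Rightarrow> real^2"
  assumes "1 \<le> p" "1 \<le> N"
  shows "polar (empirical_centroid_body p N x) = polar_ball p (count_space {1..N}) x"
proof -
  interpret mean_norm_space "count_space {1..N}" p by (rule mean_norm_space_empirical[OF assms])
  have "(\<lambda>z. if p = \<infinity> then (MAX i\<in>{1..N}. \<bar>x i \<bullet> z\<bar>)
     else (1 / real N * (\<Sum>i=1..N. \<bar>x i \<bullet> z\<bar> powr enn2real p)) powr (1 / enn2real p))
    = (\<lambda>z. mean_norm p (count_space {1..N}) (\<lambda>i. x i \<bullet> z))"
    using assms by (auto simp: fun_eq_iff mean_norm_def cSup_eq_Max lebesgue_integral_count_space_finite)
  then show ?thesis
    unfolding empirical_centroid_body_def polar_ball_def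
    using polar_body_of_support[OF seminorm_mean_norm[OF bounded_measurable_empirical]] by simp
qed

definition empirical_inverse_volume :: "ennreal \<Rightarrow> nat \<Rightarrow> real \<Rightarrow> (nat \<Rightarrow> real^2) \<Rightarrow> real" where
  "empirical_inverse_volume p N r x = vol_powr_neg (polar_ball p (count_space {1..N}) x) r"

text \<open>The polars are the sections of one measurable set of pairs of a sample and a test
  vector, so their areas depend measurably on the sample.\<close>

lemma empirical_inverse_volume_measurable [measurable]:
  assumes "1 \<le> N"
  shows "empirical_inverse_volume p N r \<in> borel_measurable (\<Pi>\<^sub>M i\<in>{1..N}. borel)"
proof -
  note One_nat_def [simp del]
  let ?P = "\<Pi>\<^sub>M i\<in>{1..N}. (borel :: (real^2) measure)"
  have [measurable]: "(\<lambda>z. \<bar>fst z i \<bullet> snd z\<bar>) \<in> borel_measurable (?P \<Otimes>\<^sub>M borel)" if "i \<in> {1..N}" for i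
    using that by measurable
  have "(\<lambda>z. mean_norm p (count_space {1..N}) (\<lambda>i. fst z i \<bullet> snd z)) \<in> borel_measurable (?P \<Otimes>\<^sub>M borel)"
  proof (cases "p = \<infinity>")
    case True
    have "(\<lambda>z. Max ((\<lambda>i. \<bar>fst z i \<bullet> snd z\<bar>) ` {1..N})) \<in> borel_measurable (?P \<Otimes>\<^sub>M borel)"
      by (intro borel_measurable_Max) auto
    then show ?thesis using True assms by (simp add: mean_norm_def cSup_eq_Max)
  next
    case False
    have "(\<lambda>z. ((\<Sum>i\<in>{1..N}. \<bar>fst z i \<bullet> snd z\<bar> powr enn2real p) / real N) powr (1 / enn2real p)) \<in> borel_measurable (?P \<Otimes>\<^sub>M borel)"
      by measurable
    then show ?thesis using False by (simp add: mean_norm_def lebesgue_integral_count_space_finite)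
  qed
  then have S: "{z \<in> space (?P \<Otimes>\<^sub>M lborel). mean_norm p (count_space {1..N}) (\<lambda>i. fst z i \<bullet> snd z) \<le> 1} \<in> sets (?P \<Otimes>\<^sub>M lborel)"
    (is "?S \<in> _") by measurable
  have fib: "Pair x -` ?S = polar_ball p (count_space {1..N}) x" if "x \<in> space ?P" for x
    using that by (auto simp: polar_ball_def space_pair_measure)
  have "(\<lambda>x. emeasure lborel (Pair x -` ?S)) \<in> borel_measurable ?P"
    by (rule lborel.measurable_emeasure_Pair[OF S])
  then have [measurable]: "(\<lambda>x. emeasure lborel (polar_ball p (count_space {1..N}) x)) \<in> borel_measurable ?P"
    by (rule measurable_cong[THEN iffD1, rotated]) (simp only: fib)
  have "(\<lambda>x. if emeasure lborel (polar_ball p (count_space {1..N}) x) = \<infinity> then 0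
      else enn2real (emeasure lborel (polar_ball p (count_space {1..N}) x)) powr (- r)) \<in> borel_measurable ?P"
    by measurable
  then show ?thesis
    unfolding empirical_inverse_volume_def[abs_def] vol_powr_neg_def measure_def .
qed

lemma empirical_inverse_volume_cong:
  assumes "\<And>i. i \<in> {1..N} \<Longrightarrow> x i = y i"
  shows "empirical_inverse_volume p N r x = empirical_inverse_volume p N r y"
  using polar_ball_cong[of "count_space {1..N}" x y] assms by (simp add: empirical_inverse_volume_def)

section \<open>Laws of uniform samples and the expectation as a functional of the body\<close>

definition uniform_product :: "nat \<Rightarrow> (real^2) set \<Rightarrow> (nat \<Rightarrow> real^2) measure" where
  "uniform_product N K = (\<Pi>\<^sub>M i\<in>{1..N}. uniform_measure lborel K)"

text \<open>Integration against the law of the sample makes the expectation a function of the set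
  \<open>K\<close> alone, as \<open>planar_functional\<close> requires.\<close>

definition expected_inverse_volume :: "ennreal \<Rightarrow> nat \<Rightarrow> real \<Rightarrow> (real^2) set \<Rightarrow> ennreal" where
  "expected_inverse_volume p N r K = (\<integral>\<^sup>+\<omega>. ennreal (empirical_inverse_volume p N r \<omega>) \<partial>uniform_product N K)"

lemma sets_uniform_product [measurable_cong]: "sets (uniform_product N K) = sets (\<Pi>\<^sub>M i\<in>{1..N}. borel)"
  unfolding uniform_product_def by (intro sets_PiM_cong) auto

lemma uniform_prob_space:
  fixes K :: "(real^2) set"
  assumes K: "compact K" "0 < emeasure lborel K"
  shows "prob_space (uniform_measure lborel K)"
  using K emeasure_bounded_finite[OF compact_imp_bounded[OF K(1)]]
  by (intro prob_space_uniform_measure) auto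

lemma uniform_product_sigma_finite:
  fixes K :: "(real^2) set"
  assumes K: "compact K" "0 < emeasure lborel K"
  shows "product_sigma_finite (\<lambda>i::nat. uniform_measure lborel K)"
proof -
  interpret prob_space "uniform_measure lborel K" by (rule uniform_prob_space[OF K])
  show ?thesis by unfold_locales
qed

lemma emeasure_uniform_product:
  fixes K :: "(real^2) set"
  assumes K: "compact K" "0 < emeasure lborel K" and A: "\<And>i. i \<in> {1..N} \<Longrightarrow> A i \<in> sets borel"
  shows "emeasure (uniform_product N K) (Pi\<^sub>E {1..N} A) = (\<Prod>i\<in>{1..N}. emeasure (uniform_measure lborel K) (A i))"
proof -
  interpret product_sigma_finite "\<lambda>i::nat. uniform_measure lborel K" by (rule uniform_product_sigma_finite[OF K])
  show ?thesis unfolding uniform_product_def using A by (intro emeasure_PiM) auto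
qed

lemma uniform_product_eqI:
  fixes K :: "(real^2) set"
  assumes K: "compact K" "0 < emeasure lborel K"
    and P: "sets P = sets (\<Pi>\<^sub>M i\<in>{1..N}. borel)"
    and eq: "\<And>A. (\<And>i. i \<in> {1..N} \<Longrightarrow> A i \<in> sets borel) \<Longrightarrow>
      emeasure P (Pi\<^sub>E {1..N} A) = (\<Prod>i\<in>{1..N}. emeasure (uniform_measure lborel K) (A i))"
  shows "P = uniform_product N K"
proof -
  interpret product_sigma_finite "\<lambda>i::nat. uniform_measure lborel K" by (rule uniform_product_sigma_finite[OF K])
  show ?thesis
    unfolding uniform_product_def
  proof (rule PiM_eqI)
    show "sets P = sets (\<Pi>\<^sub>M i\<in>{1..N}. uniform_measure lborel K)"
      using P sets_uniform_product[of N K] by (simp add: uniform_product_def)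
  qed (use eq in auto)
qed

lemma ennreal_cancel_divide:
  fixes a b :: ennreal
  assumes "0 < c"
  shows "ennreal c * a / (ennreal c * b) = a / b"
proof -
  have "ennreal c * inverse (ennreal c) = 1" using assms by (simp add: inverse_ennreal flip: ennreal_mult)
  moreover have "inverse (ennreal c * b) = inverse (ennreal c) * inverse b"
    using assms by (intro ennreal_inverse_mult') auto
  ultimately show ?thesis
    by (metis (no_types, lifting) divide_ennreal_def mult.assoc mult.commute mult_1)
qed

lemma uniform_measure_area_scaling:
  assumes T: "area_scaling c T" and K: "compact K" and A: "A \<in> sets borel"
  shows "emeasure (uniform_measure lborel (T ` K)) A = emeasure (uniform_measure lborel K) (T -` A)"
proof -
  have c: "0 < c" using T by (simp add: area_scaling_def)
  have TA: "T -` A \<in> sets borel" using measurable_sets_borel[OF area_scaling_distr(1)[OF T] A] .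
  have "T ` K \<inter> A = T ` (K \<inter> T -` A)" by auto
  moreover have sets: "K \<inter> T -` A \<in> sets borel" "K \<in> sets borel" using TA K by (auto simp: borel_compact)
  ultimately have "emeasure lborel (T ` K \<inter> A) = ennreal c * emeasure lborel (K \<inter> T -` A)"
    "emeasure lborel (T ` K) = ennreal c * emeasure lborel K"
    using area_scaling_distr(4)[OF T] by simp_all
  moreover have "T ` K \<in> sets borel" using area_scaling_distr(6)[OF T K] by (rule borel_compact)
  ultimately show ?thesis
    using A TA sets c by (simp add: ennreal_cancel_divide)
qed

text \<open>The constant \<open>c\<close> cancels in the normalized measure, so applying
  \<open>T\<close> to independent uniform points of \<open>K\<close> gives independent uniform
  points of the image.\<close>

lemma uniform_product_area_scaling:
  assumes T: "area_scaling c T" and K: "compact K" "0 < emeasure lborel K"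
  shows "uniform_product N (T ` K) = distr (uniform_product N K) (\<Pi>\<^sub>M i\<in>{1..N}. borel) (\<lambda>\<omega>. \<lambda>i\<in>{1..N}. T (\<omega> i))"
proof -
  note One_nat_def [simp del]
  have c: "0 < c" using T by (simp add: area_scaling_def)
  note [measurable] = area_scaling_distr(1)[OF T]
  have meas: "(\<lambda>\<omega>. \<lambda>i\<in>{1..N}. T (\<omega> i)) \<in> uniform_product N K \<rightarrow>\<^sub>M (\<Pi>\<^sub>M i\<in>{1..N}. borel)"
    by measurable
  have TK: "compact (T ` K)" by (rule area_scaling_distr(6)[OF T K(1)])
  have posTK: "0 < emeasure lborel (T ` K)"
    using area_scaling_distr(4)[OF T, of K] K c by (simp add: borel_compact ennreal_zero_less_mult_iff)
  show ?thesis
  proof (rule uniform_product_eqI[OF TK posTK, symmetric])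
    fix A :: "nat \<Rightarrow> (real^2) set" assume A: "\<And>i. i \<in> {1..N} \<Longrightarrow> A i \<in> sets borel"
    have TA: "T -` A i \<in> sets borel" if "i \<in> {1..N}" for i
      using measurable_sets_borel[OF area_scaling_distr(1)[OF T] A[OF that]] .
    have "(\<lambda>\<omega>. \<lambda>i\<in>{1..N}. T (\<omega> i)) -` (Pi\<^sub>E {1..N} A) \<inter> space (uniform_product N K) = Pi\<^sub>E {1..N} (\<lambda>i. T -` A i)"
      by (auto simp: uniform_product_def space_PiM PiE_iff)
    moreover have "Pi\<^sub>E {1..N} A \<in> sets (\<Pi>\<^sub>M i\<in>{1..N}. borel)"
      using A by (intro sets_PiM_I_finite) auto
    ultimately show "emeasure (distr (uniform_product N K) (\<Pi>\<^sub>M i\<in>{1..N}. borel) (\<lambda>\<omega>. \<lambda>i\<in>{1..N}. T (\<omega> i))) (Pi\<^sub>E {1..N} A)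
      = (\<Prod>i\<in>{1..N}. emeasure (uniform_measure lborel (T ` K)) (A i))"
      using A emeasure_uniform_product[OF K, of N "\<lambda>i. T -` A i"] TA
      by (simp add: emeasure_distr[OF meas] uniform_measure_area_scaling[OF T K(1)])
  qed simp
qed

lemma expected_inverse_volume_area_scaling:
  assumes T: "area_scaling c T" and K: "compact K" "0 < emeasure lborel K" and N: "1 \<le> N"
  shows "expected_inverse_volume p N r (T ` K)
     = (\<integral>\<^sup>+\<omega>. ennreal (empirical_inverse_volume p N r (\<lambda>i. T (\<omega> i))) \<partial>uniform_product N K)"
proof -
  note [measurable] = area_scaling_distr(1)[OF T] empirical_inverse_volume_measurable[OF N]
  have "expected_inverse_volume p N r (T ` K)
     = (\<integral>\<^sup>+\<omega>. ennreal (empirical_inverse_volume p N r (\<lambda>i\<in>{1..N}. T (\<omega> i))) \<partial>uniform_product N K)"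
    unfolding expected_inverse_volume_def uniform_product_area_scaling[OF T K]
    by (subst nn_integral_distr) measurable
  also have "\<dots> = (\<integral>\<^sup>+\<omega>. ennreal (empirical_inverse_volume p N r (\<lambda>i. T (\<omega> i))) \<partial>uniform_product N K)"
    by (intro nn_integral_cong arg_cong[of _ _ ennreal] empirical_inverse_volume_cong) simp
  finally show ?thesis .
qed

text \<open>A uniform sample from \<open>K\<close> is one from \<open>L\<close> conditioned on all
  \<open>N\<close> points falling into \<open>K\<close>, an event of probability
  \<open>(k / l) ^ N\<close>. Dropping the condition can only enlarge the integral; this is the
  origin of the exponent \<open>N\<close>.\<close>

lemma expected_inverse_volume_mono:
  assumes K: "compact K" "0 < emeasure lborel K" and L: "compact L" and KL: "K \<subseteq> L" and N: "1 \<le> N"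
  shows "expected_inverse_volume p N r K
    \<le> ennreal ((measure lborel L / measure lborel K) powr real N) * expected_inverse_volume p N r L"
proof -
  note [measurable] = empirical_inverse_volume_measurable[OF N]
  have borel: "K \<in> sets borel" "L \<in> sets borel" using K L by (auto simp: borel_compact)
  have posL: "0 < emeasure lborel L"
    using K(2) emeasure_mono[OF KL, of lborel] borel by (auto intro: less_le_trans)
  define k where "k = measure lborel K"
  define l where "l = measure lborel L"
  have "emeasure lborel K \<noteq> \<infinity>" "emeasure lborel L \<noteq> \<infinity>"
    using emeasure_bounded_finite[OF compact_imp_bounded[OF K(1)]] emeasure_bounded_finite[OF compact_imp_bounded[OF L]] by auto
  then have kl: "emeasure lborel K = ennreal k" "emeasure lborel L = ennreal l"
    by (simp_all add: k_def l_def emeasure_eq_ennreal_measure)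
  have kl0: "0 < k" "0 < l" using K(2) posL kl by auto
  define B where "B = Pi\<^sub>E {1..N} (\<lambda>_. K)"
  have B: "B \<in> sets (uniform_product N L)"
    unfolding sets_uniform_product B_def using borel by (intro sets_PiM_I_finite) auto
  have eB: "emeasure (uniform_product N L) B = ennreal (k / l) ^ N"
    using kl kl0 KL borel unfolding B_def by (subst emeasure_uniform_product[OF L posL]) (auto simp: Int_absorb1 divide_ennreal)
  have eq: "uniform_measure (uniform_product N L) B = uniform_product N K"
  proof (rule uniform_product_eqI[OF K])
    fix A :: "nat \<Rightarrow> (real^2) set" assume A: "\<And>i. i \<in> {1..N} \<Longrightarrow> A i \<in> sets borel"
    have "Pi\<^sub>E {1..N} A \<in> sets (uniform_product N L)"
      unfolding sets_uniform_product using A by (intro sets_PiM_I_finite) auto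
    then have "emeasure (uniform_measure (uniform_product N L) B) (Pi\<^sub>E {1..N} A)
        = emeasure (uniform_product N L) (Pi\<^sub>E {1..N} (\<lambda>i. K \<inter> A i)) / ennreal (k / l) ^ N"
      using B by (simp add: eB) (simp add: B_def PiE_Int)
    also have "emeasure (uniform_product N L) (Pi\<^sub>E {1..N} (\<lambda>i. K \<inter> A i))
        = (\<Prod>i\<in>{1..N}. emeasure (uniform_measure lborel L) (K \<inter> A i))"
      using A borel by (intro emeasure_uniform_product[OF L posL]) auto
    also have "\<dots> = (\<Prod>i\<in>{1..N}. ennreal (k / l) * emeasure (uniform_measure lborel K) (A i))"
    proof (rule prod.cong[OF refl])
      fix i assume i: "i \<in> {1..N}"
      have sub: "L \<inter> (K \<inter> A i) = K \<inter> A i" using KL by auto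
      have "emeasure lborel (K \<inter> A i) \<le> emeasure lborel K" using A[OF i] borel by (intro emeasure_mono) auto
      then have "emeasure lborel (K \<inter> A i) \<noteq> \<infinity>" using kl by (auto simp: top_unique)
      then obtain a where a: "emeasure lborel (K \<inter> A i) = ennreal a" "0 \<le> a" by (cases "emeasure lborel (K \<inter> A i)") auto
      show "emeasure (uniform_measure lborel L) (K \<inter> A i) = ennreal (k / l) * emeasure (uniform_measure lborel K) (A i)"
        using A[OF i] borel a kl0 by (simp add: sub kl divide_ennreal flip: ennreal_mult)
    qed
    also have "\<dots> = ennreal (k / l) ^ N * (\<Prod>i\<in>{1..N}. emeasure (uniform_measure lborel K) (A i))"
      by (simp add: prod.distrib)
    also have "\<dots> / ennreal (k / l) ^ N = (\<Prod>i\<in>{1..N}. emeasure (uniform_measure lborel K) (A i))"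
      using kl0 by (simp add: ennreal_power mult.commute[of "ennreal _"] ennreal_mult_divide_eq)
    finally show "emeasure (uniform_measure (uniform_product N L) B) (Pi\<^sub>E {1..N} A)
       = (\<Prod>i\<in>{1..N}. emeasure (uniform_measure lborel K) (A i))" .
  qed (simp add: sets_uniform_product)
  have "expected_inverse_volume p N r K
     = (\<integral>\<^sup>+\<omega>. ennreal (empirical_inverse_volume p N r \<omega>) * indicator B \<omega> \<partial>uniform_product N L) / ennreal (k / l) ^ N"
    unfolding expected_inverse_volume_def eq[symmetric] eB[symmetric]
    by (rule nn_integral_uniform_measure[OF _ B]) measurable
  also have "\<dots> \<le> expected_inverse_volume p N r L / ennreal (k / l) ^ N"
    unfolding expected_inverse_volume_def
    by (intro divide_right_mono_ennreal nn_integral_mono) (auto split: split_indicator)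
  also have "\<dots> = ennreal ((l / k) powr real N) * expected_inverse_volume p N r L"
    using kl0 by (simp add: ennreal_power divide_ennreal_def inverse_ennreal powr_realpow mult.commute flip: power_inverse)
  finally show ?thesis by (simp add: k_def l_def)
qed

text \<open>The shadow inequality holds for every fixed sample, with the sample indices as index
  space, and is then integrated. The integrals over displaced samples belong to the sheared bodies
  because the shear preserves area.\<close>

lemma planar_functional_expected:
  assumes p: "1 \<le> p" and N: "1 \<le> N" and r: "1 \<le> r"
  shows "planar_functional (expected_inverse_volume p N r) r (real N)"
proof
  interpret mean_norm_space "count_space {1..N}" p by (rule mean_norm_space_empirical[OF p N])
  note [measurable] = empirical_inverse_volume_measurable[OF N]
  show "0 \<le> r" "0 \<le> real N" using r by auto
  fix K :: "(real^2) set" assume K: "compact K" "0 < emeasure lborel K"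
  show "expected_inverse_volume p N r (T ` K) = ennreal (\<bar>det (matrix T)\<bar> powr r) * expected_inverse_volume p N r K"
    if T: "linear T" "det (matrix T) \<noteq> 0" for T
  proof -
    have "empirical_inverse_volume p N r (\<lambda>i. T (\<omega> i)) = \<bar>det (matrix T)\<bar> powr r * empirical_inverse_volume p N r \<omega>" for \<omega>
      unfolding empirical_inverse_volume_def polar_ball_linear[OF T(1)]
      by (rule vol_powr_neg_vimage[OF area_scaling_adjoint[OF T] polar_ball_borel[OF bounded_measurable_empirical]])
    then show ?thesis
      unfolding expected_inverse_volume_area_scaling[OF area_scaling_linear[OF T] K N]
      by (simp add: ennreal_mult' nn_integral_cmult expected_inverse_volume_def)
  qed
  show "expected_inverse_volume p N r K \<le> ennreal ((measure lborel L / measure lborel K) powr real N) * expected_inverse_volume p N r L"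
    if "compact L" "K \<subseteq> L" for L
    using expected_inverse_volume_mono[OF K that N] .
  fix e :: "real^2" and h s t :: real
  assume e: "e \<noteq> 0" and h: "0 \<le> h" and st: "0 < s" "0 < t"
  define \<alpha> where "\<alpha> = t / (s + t)"
  define \<beta> where "\<beta> = s / (s + t)"
  have ab: "0 < \<alpha>" "0 < \<beta>" "\<alpha> + \<beta> = 1" using st by (auto simp: \<alpha>_def \<beta>_def add_divide_distrib[symmetric])
  have zero: "\<alpha> * (- s) + \<beta> * t = 0" by (simp add: \<alpha>_def \<beta>_def)
  let ?F = "empirical_inverse_volume p N r"
  have conv: "?F \<omega> \<le> \<alpha> * ?F (\<lambda>i. cap_shear e h (- s) (\<omega> i)) + \<beta> * ?F (\<lambda>i. cap_shear e h t (\<omega> i))" for \<omega>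
    using vol_powr_neg_shadow_convex[OF bounded_measurable_empirical[of \<omega> N]
        bounded_measurable_empirical[of "\<lambda>i. max 0 (cross2 e (\<omega> i) - h) - max 0 (- cross2 e (\<omega> i) - h)" N] e ab r, of "- s" t]
    unfolding zero by (simp add: empirical_inverse_volume_def polar_ball_def cross2.cap_shear_def)
  note [measurable] = area_scaling_distr(1)[OF area_scaling_cap_shear[OF h]]
  have meas: "(\<lambda>\<omega>. ?F (\<lambda>i. cap_shear e h t (\<omega> i))) \<in> borel_measurable (uniform_product N K)" for t
  proof -
    have "(\<lambda>\<omega>. ?F (\<lambda>i\<in>{1..N}. cap_shear e h t (\<omega> i))) \<in> borel_measurable (uniform_product N K)" by measurable
    moreover have "?F (\<lambda>i\<in>{1..N}. cap_shear e h t (\<omega> i)) = ?F (\<lambda>i. cap_shear e h t (\<omega> i))" for \<omega>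
      by (intro empirical_inverse_volume_cong) simp
    ultimately show ?thesis by simp
  qed
  have nonneg: "0 \<le> ?F x" for x by (simp add: empirical_inverse_volume_def)
  have "expected_inverse_volume p N r K \<le> (\<integral>\<^sup>+\<omega>. ennreal \<alpha> * ennreal (?F (\<lambda>i. cap_shear e h (- s) (\<omega> i)))
      + ennreal \<beta> * ennreal (?F (\<lambda>i. cap_shear e h t (\<omega> i))) \<partial>uniform_product N K)"
    unfolding expected_inverse_volume_def
  proof (rule nn_integral_mono)
    fix \<omega>
    have "ennreal (?F \<omega>) \<le> ennreal (\<alpha> * ?F (\<lambda>i. cap_shear e h (- s) (\<omega> i)) + \<beta> * ?F (\<lambda>i. cap_shear e h t (\<omega> i)))"
      by (rule ennreal_leI[OF conv])
    then show "ennreal (?F \<omega>) \<le> ennreal \<alpha> * ennreal (?F (\<lambda>i. cap_shear e h (- s) (\<omega> i)))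
      + ennreal \<beta> * ennreal (?F (\<lambda>i. cap_shear e h t (\<omega> i)))"
      using ab nonneg by (simp add: ennreal_mult)
  qed
  also have "\<dots> = ennreal \<alpha> * expected_inverse_volume p N r (cap_shear e h (- s) ` K)
      + ennreal \<beta> * expected_inverse_volume p N r (cap_shear e h t ` K)"
    unfolding expected_inverse_volume_area_scaling[OF area_scaling_cap_shear[OF h] K N]
    using meas by (subst nn_integral_add) (auto simp: nn_integral_cmult)
  finally show "expected_inverse_volume p N r K \<le> ennreal (t / (s + t)) * expected_inverse_volume p N r (cap_shear e h (- s) ` K)
      + ennreal (s / (s + t)) * expected_inverse_volume p N r (cap_shear e h t ` K)"
    by (simp add: \<alpha>_def \<beta>_def)
qed

text \<open>Needed for the return to real expectations: \<open>enn2real\<close> sends infinity to 0,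
  so it preserves an inequality only when the larger side is finite.\<close>

lemma expected_inverse_volume_finite:
  assumes K: "compact K" "0 < emeasure lborel K" and p: "1 \<le> p" and N: "1 \<le> N" and r: "1 \<le> r"
  shows "expected_inverse_volume p N r K < \<infinity>"
proof -
  interpret mean_norm_space "count_space {1..N}" p by (rule mean_norm_space_empirical[OF p N])
  interpret U: prob_space "uniform_measure lborel K" by (rule uniform_prob_space[OF K])
  interpret P: prob_space "uniform_product N K"
    unfolding uniform_product_def by (intro prob_space_PiM U.prob_space_axioms)
  obtain R' where R': "\<And>y. y \<in> K \<Longrightarrow> norm y \<le> R'" using compact_imp_bounded[OF K(1)] by (auto simp: bounded_iff)
  define R where "R = \<bar>R'\<bar> + 1"
  have R: "0 < R" "\<And>y. y \<in> K \<Longrightarrow> norm y \<le> R" using R' by (force simp: R_def)+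
  have "AE x in uniform_measure lborel K. x \<in> K"
    using K(1) by (intro AE_uniform_measureI) (auto simp: borel_compact)
  then have "AE \<omega> in uniform_product N K. \<omega> i \<in> K" if "i \<in> {1..N}" for i
    unfolding uniform_product_def using that by (intro AE_PiM_component U.prob_space_axioms)
  then have "AE \<omega> in uniform_product N K. \<forall>i\<in>{1..N}. \<omega> i \<in> K"
    by (intro AE_finite_allI) auto
  then have "AE \<omega> in uniform_product N K. ennreal (empirical_inverse_volume p N r \<omega>) \<le> ennreal (vol_powr_neg (cball (0::real^2) (1 / R)) r)"
  proof eventually_elim
    case (elim \<omega>)
    show ?case unfolding empirical_inverse_volume_def
      using elim R r by (intro ennreal_leI vol_powr_neg_polar_ball_bound bounded_measurable_empirical) auto
  qed
  then have "expected_inverse_volume p N r K \<le> (\<integral>\<^sup>+\<omega>. ennreal (vol_powr_neg (cball (0::real^2) (1 / R)) r) \<partial>uniform_product N K)"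
    unfolding expected_inverse_volume_def by (rule nn_integral_mono_AE)
  also have "\<dots> < \<infinity>" by (simp add: P.emeasure_space_1)
  finally show ?thesis .
qed

text \<open>Independence says that the joint law is the product of the marginal laws, so the
  expectation does not depend on the underlying probability space.\<close>

lemma expectation_iid_uniform:
  fixes X :: "nat \<Rightarrow> 'w \<Rightarrow> real^2"
  assumes X: "iid_uniform M N X K" and p: "1 \<le> p" and N: "1 \<le> N"
  shows "prob_space.expectation M (\<lambda>\<omega>. vol_powr_neg (polar (empirical_centroid_body p N (\<lambda>i. X i \<omega>))) r)
     = enn2real (expected_inverse_volume p N r K)"
proof -
  note One_nat_def [simp del]
  interpret prob_space M using X by (simp add: iid_uniform_def)
  note [measurable] = empirical_inverse_volume_measurable[OF N]
  have indep: "indep_vars (\<lambda>_. borel) X {1..N}" and distr: "\<And>i. i \<in> {1..N} \<Longrightarrow> distr M borel (X i) = uniform_measure lborel K"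
    using X by (auto simp: iid_uniform_def)
  have rv: "X i \<in> M \<rightarrow>\<^sub>M borel" if "i \<in> {1..N}" for i using indep that by (auto simp: indep_vars_def)
  have meas: "(\<lambda>\<omega>. \<lambda>i\<in>{1..N}. X i \<omega>) \<in> M \<rightarrow>\<^sub>M (\<Pi>\<^sub>M i\<in>{1..N}. borel)"
    using rv by (intro measurable_restrict) auto
  have law: "distr M (\<Pi>\<^sub>M i\<in>{1..N}. borel) (\<lambda>\<omega>. \<lambda>i\<in>{1..N}. X i \<omega>) = uniform_product N K"
  proof -
    have "distr M (\<Pi>\<^sub>M i\<in>{1..N}. borel) (\<lambda>\<omega>. \<lambda>i\<in>{1..N}. X i \<omega>) = (\<Pi>\<^sub>M i\<in>{1..N}. distr M borel (X i))"
      using indep indep_vars_iff_distr_eq_PiM'[where I = "{1..N}" and M' = "\<lambda>_. borel" and X = X] N rv by simp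
    also have "\<dots> = uniform_product N K"
      unfolding uniform_product_def using distr by (intro PiM_cong) auto
    finally show ?thesis .
  qed
  let ?F = "empirical_inverse_volume p N r"
  have eq: "vol_powr_neg (polar (empirical_centroid_body p N (\<lambda>i. X i \<omega>))) r = ?F (\<lambda>i\<in>{1..N}. X i \<omega>)" for \<omega>
    unfolding polar_empirical_centroid_body[OF p N] empirical_inverse_volume_def[symmetric]
    by (intro empirical_inverse_volume_cong) simp
  have "(\<integral>\<^sup>+\<omega>. ennreal (?F (\<lambda>i\<in>{1..N}. X i \<omega>)) \<partial>M) = expected_inverse_volume p N r K"
    unfolding expected_inverse_volume_def law[symmetric] using meas by (subst nn_integral_distr) auto
  moreover have "(\<lambda>\<omega>. ?F (\<lambda>i\<in>{1..N}. X i \<omega>)) \<in> borel_measurable M"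
    using meas by (rule measurable_compose) measurable
  ultimately show ?thesis
    unfolding eq by (subst integral_eq_nn_integral) (auto simp: empirical_inverse_volume_def)
qed

section \<open>The centroid body\<close>

text \<open>Here each point is its own index. Restricting the space, and not just the density, makes
  the supremum over the space one over \<open>K\<close>.\<close>

definition body_measure :: "(real^2) set \<Rightarrow> (real^2) measure" where
  "body_measure K = restrict_space lborel K"

lemma body_measure:
  assumes K: "compact K"
  shows "space (body_measure K) = K" "measure (body_measure K) K = measure lborel K"
    "integral\<^sup>L (body_measure K) f = (LINT x:K|lborel. (f x :: real))"
    "finite_measure (body_measure K)"
    "g \<in> borel_measurable borel \<Longrightarrow> g \<in> borel_measurable (body_measure K)"
proof -
  have [simp]: "K \<in> sets borel" using K by (rule borel_compact)
  show "space (body_measure K) = K" by (simp add: body_measure_def space_restrict_space)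
  show "measure (body_measure K) K = measure lborel K"
    unfolding body_measure_def by (rule measure_restrict_space) auto
  show "integral\<^sup>L (body_measure K) f = (LINT x:K|lborel. f x)"
    unfolding body_measure_def set_lebesgue_integral_def by (rule integral_restrict_space) simp
  show "finite_measure (body_measure K)"
    unfolding body_measure_def using emeasure_bounded_finite[OF compact_imp_bounded[OF K]]
    by (intro finite_measureI) (simp add: space_restrict_space emeasure_restrict_space)
  show "g \<in> borel_measurable borel \<Longrightarrow> g \<in> borel_measurable (body_measure K)"
    unfolding body_measure_def by (rule measurable_restrict_space1) simp
qed

lemma mean_norm_space_body:
  assumes K: "compact K" "0 < emeasure lborel K" and p: "1 \<le> p"
  shows "mean_norm_space (body_measure K) p"
proof -
  interpret finite_measure "body_measure K" by (rule body_measure(4)[OF K(1)])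
  have "0 < measure lborel K"
    using K(2) emeasure_bounded_finite[OF compact_imp_bounded[OF K(1)]] by (simp add: emeasure_eq_ennreal_measure)
  then show ?thesis by unfold_locales (simp_all add: p body_measure(1,2)[OF K(1)])
qed

lemma bounded_measurable_body:
  fixes f :: "real^2 \<Rightarrow> 'b::euclidean_space"
  assumes K: "compact K" and f: "continuous_on UNIV f"
  shows "f \<in> bounded_measurable (body_measure K)"
proof -
  have "bounded (f ` K)"
    using K f by (intro compact_imp_bounded compact_continuous_image) (auto intro: continuous_on_subset)
  then show ?thesis
    using body_measure(5)[OF K borel_measurable_continuous_onI[OF f]]
    by (simp add: bounded_measurable_def body_measure(1)[OF K])
qed

lemma polar_centroid_body:
  assumes K: "compact K" "0 < emeasure lborel K" and p: "1 \<le> p"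
  shows "polar (centroid_body p K) = polar_ball p (body_measure K) (\<lambda>x. x)"
proof -
  interpret mean_norm_space "body_measure K" p by (rule mean_norm_space_body[OF K p])
  have "(\<lambda>z. if p = \<infinity> then (SUP x\<in>K. \<bar>x \<bullet> z\<bar>)
     else (1 / measure lborel K * (LINT x:K|lborel. \<bar>x \<bullet> z\<bar> powr enn2real p)) powr (1 / enn2real p))
    = (\<lambda>z. mean_norm p (body_measure K) (\<lambda>x. x \<bullet> z))"
    by (simp add: fun_eq_iff mean_norm_def body_measure[OF K(1)])
  then show ?thesis
    unfolding centroid_body_def polar_ball_def
    using polar_body_of_support[OF seminorm_mean_norm[OF bounded_measurable_body[OF K(1) continuous_on_id]]] by simp
qed

lemma integral_area_scaling:
  fixes f :: "real^2 \<Rightarrow> real"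
  assumes T: "area_scaling c T" and K: "compact K" and f: "f \<in> borel_measurable borel"
  shows "(LINT x:T ` K|lborel. f x) = c * (LINT x:K|lborel. f (T x))"
proof -
  have c: "0 < c" using T by (simp add: area_scaling_def)
  note [measurable] = area_scaling_distr(1)[OF T] f
  have [measurable]: "K \<in> sets borel" "T ` K \<in> sets borel"
    using K area_scaling_distr(6)[OF T K] by (auto simp: borel_compact)
  have "lborel = density (distr lborel borel T) (\<lambda>_. ennreal c)"
  proof (rule measure_eqI)
    fix A :: "(real^2) set" assume A: "A \<in> sets lborel"
    then have "emeasure (density (distr lborel borel T) (\<lambda>_. ennreal c)) A = ennreal c * emeasure lborel (T -` A)"
      by (simp add: emeasure_density_const emeasure_distr)
    also have "\<dots> = emeasure lborel A"
      using c A by (simp add: area_scaling_distr(5)[OF T] flip: ennreal_mult mult.assoc)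
    finally show "emeasure lborel A = emeasure (density (distr lborel borel T) (\<lambda>_. ennreal c)) A" by simp
  qed simp
  then have "(LINT x:T ` K|lborel. f x) = (LINT x|density (distr lborel borel T) (\<lambda>_. ennreal c). indicator (T ` K) x * f x)"
    by (simp add: set_lebesgue_integral_def)
  also have "\<dots> = (LINT x|distr lborel borel T. c * (indicator (T ` K) x * f x))"
    using c by (subst integral_density) auto
  also have "\<dots> = (LINT x|lborel. c * (indicator (T ` K) (T x) * f (T x)))"
    by (subst integral_distr) auto
  also have "\<dots> = c * (LINT x:K|lborel. f (T x))"
    using area_scaling_distr(2)[OF T] by (simp add: set_lebesgue_integral_def indicator_image)
  finally show ?thesis .
qed

text \<open>Expresses the polar for the image through displaced points over the fixed index space
  \<open>K\<close>, the form in which \<open>vol_powr_neg_shadow_convex\<close> applies.\<close>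

lemma polar_ball_area_scaling:
  assumes T: "area_scaling c T" and K: "compact K"
  shows "polar_ball p (body_measure (T ` K)) (\<lambda>x. x) = polar_ball p (body_measure K) T"
proof -
  have c: "0 < c" using T by (simp add: area_scaling_def)
  have TK: "compact (T ` K)" by (rule area_scaling_distr(6)[OF T K])
  have meas: "measure lborel (T ` K) = c * measure lborel K"
    using area_scaling_distr(4)[OF T borel_compact[OF K]] c by (simp add: measure_def enn2real_mult)
  have "mean_norm p (body_measure (T ` K)) (\<lambda>x. x \<bullet> w) = mean_norm p (body_measure K) (\<lambda>x. T x \<bullet> w)" for w
    using c by (simp add: mean_norm_def body_measure[OF TK] body_measure[OF K] image_image meas integral_area_scaling[OF T K])
  then show ?thesis by (simp add: polar_ball_def)
qed

definition centroid_inverse_volume :: "ennreal \<Rightarrow> (real^2) set \<Rightarrow> ennreal" where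
  "centroid_inverse_volume p K = ennreal (vol_powr_neg (polar_ball p (body_measure K) (\<lambda>x. x)) 1)"

text \<open>For finite \<open>p\<close> the integral before normalization grows with the body, and
  the normalization costs \<open>l / k\<close> to the power \<open>1 / q\<close>, which is at most
  \<open>l / k\<close> since that ratio is at least 1. At \<open>p = \<infinity>\<close> the
  supremum itself is monotone.\<close>

lemma mean_norm_body_mono:
  assumes K: "compact K" "0 < emeasure lborel K" and L: "compact L" and KL: "K \<subseteq> L" and p: "1 \<le> p"
    and f: "continuous_on UNIV f"
  shows "mean_norm p (body_measure K) f \<le> measure lborel L / measure lborel K * mean_norm p (body_measure L) f"
proof -
  have borel: "K \<in> sets borel" "L \<in> sets borel" using K L by (auto simp: borel_compact)
  have posL: "0 < emeasure lborel L"
    using K(2) emeasure_mono[OF KL, of lborel] borel by (auto intro: less_le_trans)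
  interpret K: mean_norm_space "body_measure K" p by (rule mean_norm_space_body[OF K p])
  interpret L: mean_norm_space "body_measure L" p by (rule mean_norm_space_body[OF L posL p])
  define k where "k = measure lborel K"
  define l where "l = measure lborel L"
  have k: "0 < k" using K.total by (simp add: k_def body_measure[OF K(1)])
  have kl: "k \<le> l" unfolding k_def l_def
    using KL borel emeasure_bounded_finite[OF compact_imp_bounded[OF L]] by (intro measure_mono_fmeasurable) (auto simp: fmeasurable_def)
  have bK: "f \<in> bounded_measurable (body_measure K)" and bL: "f \<in> bounded_measurable (body_measure L)"
    using bounded_measurable_body[OF K(1) f] bounded_measurable_body[OF L f] by auto
  have \<rho>: "1 \<le> l / k" using k kl by simp
  show ?thesis
  proof (cases "p = \<infinity>")
    case True
    have "compact ((\<lambda>x. \<bar>f x\<bar>) ` L)"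
      using f by (intro compact_continuous_image continuous_intros L) (auto intro: continuous_on_subset)
    then have "bdd_above ((\<lambda>x. \<bar>f x\<bar>) ` L)" by (intro bounded_imp_bdd_above compact_imp_bounded)
    moreover have "K \<noteq> {}" using K(2) by auto
    ultimately have "mean_norm p (body_measure K) f \<le> mean_norm p (body_measure L) f"
      using True KL by (simp add: mean_norm_def body_measure[OF K(1)] body_measure[OF L] cSUP_subset_mono)
    also have "\<dots> \<le> l / k * mean_norm p (body_measure L) f"
      using mult_right_mono[OF \<rho> L.mean_norm_nonneg[OF bL]] by simp
    finally show ?thesis by (simp add: k_def l_def)
  next
    case False
    define q where "q = enn2real p"
    have q: "1 \<le> q" using K.p_finite[OF False] by (simp add: q_def)
    define I where "I = (\<lambda>A. LINT x:A|lborel. \<bar>f x\<bar> powr q)"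
    have "I K \<le> I L"
    proof -
      have "set_integrable lborel L (\<lambda>x. \<bar>f x\<bar> powr q)" "set_integrable lborel K (\<lambda>x. \<bar>f x\<bar> powr q)"
        using L.integrable_powr[OF bL, of q] K.integrable_powr[OF bK, of q] q borel
        by (simp_all add: body_measure_def set_integrable_def integrable_restrict_space)
      then show ?thesis
        unfolding I_def set_lebesgue_integral_def set_integrable_def
        using KL by (intro integral_mono) (auto split: split_indicator)
    qed
    have I0: "0 \<le> I A" for A unfolding I_def set_lebesgue_integral_def by (intro Bochner_Integration.integral_nonneg) auto
    have "I K / k \<le> l / k * (I L / l)"
      using \<open>I K \<le> I L\<close> k kl by (simp add: divide_right_mono)
    then have "(I K / k) powr (1 / q) \<le> (l / k * (I L / l)) powr (1 / q)"
      using q k I0 by (intro powr_mono2) auto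
    also have "\<dots> = (l / k) powr (1 / q) * (I L / l) powr (1 / q)"
      by (rule powr_mult)
    also have "\<dots> \<le> (l / k) powr 1 * (I L / l) powr (1 / q)"
      using q \<rho> by (intro mult_right_mono powr_mono) auto
    also have "(l / k) powr 1 = l / k" using k kl by simp
    finally show ?thesis
      using False by (simp add: mean_norm_def q_def[symmetric] body_measure[OF K(1)] body_measure[OF L] I_def k_def l_def)
  qed
qed

text \<open>The norms over \<open>K\<close> are at most \<open>\<rho>\<close> times those over
  \<open>L\<close>, so the ball for \<open>K\<close> contains the ball for \<open>L\<close> shrunk
  by the factor \<open>\<rho>\<close>; in the plane this costs \<open>\<rho>\<close> squared, whence
  the exponent 2. For \<open>shear\<close> the points of \<open>K\<close> are themselves the
  displaced family.\<close>

lemma planar_functional_centroid: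
  assumes p: "1 \<le> p"
  shows "planar_functional (centroid_inverse_volume p) 1 2"
proof
  show "0 \<le> (1::real)" "0 \<le> (2::real)" by auto
  fix K :: "(real^2) set" assume K: "compact K" "0 < emeasure lborel K"
  interpret K: mean_norm_space "body_measure K" p by (rule mean_norm_space_body[OF K p])
  note id_bm = bounded_measurable_body[OF K(1) continuous_on_id]
  show "centroid_inverse_volume p (T ` K) = ennreal (\<bar>det (matrix T)\<bar> powr 1) * centroid_inverse_volume p K"
    if T: "linear T" "det (matrix T) \<noteq> 0" for T
    unfolding centroid_inverse_volume_def polar_ball_area_scaling[OF area_scaling_linear[OF T] K(1)] polar_ball_linear[OF T(1)]
      vol_powr_neg_vimage[OF area_scaling_adjoint[OF T] K.polar_ball_borel[OF id_bm]]
    by (simp add: ennreal_mult)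
  show "centroid_inverse_volume p K \<le> ennreal ((measure lborel L / measure lborel K) powr 2) * centroid_inverse_volume p L"
    if L: "compact L" "K \<subseteq> L" for L
  proof -
    have posL: "0 < emeasure lborel L"
      using K(2) emeasure_mono[OF L(2), of lborel] L by (auto intro: less_le_trans borel_compact)
    interpret L: mean_norm_space "body_measure L" p by (rule mean_norm_space_body[OF L(1) posL p])
    define \<rho> where "\<rho> = measure lborel L / measure lborel K"
    have \<rho>: "0 < \<rho>" using K.total L.total by (simp add: \<rho>_def body_measure[OF K(1)] body_measure[OF L(1)])
    note L_bm = bounded_measurable_body[OF L(1) continuous_on_id]
    let ?S = "(\<lambda>w. \<rho> *\<^sub>R w) -` polar_ball p (body_measure L) (\<lambda>x. x)"
    have sub: "?S \<subseteq> polar_ball p (body_measure K) (\<lambda>x. x)"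
    proof
      fix w assume "w \<in> ?S"
      then have "\<rho> * mean_norm p (body_measure L) (\<lambda>x. x \<bullet> w) \<le> 1"
        using \<rho> seminormD(1)[OF L.seminorm_mean_norm[OF L_bm], of \<rho> w] by (simp add: polar_ball_def)
      moreover have "mean_norm p (body_measure K) (\<lambda>x. x \<bullet> w) \<le> \<rho> * mean_norm p (body_measure L) (\<lambda>x. x \<bullet> w)"
        unfolding \<rho>_def by (intro mean_norm_body_mono K L p continuous_intros)
      ultimately show "w \<in> polar_ball p (body_measure K) (\<lambda>x. x)" by (simp add: polar_ball_def)
    qed
    have "0 < emeasure lborel ?S"
      using area_scaling_distr(5)[OF area_scaling_homothety[OF \<rho>] L.polar_ball_borel[OF L_bm]] L.polar_ball_pos[OF L_bm] \<rho>
      by (simp add: ennreal_zero_less_mult_iff)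
    then have "vol_powr_neg (polar_ball p (body_measure K) (\<lambda>x. x)) 1 \<le> vol_powr_neg ?S 1"
      using sub K.polar_ball_borel[OF id_bm] by (intro vol_powr_neg_antimono) auto
    also have "\<dots> = \<rho> powr 2 * vol_powr_neg (polar_ball p (body_measure L) (\<lambda>x. x)) 1"
      using vol_powr_neg_vimage[OF area_scaling_homothety[OF \<rho>] L.polar_ball_borel[OF L_bm]] \<rho> by simp
    finally show ?thesis
      unfolding centroid_inverse_volume_def \<rho>_def by (simp add: ennreal_leI flip: ennreal_mult)
  qed
  fix e :: "real^2" and h s t :: real
  assume e: "e \<noteq> 0" and h: "0 \<le> h" and st: "0 < s" "0 < t"
  define \<alpha> where "\<alpha> = t / (s + t)"
  define \<beta> where "\<beta> = s / (s + t)"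
  have ab: "0 < \<alpha>" "0 < \<beta>" "\<alpha> + \<beta> = 1" using st by (auto simp: \<alpha>_def \<beta>_def add_divide_distrib[symmetric])
  have zero: "\<alpha> * (- s) + \<beta> * t = 0" by (simp add: \<alpha>_def \<beta>_def)
  define g where "g = (\<lambda>x. max 0 (cross2 e x - h) - max 0 (- cross2 e x - h))"
  have g: "continuous_on UNIV g" unfolding g_def by (intro continuous_intros)
  let ?V = "\<lambda>x. vol_powr_neg (polar_ball p (body_measure K) x) 1"
  have "?V (\<lambda>x. x) \<le> \<alpha> * ?V (cap_shear e h (- s)) + \<beta> * ?V (cap_shear e h t)"
    using K.vol_powr_neg_shadow_convex[OF id_bm bounded_measurable_body[OF K(1) g] e ab order_refl, of "- s" t]
    unfolding zero by (simp add: polar_ball_def cross2.cap_shear_def g_def)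
  then show "centroid_inverse_volume p K \<le> ennreal (t / (s + t)) * centroid_inverse_volume p (cap_shear e h (- s) ` K)
      + ennreal (s / (s + t)) * centroid_inverse_volume p (cap_shear e h t ` K)"
    unfolding centroid_inverse_volume_def polar_ball_area_scaling[OF area_scaling_cap_shear[OF h] K(1)]
      \<alpha>_def[symmetric] \<beta>_def[symmetric]
    using ab by (simp add: ennreal_leI flip: ennreal_mult ennreal_plus)
qed

theorem theorem1p2:
  fixes K Q :: "(real^2) set" and p :: ennreal
  assumes "convex_body K" and "centrally_symmetric K"
    and "centered_square Q" and "emeasure lborel Q = emeasure lborel K"
    and "1 \<le> p"
  shows "(\<forall>(N::nat) (r::real) (M :: 'v measure) X (M' :: 'w measure) Y.
            2 \<le> N \<and> 1 \<le> r \<and> iid_uniform M N X K \<and> iid_uniform M' N Y Q \<longrightarrow>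
            prob_space.expectation M
              (\<lambda>\<omega>. vol_powr_neg (polar (empirical_centroid_body p N (\<lambda>i. X i \<omega>))) r)
            \<le> prob_space.expectation M'
              (\<lambda>\<omega>. vol_powr_neg (polar (empirical_centroid_body p N (\<lambda>i. Y i \<omega>))) r))
       \<and> emeasure lborel (polar (centroid_body p K)) \<ge> emeasure lborel (polar (centroid_body p Q))"
proof -
  have cK: "compact K" using assms(1) by (simp add: convex_body_def)
  have posK: "0 < emeasure lborel K"
    using assms(1) by (intro emeasure_lborel_pos) (auto simp: convex_body_def borel_compact)
  have Q: "compact Q" "0 < emeasure lborel Q"
    using compact_centered_square[OF assms(3)] posK assms(4) by simp_all
  have expected: "prob_space.expectation M
        (\<lambda>\<omega>. vol_powr_neg (polar (empirical_centroid_body p N (\<lambda>i. X i \<omega>))) r)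
      \<le> prob_space.expectation M'
        (\<lambda>\<omega>. vol_powr_neg (polar (empirical_centroid_body p N (\<lambda>i. Y i \<omega>))) r)"
    if N: "2 \<le> N" and r: "1 \<le> r" and X: "iid_uniform M N X K" and Y: "iid_uniform M' N Y Q"
    for N r and M :: "'v measure" and X and M' :: "'w measure" and Y
  proof -
    have N1: "1 \<le> N" using N by simp
    interpret planar_functional "expected_inverse_volume p N r" r "real N"
      by (rule planar_functional_expected[OF assms(5) N1 r])
    have "expected_inverse_volume p N r K \<le> expected_inverse_volume p N r Q"
      by (rule symmetric_body_le_square[OF assms(1-4)])
    moreover have "expected_inverse_volume p N r Q < \<infinity>"
      by (rule expected_inverse_volume_finite[OF Q assms(5) N1 r])
    ultimately show ?thesis
      unfolding expectation_iid_uniform[OF X assms(5) N1] expectation_iid_uniform[OF Y assms(5) N1]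
      by (intro enn2real_mono) auto
  qed
  have "emeasure lborel (polar (centroid_body p Q)) \<le> emeasure lborel (polar (centroid_body p K))"
  proof -
    interpret planar_functional "centroid_inverse_volume p" 1 2
      by (rule planar_functional_centroid[OF assms(5)])
    interpret mK: mean_norm_space "body_measure K" p by (rule mean_norm_space_body[OF cK posK assms(5)])
    interpret mQ: mean_norm_space "body_measure Q" p by (rule mean_norm_space_body[OF Q assms(5)])
    define A where "A = polar_ball p (body_measure K) (\<lambda>x. x)"
    define B where "B = polar_ball p (body_measure Q) (\<lambda>x. x)"
    have pos: "0 < emeasure lborel A" "0 < emeasure lborel B"
      unfolding A_def B_def
      by (intro mK.polar_ball_pos mQ.polar_ball_pos bounded_measurable_body cK Q continuous_on_id)+
    have "vol_powr_neg A 1 \<le> vol_powr_neg B 1"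
      using symmetric_body_le_square[OF assms(1-4)] by (simp add: centroid_inverse_volume_def A_def B_def)
    then have "emeasure lborel B \<le> emeasure lborel A"
    \<comment> \<open>If \<open>A\<close> has finite area, its inverse area is positive, hence so is
      that of \<open>B\<close>; this excludes an infinite area of \<open>B\<close>, which the
      convention would map to 0.\<close>
    proof (cases "emeasure lborel A = \<infinity>")
      case False
      then have A: "emeasure lborel A = ennreal (measure lborel A)" by (simp add: emeasure_eq_ennreal_measure)
      then have A0: "0 < measure lborel A" using pos by simp
      with False have "0 < vol_powr_neg A 1" by (simp add: vol_powr_neg_def)
      with \<open>vol_powr_neg A 1 \<le> vol_powr_neg B 1\<close> have finB: "emeasure lborel B \<noteq> \<infinity>"
        by (auto simp: vol_powr_neg_def)
      then have B: "emeasure lborel B = ennreal (measure lborel B)" by (simp add: emeasure_eq_ennreal_measure)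
      then have B0: "0 < measure lborel B" using pos by simp
      have "inverse (measure lborel A) \<le> inverse (measure lborel B)"
        using \<open>vol_powr_neg A 1 \<le> vol_powr_neg B 1\<close> False finB A0 B0
        by (simp add: vol_powr_neg_def powr_minus)
      then have "measure lborel B \<le> measure lborel A" using A0 B0 by (simp add: inverse_le_iff_le)
      then show ?thesis unfolding A B by (rule ennreal_leI)
    qed simp
    then show ?thesis
      unfolding polar_centroid_body[OF cK posK assms(5)] polar_centroid_body[OF Q assms(5)] A_def B_def .
  qed
  then show ?thesis using expected by blast
qed

end
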